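(* The operator $\mathcal U^{1/2}=\mathcal L^{1/2}(\mathcal I+\mathcal L)^{-1/2}$ on $\mathbb R^n$, where $\mathcal L=-\Delta$, is bounded and injective, but not surjective, from $\mathfrak h^1(\mathbb R^n)$ to $H^1(\mathbb R^n)$. Thus, the space $H^1(\mathbb R^n)$ contains $\mathcal U^{1/2}[\mathfrak h^1(\mathbb R^n)]$ properly.
   Context: $\Delta$ is the standard Laplacian on $\mathbb R^n$; $\mathcal U^{1/2}$ is the Fourier multiplier operator with symbol $|\xi|/\sqrt{1+|\xi|^2}$. $H^1(\mathbb R^n)$ is the classical real Hardy space, i.e. $\{f\in L^1(\mathbb R^n):|\nabla\mathcal L^{-1/2}f|\in L^1(\mathbb R^n)\}$ with norm $\|f\|_{L^1}+\||\nabla\mathcal L^{-1/2}f|\|_{L^1}$. $\mathfrak h^1(\mathbb R^n)$ is the local Hardy space of Goldberg; it consists of all $f\in L^1(\mathbb R^n)$ of the form $f=\sum_{j\ge1}\lambda_ja_j$, $\sum_j|\lambda_j|<\infty$, where each $a_j$ is either supported in a ball $B$ of radius at most one with $\|a_j\|_2\le|B|^{-1/2}$ and $\int a_j=0$, or supported in a ball $B$ of radius exactly one with $\|a_j\|_2\le|B|^{-1/2}$; the norm is the infimum of $\sum_j|\lambda_j|$. Equivalently (with equivalent norms), $\mathfrak h^1(\mathbb R^n)=\{f\in L^1(\mathbb R^n):|\nabla(\mathcal I+\mathcal L)^{-1/2}f|\in L^1(\mathbb R^n)\}$. *)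

theory Defs
  imports "HOL-Analysis.Analysis"
begin

text \<open>
  Elements of \<open>L\<^sup>1(\<real>\<^sup>n)\<close> are represented by complex-valued, Lebesgue integrable Borel functions on
  \<open>real ^ 'n\<close>. Equality in \<open>L\<^sup>1\<close> is equality almost everywhere, and the sets of functions below are
  closed under changing the (Borel) representative.

  The Fourier transform carries no \<open>2 \<pi>\<close> in the exponent, so that \<open>- \<Delta>\<close> has the symbol
  \<open>\<bar>\<xi>\<bar>\<^sup>2\<close> and \<open>\<nabla>\<close> has the symbol \<open>\<i> \<xi>\<close>.
\<close>

definition fourier :: "(real ^ 'n \<Rightarrow> complex) \<Rightarrow> real ^ 'n \<Rightarrow> complex" where
  "fourier f \<xi> = (LINT x|lborel. cis (- (x \<bullet> \<xi>)) * f x)"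

text \<open>
  \<open>fourier_multiplier m f g\<close> says that \<open>g \<in> L\<^sup>1\<close> is the image of \<open>f \<in> L\<^sup>1\<close> under the Fourier
  multiplier operator with symbol \<open>m\<close>. It is a relation because the image, a priori only a tempered
  distribution, need not be an \<open>L\<^sup>1\<close> function. Almost everywhere suffices for an identity between
  tempered distributions, and makes the value of a singular symbol at the origin irrelevant.
\<close>

definition fourier_multiplier ::
    "(real ^ 'n \<Rightarrow> complex) \<Rightarrow> (real ^ 'n \<Rightarrow> complex) \<Rightarrow> (real ^ 'n \<Rightarrow> complex) \<Rightarrow> bool" where
  "fourier_multiplier m f g \<longleftrightarrow>
     integrable lborel f \<and> integrable lborel g \<and>
     (AE \<xi> in lborel. fourier g \<xi> = m \<xi> * fourier f \<xi>)"

definition U_half :: "(real ^ 'n \<Rightarrow> complex) \<Rightarrow> (real ^ 'n \<Rightarrow> complex) \<Rightarrow> bool" where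
  "U_half = fourier_multiplier (\<lambda>\<xi>. complex_of_real (norm \<xi> / sqrt (1 + (norm \<xi>)\<^sup>2)))"

text \<open>
  \<open>riesz_gradient f G\<close>: the vector field \<open>G\<close> is \<open>\<nabla> L\<^sup>-\<^sup>1\<^sup>/\<^sup>2 f\<close> (with \<open>L = - \<Delta>\<close>), all of whose
  components lie in \<open>L\<^sup>1\<close>; equivalently, its length, the Euclidean norm on \<open>complex ^ 'n\<close>, does.
\<close>

definition riesz_gradient :: "(real ^ 'n \<Rightarrow> complex) \<Rightarrow> (real ^ 'n \<Rightarrow> complex ^ 'n) \<Rightarrow> bool" where
  "riesz_gradient f G \<longleftrightarrow>
     (\<forall>j. fourier_multiplier (\<lambda>\<xi>. \<i> * complex_of_real (\<xi> $ j / norm \<xi>)) f (\<lambda>x. G x $ j))"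

definition hardy_H1 :: "(real ^ 'n \<Rightarrow> complex) set" where
  "hardy_H1 = {f. integrable lborel f \<and> (\<exists>G. riesz_gradient f G)}"

text \<open>On \<^const>\<open>hardy_H1\<close> the choice is harmless: the gradient is unique almost everywhere.\<close>

definition H1_norm :: "(real ^ 'n \<Rightarrow> complex) \<Rightarrow> real" where
  "H1_norm f = (LINT x|lborel. norm (f x)) +
     (LINT x|lborel. norm ((SOME G. riesz_gradient f G) x))"

text \<open>The integrability assumption on \<open>\<bar>a\<bar>\<^sup>2\<close> is needed as non-integrable functions have integral 0.\<close>

definition local_atom :: "(real ^ 'n \<Rightarrow> complex) \<Rightarrow> bool" where
  "local_atom a \<longleftrightarrow>
     a \<in> borel_measurable lborel \<and> integrable lborel (\<lambda>x. (norm (a x))\<^sup>2) \<and>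
     (\<exists>c r. 0 < r \<and>
        (AE x in lborel. x \<notin> ball c r \<longrightarrow> a x = 0) \<and>
        sqrt (LINT x|lborel. (norm (a x))\<^sup>2) \<le> measure lborel (ball c r) powr (- 1 / 2) \<and>
        (r \<le> 1 \<and> (LINT x|lborel. a x) = 0 \<or> r = 1))"

text \<open>
  The series \<open>\<Sum>j. \<lambda>\<^sub>j a\<^sub>j\<close> is summed in \<open>L\<^sup>1\<close>, where it converges absolutely because atoms have
  \<open>L\<^sup>1\<close> norm at most 1.
\<close>

definition atomic_decomposition ::
    "(real ^ 'n \<Rightarrow> complex) \<Rightarrow> (nat \<Rightarrow> complex) \<Rightarrow> (nat \<Rightarrow> real ^ 'n \<Rightarrow> complex) \<Rightarrow> bool" where
  "atomic_decomposition f l a \<longleftrightarrow>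
     (\<forall>j. local_atom (a j)) \<and> summable (\<lambda>j. norm (l j)) \<and>
     (\<lambda>N. LINT x|lborel. norm (f x - (\<Sum>j<N. l j * a j x))) \<longlonglongrightarrow> 0"

definition local_hardy_h1 :: "(real ^ 'n \<Rightarrow> complex) set" where
  "local_hardy_h1 = {f. integrable lborel f \<and> (\<exists>l a. atomic_decomposition f l a)}"

definition h1_norm :: "(real ^ 'n \<Rightarrow> complex) \<Rightarrow> real" where
  "h1_norm f = Inf {\<Sum>j. norm (l j) | l a. atomic_decomposition f l a}"

end

theory Submission
  imports Defs "HOL-Probability.Probability"
begin

text \<open>
  The proof rests on subordination to the Gaussians \<open>gauss s\<close>, whose Fourier transforms are
  \<open>exp (- s\<^sup>2 \<bar>\<xi>\<bar>\<^sup>2 / 2)\<close>: the Bessel kernel and the Riesz transforms are integrals over the scale \<open>s\<close> of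
  Gaussians and of their derivatives, and Fubini's theorem (lemma \<open>superposition\<close>) gives both \<open>L\<^sup>1\<close> bounds and symbols.

  \<^emph>\<open>The operator itself.\<close> Already on \<open>L\<^sup>1\<close> the operator \<open>U\<^sup>1\<^sup>/\<^sup>2\<close> is bounded. With
  \<open>z = 1 / (1 + \<bar>\<xi>\<bar>\<^sup>2)\<close> its symbol is \<open>sqrt (1 - z)\<close>, the binomial series of which is absolutely
  summable up to \<open>z = 1\<close>, and \<open>z\<close> is the symbol of the convolution with the Bessel kernel, which has
  \<open>L\<^sup>1\<close> norm at most 1 (\<open>bessel_kernel\<close>, \<open>U_half_exists\<close>).

  \<^emph>\<open>The gradient.\<close> If \<open>g = U\<^sup>1\<^sup>/\<^sup>2 f\<close>, then \<open>\<nabla> L\<^sup>-\<^sup>1\<^sup>/\<^sup>2 g = \<nabla> (I + L)\<^sup>-\<^sup>1\<^sup>/\<^sup>2 f\<close>, so it remains to bound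
  the local Riesz transforms \<open>\<partial>\<^sub>j (I + L)\<^sup>-\<^sup>1\<^sup>/\<^sup>2\<close> from atoms to \<open>L\<^sup>1\<close>, uniformly (\<open>riesz_atom\<close>). They are
  written as \<open>sqrt (2 / \<pi>) \<integral> exp (- s\<^sup>2 / 2) \<partial>\<^sub>j gauss s ds\<close>, and for an atom supported in a ball \<open>B\<close> of
  radius \<open>r\<close> the integral is split at \<open>s = r\<close>. On the scales \<open>s \<ge> r\<close> it converges absolutely in \<open>L\<^sup>1\<close>,
  by the cancellation of the atom or, if \<open>r = 1\<close>, by the factor \<open>exp (- s\<^sup>2 / 2)\<close>. On the
  scales \<open>s < r\<close> the Gaussian tails control it off \<open>2B\<close>, and Plancherel's inequality together with
  the Cauchy-Schwarz inequality controls it on \<open>2B\<close>. The integral over the small scales need not converge absolutely,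
  but these bounds tend to 0 with the scale, so that the truncations form a Cauchy sequence in \<open>L\<^sup>1\<close>.

  \<^emph>\<open>Injectivity\<close> holds because the symbol vanishes only at the origin and the Fourier
  transform is injective on \<open>L\<^sup>1\<close> (\<open>fourier_unique\<close>).

  \<^emph>\<open>The range is proper.\<close> The function \<open>\<partial>\<^sub>i gauss 1\<close> lies in \<open>H\<^sup>1\<close> (\<open>riesz_dgauss\<close>). The Fourier transform
  of a preimage would behave like \<open>\<i> \<xi>\<^sub>i / \<bar>\<xi>\<bar>\<close> near the origin, whereas the Fourier transform of an
  \<open>L\<^sup>1\<close> function is continuous (\<open>no_preimage_dgauss\<close>).
\<close>

section \<open>Limits in \<open>L\<^sup>1\<close>\<close>

abbreviation norm1 :: "(real ^ 'n \<Rightarrow> 'b :: real_normed_vector) \<Rightarrow> real" where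
  "norm1 f \<equiv> (LINT x|lborel. norm (f x))"

abbreviation dist1 :: "(real ^ 'n \<Rightarrow> complex) \<Rightarrow> (real ^ 'n \<Rightarrow> complex) \<Rightarrow> real" where
  "dist1 f g \<equiv> (LINT x|lborel. norm (f x - g x))"

text \<open>The square of the \<open>L\<^sup>2\<close> norm is extended real valued, hence meaningful for every measurable function.\<close>

abbreviation norm2_sq :: "(real ^ 'n \<Rightarrow> complex) \<Rightarrow> ennreal" where
  "norm2_sq f \<equiv> (\<integral>\<^sup>+x. ennreal ((norm (f x))\<^sup>2) \<partial>lborel)"

lemma L1_series:
  fixes f :: "nat \<Rightarrow> 'a \<Rightarrow> complex"
  assumes f [measurable]: "\<And>i. integrable M (f i)"
    and sum: "summable (\<lambda>i. LINT x|M. norm (f i x))"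
  obtains F where "integrable M F"
    "(\<lambda>N. LINT x|M. norm (F x - (\<Sum>i<N. f i x))) \<longlonglongrightarrow> 0"
    "(LINT x|M. norm (F x)) \<le> (\<Sum>i. LINT x|M. norm (f i x))"
proof -
  have "(\<integral>\<^sup>+x. (\<Sum>i. ennreal (norm (f i x))) \<partial>M) = (\<Sum>i. \<integral>\<^sup>+x. norm (f i x) \<partial>M)"
    by (intro nn_integral_suminf) auto
  also have "\<dots> = (\<Sum>i. ennreal (LINT x|M. norm (f i x)))"
    by (intro suminf_cong nn_integral_eq_integral integrable_norm f) auto
  also have "\<dots> \<noteq> \<infinity>"
    using sum by (simp add: ennreal_suminf_neq_top)
  finally have "AE x in M. (\<Sum>i. ennreal (norm (f i x))) \<noteq> \<infinity>"
    by (intro nn_integral_PInf_AE) auto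
  then have ae: "AE x in M. summable (\<lambda>i. norm (f i x))"
    by eventually_elim (auto intro: summable_suminf_not_top)
  define F where "F x = (\<Sum>i. f i x)" for x
  have F: "integrable M F"
    unfolding F_def by (rule integrable_suminf[OF f ae sum])
  have tail: "(LINT x|M. norm (F x - (\<Sum>i<N. f i x))) \<le> (\<Sum>i. LINT x|M. norm (f (i + N) x))" for N
  proof -
    have s: "AE x in M. summable (\<lambda>i. norm (norm (f (i + N) x)))"
      using ae by eventually_elim (drule summable_ignore_initial_segment[where k = N], simp)
    have s': "summable (\<lambda>i. LINT x|M. norm (norm (f (i + N) x)))"
      using summable_ignore_initial_segment[OF sum, of N] by simp
    have "(LINT x|M. norm (F x - (\<Sum>i<N. f i x))) \<le> (LINT x|M. (\<Sum>i. norm (f (i + N) x)))"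
    proof (rule integral_mono_AE)
      show "integrable M (\<lambda>x. norm (F x - (\<Sum>i<N. f i x)))"
        using F f by auto
      show "integrable M (\<lambda>x. \<Sum>i. norm (f (i + N) x))"
        by (rule integrable_suminf[OF _ s s']) (use f in auto)
      show "AE x in M. norm (F x - (\<Sum>i<N. f i x)) \<le> (\<Sum>i. norm (f (i + N) x))"
        using ae
      proof eventually_elim
        case (elim x)
        then have sx: "summable (\<lambda>i. f i x)" by (rule summable_norm_cancel)
        have "F x - (\<Sum>i<N. f i x) = (\<Sum>i. f (i + N) x)"
          unfolding F_def using suminf_minus_initial_segment[OF sx, of N] by simp
        also have "norm \<dots> \<le> (\<Sum>i. norm (f (i + N) x))"
          by (rule summable_norm) (use summable_ignore_initial_segment[OF elim, of N] in simp)
        finally show ?case .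
      qed
    qed
    also have "\<dots> = (\<Sum>i. LINT x|M. norm (f (i + N) x))"
      by (rule integral_suminf[OF _ s s']) (use f in auto)
    finally show ?thesis .
  qed
  have "(\<lambda>N. LINT x|M. norm (F x - (\<Sum>i<N. f i x))) \<longlonglongrightarrow> 0"
  proof (rule tendsto_sandwich[OF _ _ tendsto_const])
    show "(\<lambda>N. \<Sum>i. LINT x|M. norm (f (i + N) x)) \<longlonglongrightarrow> 0"
      using suminf_exist_split2[OF sum] .
  qed (use tail in auto)
  moreover have "(LINT x|M. norm (F x)) \<le> (\<Sum>i. LINT x|M. norm (f i x))"
    using tail[of 0] by simp
  ultimately show ?thesis using F that by blast
qed

lemma L1_norm_triangle:
  fixes f g h :: "'a \<Rightarrow> complex"
  assumes "integrable M f" "integrable M g" "integrable M h"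
  shows "(LINT x|M. norm (f x - h x)) \<le> (LINT x|M. norm (f x - g x)) + (LINT x|M. norm (g x - h x))"
proof -
  have "(LINT x|M. norm (f x - h x)) \<le> (LINT x|M. norm (f x - g x) + norm (g x - h x))"
    using assms by (intro integral_mono) (auto intro: norm_triangle_sub order_trans[OF _ norm_triangle_ineq])
  also have "\<dots> = (LINT x|M. norm (f x - g x)) + (LINT x|M. norm (g x - h x))"
    using assms by (intro Bochner_Integration.integral_add) auto
  finally show ?thesis .
qed

lemma L1_complete:
  fixes u :: "nat \<Rightarrow> 'a \<Rightarrow> complex"
  assumes u: "\<And>i. integrable M (u i)"
    and cauchy: "\<And>e. 0 < e \<Longrightarrow> \<exists>N. \<forall>k\<ge>N. \<forall>l\<ge>N. (LINT x|M. norm (u k x - u l x)) < e"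
  obtains F where "integrable M F" "(\<lambda>i. LINT x|M. norm (F x - u i x)) \<longlonglongrightarrow> 0"
proof -
  define P where "P i N \<longleftrightarrow> (\<forall>k\<ge>N. \<forall>l\<ge>N. (LINT x|M. norm (u k x - u l x)) < (1/2)^i)"
    for i :: nat and N :: nat
  have P: "\<exists>N. P i N" for i
    unfolding P_def by (rule cauchy) simp
  define N where "N i = (SOME N. P i N)" for i
  have N: "P i (N i)" for i
    unfolding N_def using P by (rule someI_ex)
  \<comment> \<open>A subsequence along which consecutive differences are summable.\<close>
  define n where "n i = (\<Sum>j\<le>i. N j) + i" for i
  have nN: "N i \<le> n i" "n i \<le> n (Suc i)" "i \<le> n i" for i
    unfolding n_def by (auto intro: trans_le_add1 member_le_sum)
  define v where "v i x = u (n (Suc i)) x - u (n i) x" for i x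
  have v: "integrable M (v i)" for i unfolding v_def using u by auto
  have small: "(LINT x|M. norm (v i x)) \<le> (1/2)^i" for i
    using N[of i] nN[of i] unfolding P_def v_def by (auto intro: less_imp_le)
  have "summable (\<lambda>i. LINT x|M. norm (v i x))"
    by (rule summable_comparison_test'[of "\<lambda>i. (1/2)^i" 0]) (use small in auto)
  from L1_series[OF v this] obtain G where G: "integrable M G"
    and lim: "(\<lambda>k. LINT x|M. norm (G x - (\<Sum>i<k. v i x))) \<longlonglongrightarrow> 0" by blast
  have tel: "(\<Sum>i<k. v i x) = u (n k) x - u (n 0) x" for k x
    unfolding v_def by (rule sum_lessThan_telescope)
  define F where "F x = G x + u (n 0) x" for x
  have F: "integrable M F" unfolding F_def using G u by auto
  have limF: "(\<lambda>k. LINT x|M. norm (F x - u (n k) x)) \<longlonglongrightarrow> 0"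
    using lim unfolding tel F_def by (simp add: algebra_simps)
  have "(\<lambda>i. LINT x|M. norm (F x - u i x)) \<longlonglongrightarrow> 0"
  proof (rule LIMSEQ_I)
    fix e :: real assume e: "0 < e"
    from cauchy[of "e/2"] e obtain K where
      K: "\<And>k l. k \<ge> K \<Longrightarrow> l \<ge> K \<Longrightarrow> (LINT x|M. norm (u k x - u l x)) < e/2" by auto
    from LIMSEQ_D[OF limF, of "e/2"] e obtain j0 where
      j0: "\<And>j. j \<ge> j0 \<Longrightarrow> \<bar>LINT x|M. norm (F x - u (n j) x)\<bar> < e/2" by auto
    define j where "j = max j0 K"
    have j: "j \<ge> j0" "n j \<ge> K"
      using nN(3)[of j] unfolding j_def by auto
    show "\<exists>no. \<forall>i\<ge>no. norm ((LINT x|M. norm (F x - u i x)) - 0) < e"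
    proof (intro exI allI impI)
      fix i assume i: "K \<le> i"
      have "(LINT x|M. norm (F x - u i x))
          \<le> (LINT x|M. norm (F x - u (n j) x)) + (LINT x|M. norm (u (n j) x - u i x))"
        by (rule L1_norm_triangle[OF F u u])
      also have "\<dots> < e/2 + e/2"
        using j0[OF j(1)] K[OF j(2) i] by linarith
      finally show "norm ((LINT x|M. norm (F x - u i x)) - 0) < e" by simp
    qed
  qed
  then show ?thesis using F that by blast
qed

text \<open>A form of Tonelli's criterion with a bound for the inner integrals.\<close>

lemma integrable_pairI:
  fixes k :: "'a \<Rightarrow> 'b \<Rightarrow> complex"
  assumes "sigma_finite_measure M" "sigma_finite_measure N"
    and meas: "(\<lambda>(t, x). k t x) \<in> borel_measurable (M \<Otimes>\<^sub>M N)"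
    and int: "\<And>t. t \<in> space M \<Longrightarrow> integrable N (k t)"
    and le: "\<And>t. t \<in> space M \<Longrightarrow> (LINT x|N. norm (k t x)) \<le> B t"
    and B: "integrable M B"
  shows "integrable (M \<Otimes>\<^sub>M N) (\<lambda>(t, x). k t x)"
proof -
  interpret pair_sigma_finite M N using assms(1,2) by (simp add: pair_sigma_finite_def)
  have [measurable]: "(\<lambda>p. k (fst p) (snd p)) \<in> borel_measurable (M \<Otimes>\<^sub>M N)"
    using meas by (simp add: case_prod_beta')
  show ?thesis
  proof (rule Fubini_integrable[OF meas], unfold prod.case)
    show "integrable M (\<lambda>t. LINT x|N. norm (k t x))"
    proof (rule Bochner_Integration.integrable_bound[OF B])
      have "(\<lambda>t. LINT x|N. norm (k (fst (t, x)) (snd (t, x)))) \<in> borel_measurable M"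
        by measurable
      then show "(\<lambda>t. LINT x|N. norm (k t x)) \<in> borel_measurable M" by simp
      show "AE t in M. norm (LINT x|N. norm (k t x)) \<le> norm (B t)"
        using le by (auto intro!: AE_I2 order_trans[OF _ abs_ge_self])
    qed
    show "AE t in M. integrable N (k t)" using int by (intro AE_I2)
  qed
qed

section \<open>The Fourier transform on \<open>L\<^sup>1\<close>\<close>

lemma cis_measurable [measurable (raw)]:
  assumes [measurable]: "f \<in> borel_measurable M"
  shows "(\<lambda>t. cis (f t)) \<in> borel_measurable M"
proof -
  have "cis \<in> borel_measurable borel"
    by (intro borel_measurable_continuous_onI continuous_on_cis continuous_on_id)
  from measurable_compose[OF assms this] show ?thesis .
qed

lemma integrable_cis_mult [simp]:
  fixes f :: "real ^ 'n \<Rightarrow> complex"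
  assumes "integrable lborel f"
  shows "integrable lborel (\<lambda>x. cis (- (x \<bullet> \<xi>)) * f x)"
  by (rule Bochner_Integration.integrable_bound[OF assms])
     (use borel_measurable_integrable[OF assms] in \<open>auto simp: norm_mult\<close>)

lemma fourier_bound:
  assumes "integrable lborel f"
  shows "norm (fourier f \<xi>) \<le> norm1 f"
proof -
  have "norm (fourier f \<xi>) \<le> (LINT x|lborel. norm (cis (- (x \<bullet> \<xi>)) * f x))"
    unfolding fourier_def by (rule integral_norm_bound)
  then show ?thesis by (simp add: norm_mult)
qed

lemma fourier_diff:
  assumes "integrable lborel f" "integrable lborel g"
  shows "fourier (\<lambda>x. f x - g x) \<xi> = fourier f \<xi> - fourier g \<xi>"
  using assms by (simp add: fourier_def right_diff_distrib)

lemma fourier_cmult: "fourier (\<lambda>x. c * f x) \<xi> = c * fourier f \<xi>"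
  by (simp add: fourier_def mult.left_commute[of _ c])

lemma fourier_sum:
  assumes "\<And>i. i \<in> I \<Longrightarrow> integrable lborel (f i)"
  shows "fourier (\<lambda>x. \<Sum>i\<in>I. f i x) \<xi> = (\<Sum>i\<in>I. fourier (f i) \<xi>)"
  using assms unfolding fourier_def sum_distrib_left
  by (intro Bochner_Integration.integral_sum integrable_cis_mult)

lemma fourier_tendsto:
  assumes "\<And>i. integrable lborel (u i)" "integrable lborel F"
    and "(\<lambda>i. LINT x|lborel. norm (F x - u i x)) \<longlonglongrightarrow> 0"
  shows "(\<lambda>i. fourier (u i) \<xi>) \<longlonglongrightarrow> fourier F \<xi>"
proof (rule Lim_null[THEN iffD2], rule Lim_null_comparison[OF always_eventually assms(3)], rule allI)
  fix i
  have "norm (fourier (u i) \<xi> - fourier F \<xi>) = norm (fourier (\<lambda>x. F x - u i x) \<xi>)"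
    using assms by (simp add: fourier_diff norm_minus_commute)
  also have "\<dots> \<le> dist1 F (u i)"
    using assms by (intro fourier_bound) auto
  finally show "norm (fourier (u i) \<xi> - fourier F \<xi>) \<le> dist1 F (u i)" .
qed

lemma L1_norm_tendsto:
  fixes u :: "nat \<Rightarrow> 'a \<Rightarrow> complex"
  assumes "\<And>i. integrable M (u i)" "integrable M F"
    and "(\<lambda>i. LINT x|M. norm (F x - u i x)) \<longlonglongrightarrow> 0"
  shows "(\<lambda>i. LINT x|M. norm (u i x)) \<longlonglongrightarrow> (LINT x|M. norm (F x))"
proof (rule Lim_null[THEN iffD2], rule Lim_null_comparison[OF always_eventually assms(3)], rule allI)
  fix i
  have "norm ((LINT x|M. norm (u i x)) - (LINT x|M. norm (F x)))
      = norm (LINT x|M. norm (u i x) - norm (F x))"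
    using assms by simp
  also have "\<dots> \<le> (LINT x|M. norm (norm (u i x) - norm (F x)))"
    by (rule integral_norm_bound)
  also have "\<dots> \<le> (LINT x|M. norm (F x - u i x))"
    using assms by (intro integral_mono) (auto intro: order_trans[OF norm_triangle_ineq3] simp: norm_minus_commute)
  finally show "norm ((LINT x|M. norm (u i x)) - (LINT x|M. norm (F x)))
      \<le> (LINT x|M. norm (F x - u i x))" .
qed

lemma isCont_fourier:
  fixes f :: "real ^ 'n \<Rightarrow> complex"
  assumes "integrable lborel f"
  shows "isCont (fourier f) \<xi>"
  unfolding continuous_at_sequentially
proof (intro allI impI)
  fix \<eta> :: "nat \<Rightarrow> real ^ 'n" assume "\<eta> \<longlonglongrightarrow> \<xi>"
  then have *: "(\<lambda>i. cis (- (x \<bullet> \<eta> i)) * f x) \<longlonglongrightarrow> cis (- (x \<bullet> \<xi>)) * f x" for x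
    by (intro tendsto_intros)
  show "(fourier f \<circ> \<eta>) \<longlonglongrightarrow> fourier f \<xi>"
    unfolding fourier_def o_def
    by (rule integral_dominated_convergence[where w = "\<lambda>x. norm (f x)"])
       (use * assms in \<open>auto simp: norm_mult intro!: borel_measurable_times\<close>)
qed

text \<open>
  If \<open>k\<close> is integrable in both variables, then \<open>\<integral> k t dt\<close> is an \<open>L\<^sup>1\<close> function, and its norm and Fourier
  transform may be computed under the integral sign. Convolutions are the case \<open>k y x = f (x - y) g y\<close>,
  while operators subordinated to the Gaussians arise by integrating over the scale.
\<close>

lemma superposition:
  fixes k :: "'a \<Rightarrow> real ^ 'n \<Rightarrow> complex"
  assumes M: "sigma_finite_measure M"
    and k: "integrable (M \<Otimes>\<^sub>M lborel) (\<lambda>(t, x). k t x)"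
  shows superposition_integrable: "integrable lborel (\<lambda>x. LINT t|M. k t x)"
    and superposition_norm:
      "(LINT x|lborel. norm (LINT t|M. k t x)) \<le> (LINT t|M. LINT x|lborel. norm (k t x))"
    and superposition_fourier: "fourier (\<lambda>x. LINT t|M. k t x) \<xi> = (LINT t|M. fourier (k t) \<xi>)"
proof -
  interpret pair_sigma_finite M "lborel :: (real ^ 'n) measure"
    using M sigma_finite_lborel by (simp add: pair_sigma_finite_def)
  show int: "integrable lborel (\<lambda>x. LINT t|M. k t x)"
    using k by (rule integrable_snd)
  have kn: "integrable (M \<Otimes>\<^sub>M lborel) (\<lambda>(t, x). norm (k t x))"
    using integrable_norm[OF k] by (simp add: case_prod_beta')
  have "(LINT x|lborel. norm (LINT t|M. k t x)) \<le> (LINT x|lborel. LINT t|M. norm (k t x))"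
    using int k kn by (intro integral_mono integrable_norm integrable_snd integral_norm_bound)
  then show "(LINT x|lborel. norm (LINT t|M. k t x)) \<le> (LINT t|M. LINT x|lborel. norm (k t x))"
    using Fubini_integral[OF kn] by simp
  have [measurable]: "(\<lambda>p. k (fst p) (snd p)) \<in> borel_measurable (M \<Otimes>\<^sub>M lborel)"
    using borel_measurable_integrable[OF k] by (simp add: case_prod_beta')
  have kc: "integrable (M \<Otimes>\<^sub>M lborel) (\<lambda>(t, x). cis (- (x \<bullet> \<xi>)) * k t x)"
    by (rule Bochner_Integration.integrable_bound[OF k]) (auto simp: case_prod_beta' norm_mult)
  show "fourier (\<lambda>x. LINT t|M. k t x) \<xi> = (LINT t|M. fourier (k t) \<xi>)"
    using Fubini_integral[OF kc] unfolding fourier_def by simp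
qed

section \<open>Convolution\<close>

lemma lborel_isometry:
  fixes t :: "'a :: euclidean_space"
  assumes "\<bar>c\<bar> = 1"
  shows "distr lborel borel (\<lambda>x. t + c *\<^sub>R x) = lborel"
proof -
  have "c \<noteq> 0" using assms by auto
  from lborel_affine[OF this, of t] show ?thesis
    by (simp add: assms density_1)
qed

lemma
  fixes f :: "'a :: euclidean_space \<Rightarrow> 'b :: {banach, second_countable_topology}"
  assumes f: "integrable lborel f"
  shows integrable_translate: "integrable lborel (\<lambda>x. f (x - t))"
    and integral_translate: "(LINT x|lborel. f (x - t)) = (LINT x|lborel. f x)"
    and integrable_reflect: "integrable lborel (\<lambda>x. f (t - x))"
    and integral_reflect: "(LINT x|lborel. f (t - x)) = (LINT x|lborel. f x)"
proof -
  have [measurable]: "f \<in> borel_measurable borel" using f by simp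
  have "integrable (distr lborel borel (\<lambda>x. - t + 1 *\<^sub>R x)) f"
    by (subst lborel_isometry) (use f in auto)
  then show "integrable lborel (\<lambda>x. f (x - t))"
    by (subst (asm) integrable_distr_eq) (auto simp: algebra_simps)
  have "integrable (distr lborel borel (\<lambda>x. t + (-1) *\<^sub>R x)) f"
    by (subst lborel_isometry) (use f in auto)
  then show "integrable lborel (\<lambda>x. f (t - x))"
    by (subst (asm) integrable_distr_eq) (auto simp: algebra_simps)
  have "(LINT x|lborel. f x) = integral\<^sup>L (distr lborel borel (\<lambda>x. - t + 1 *\<^sub>R x)) f"
    by (subst lborel_isometry) auto
  also have "\<dots> = (LINT x|lborel. f (x - t))"
    by (subst integral_distr) (auto simp: algebra_simps)
  finally show "(LINT x|lborel. f (x - t)) = (LINT x|lborel. f x)" ..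
  have "(LINT x|lborel. f x) = integral\<^sup>L (distr lborel borel (\<lambda>x. t + (-1) *\<^sub>R x)) f"
    by (subst lborel_isometry) auto
  also have "\<dots> = (LINT x|lborel. f (t - x))"
    by (subst integral_distr) (auto simp: algebra_simps)
  finally show "(LINT x|lborel. f (t - x)) = (LINT x|lborel. f x)" ..
qed

text \<open>
  The convolution; for \<open>f, g\<close> in \<open>L\<^sup>1\<close> the integral exists for almost every \<open>x\<close>, and it has the default
  value 0 elsewhere.
\<close>

definition convol :: "(real ^ 'n \<Rightarrow> complex) \<Rightarrow> (real ^ 'n \<Rightarrow> complex) \<Rightarrow> real ^ 'n \<Rightarrow> complex" where
  "convol f g x = (LINT y|lborel. f (x - y) * g y)"

lemma integrable_convol_kernel:
  fixes f g :: "real ^ 'n \<Rightarrow> complex"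
  assumes f: "integrable lborel f" and g: "integrable lborel g"
  shows "integrable (lborel \<Otimes>\<^sub>M lborel) (\<lambda>(y, x). f (x - y) * g y)"
proof (rule integrable_pairI[where B = "\<lambda>y. (LINT x|lborel. norm (f x)) * norm (g y)"])
  have [measurable]: "f \<in> borel_measurable borel" "g \<in> borel_measurable borel"
    using f g by auto
  show "(\<lambda>(y, x). f (x - y) * g y) \<in> borel_measurable (lborel \<Otimes>\<^sub>M lborel)"
    by measurable
  show "integrable lborel (\<lambda>x. f (x - y) * g y)" for y
    using integrable_translate[OF f, of y] by simp
  show "(LINT x|lborel. norm (f (x - y) * g y)) \<le> norm1 f * norm (g y)" for y
    using integral_translate[OF integrable_norm[OF f], of y] by (simp add: norm_mult)
  show "integrable lborel (\<lambda>y. (LINT x|lborel. norm (f x)) * norm (g y))"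
    using g by simp
qed (rule sigma_finite_lborel)+

lemma fourier_translate:
  fixes f :: "real ^ 'n \<Rightarrow> complex"
  assumes f: "integrable lborel f"
  shows "fourier (\<lambda>x. f (x - t)) \<xi> = cis (- (t \<bullet> \<xi>)) * fourier f \<xi>"
proof -
  have "fourier f \<xi> = (LINT x|lborel. cis (- ((x - t) \<bullet> \<xi>)) * f (x - t))"
    unfolding fourier_def by (rule integral_translate[OF integrable_cis_mult[OF f], symmetric])
  then have "cis (- (t \<bullet> \<xi>)) * fourier f \<xi>
      = (LINT x|lborel. cis (- (t \<bullet> \<xi>)) * (cis (- ((x - t) \<bullet> \<xi>)) * f (x - t)))"
    by simp
  also have "\<dots> = fourier (\<lambda>x. f (x - t)) \<xi>"
    unfolding fourier_def
    by (intro Bochner_Integration.integral_cong) (simp_all add: cis_mult inner_diff_left flip: mult.assoc)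
  finally show ?thesis ..
qed

lemma
  fixes f g :: "real ^ 'n \<Rightarrow> complex"
  assumes f: "integrable lborel f" and g: "integrable lborel g"
  shows integrable_convol: "integrable lborel (convol f g)"
    and norm_convol: "(LINT x|lborel. norm (convol f g x))
      \<le> norm1 f * norm1 g"
    and fourier_convol: "fourier (convol f g) \<xi> = fourier f \<xi> * fourier g \<xi>"
proof -
  note k = integrable_convol_kernel[OF f g]
  show "integrable lborel (convol f g)"
    using superposition_integrable[OF sigma_finite_lborel k] unfolding convol_def .
  show "(LINT x|lborel. norm (convol f g x))
      \<le> norm1 f * norm1 g"
    using superposition_norm[OF sigma_finite_lborel k] unfolding convol_def
    by (simp add: norm_mult integral_translate[OF integrable_norm[OF f]])
  have "fourier (convol f g) \<xi> = (LINT y|lborel. fourier (\<lambda>x. f (x - y) * g y) \<xi>)"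
    using superposition_fourier[OF sigma_finite_lborel k] unfolding convol_def .
  also have "\<dots> = (LINT y|lborel. fourier f \<xi> * (cis (- (y \<bullet> \<xi>)) * g y))"
    by (intro Bochner_Integration.integral_cong refl, subst mult.commute, subst fourier_cmult)
       (simp add: fourier_translate[OF f])
  also have "\<dots> = fourier f \<xi> * fourier g \<xi>"
    by (simp add: fourier_def)
  finally show "fourier (convol f g) \<xi> = fourier f \<xi> * fourier g \<xi>" .
qed

section \<open>Gaussians\<close>

lemma Basis_vec_real: "Basis = range (\<lambda>i. axis i (1::real))"
  by (auto simp: Basis_vec_def)

lemma inj_axis_1: "inj (\<lambda>i. axis i (1::real))"
  by (auto simp: inj_on_def axis_eq_axis)

lemma
  fixes f :: "'n :: finite \<Rightarrow> real \<Rightarrow> complex"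
  assumes f: "\<And>i. integrable lborel (f i)"
  shows integrable_prod_nth: "integrable lborel (\<lambda>x :: real ^ 'n. \<Prod>i\<in>UNIV. f i (x $ i))"
    and integral_prod_nth:
      "(LINT x|(lborel :: (real ^ 'n) measure). (\<Prod>i\<in>UNIV. f i (x $ i))) = (\<Prod>i\<in>UNIV. (LINT u|lborel. f i u))"
proof -
  interpret product_sigma_finite "\<lambda>_ :: real ^ 'n. lborel :: real measure"
    by (simp add: product_sigma_finite_def sigma_finite_lborel)
  define h where "h b = f (the_inv (\<lambda>i. axis i (1::real)) b)" for b :: "real ^ 'n"
  have h: "h (axis i 1) = f i" for i
    unfolding h_def by (simp add: the_inv_f_f[OF inj_axis_1])
  have hint: "integrable lborel (h b)" for b using f by (simp add: h_def)
  have prod: "(\<Prod>i\<in>UNIV. g (axis i (1::real))) = (\<Prod>b\<in>Basis. g b)" for g :: "real ^ 'n \<Rightarrow> complex"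
    unfolding Basis_vec_real by (subst prod.reindex[OF inj_axis_1]) simp
  have [measurable]: "f i \<in> borel_measurable borel" for i using f[of i] by simp
  let ?T = "\<lambda>f. \<Sum>b\<in>(Basis :: (real ^ 'n) set). f b *\<^sub>R b"
  let ?P = "Pi\<^sub>M (Basis :: (real ^ 'n) set) (\<lambda>_. lborel :: real measure)"
  have T[measurable]: "?T \<in> measurable ?P borel" by measurable
  have Tn: "(\<Prod>i\<in>UNIV. f i (?T y $ i)) = (\<Prod>b\<in>Basis. h b (y b))" for y
  proof -
    have "?T y $ i = y (axis i 1)" for i
      unfolding cart_eq_inner_axis by (rule inner_sum_left_Basis) (simp add: Basis_vec_real)
    then show ?thesis
      using prod[of "\<lambda>b. h b (y b)"] by (simp add: h)
  qed
  have m: "(\<lambda>x :: real ^ 'n. \<Prod>i\<in>UNIV. f i (x $ i)) \<in> borel_measurable borel"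
    by measurable
  show "integrable lborel (\<lambda>x :: real ^ 'n. \<Prod>i\<in>UNIV. f i (x $ i))"
    unfolding lborel_eq[where 'a = "real ^ 'n"]
    by (subst integrable_distr_eq[OF T m], unfold Tn) (rule product_integrable_prod, use hint in auto)
  have "(LINT x|(lborel :: (real ^ 'n) measure). (\<Prod>i\<in>UNIV. f i (x $ i))) = (LINT y|?P. (\<Prod>b\<in>Basis. h b (y b)))"
    by (subst lborel_eq[where 'a = "real ^ 'n"], subst integral_distr[OF T m], unfold Tn) rule
  also have "\<dots> = (\<Prod>b\<in>Basis. (LINT u|lborel. h b u))"
    by (rule product_integral_prod) (use hint in auto)
  also have "\<dots> = (\<Prod>i\<in>UNIV. (LINT u|lborel. f i u))"
    using prod[of "\<lambda>b. LINT u|lborel. h b u"] by (simp add: h)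
  finally show "(LINT x|(lborel :: (real ^ 'n) measure). (\<Prod>i\<in>UNIV. f i (x $ i))) = (\<Prod>i\<in>UNIV. (LINT u|lborel. f i u))" .
qed

text \<open>
  \<open>gauss s\<close> is the density of the centred normal distribution with covariance \<open>s\<^sup>2 I\<close>, that is, the heat
  kernel at time \<open>s\<^sup>2 / 2\<close>. Parametrising by \<open>s\<close> instead of the time avoids the weight \<open>t\<^sup>-\<^sup>1\<^sup>/\<^sup>2\<close> in the
  subordination formulas. The product form reduces Fourier transforms to dimension one.
\<close>

definition gauss :: "real \<Rightarrow> real ^ 'n \<Rightarrow> real" where
  "gauss s x = (\<Prod>i\<in>UNIV. normal_density 0 s (x $ i))"

text \<open>The partial derivative \<open>\<partial>\<^sub>j gauss s\<close>.\<close>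

definition dgauss :: "'n \<Rightarrow> real \<Rightarrow> real ^ 'n \<Rightarrow> real" where
  "dgauss j s x = - (x $ j / s\<^sup>2) * gauss s x"

lemma vec_nth_measurable [measurable (raw)]:
  assumes [measurable]: "f \<in> borel_measurable M"
  shows "(\<lambda>t. (f t :: real ^ 'n) $ j) \<in> borel_measurable M"
  unfolding cart_eq_inner_axis by measurable

lemma norm_sq_vec:
  fixes x :: "real ^ 'n"
  shows "(norm x)\<^sup>2 = (\<Sum>i\<in>UNIV. (x $ i)\<^sup>2)"
  unfolding power2_norm_eq_inner inner_vec_def by (simp add: power2_eq_square)

lemma gauss_eq:
  fixes x :: "real ^ 'n"
  shows "gauss s x = (1 / sqrt (2 * pi * s\<^sup>2)) ^ CARD('n) * exp (- (norm x)\<^sup>2 / (2 * s\<^sup>2))"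
proof -
  have "exp (- (norm x)\<^sup>2 / (2 * s\<^sup>2)) = (\<Prod>i\<in>UNIV. exp (- (x $ i)\<^sup>2 / (2 * s\<^sup>2)))"
    by (simp add: norm_sq_vec exp_sum[symmetric] sum_negf sum_divide_distrib)
  then show ?thesis
    unfolding gauss_def normal_density_def by (simp add: prod_dividef power_one_over)
qed

lemma gauss_nonneg [simp]: "0 \<le> gauss s x"
  unfolding gauss_def by (intro prod_nonneg) auto

lemma gauss_measurable [measurable (raw)]:
  assumes [measurable]: "f \<in> borel_measurable M" "g \<in> borel_measurable M"
  shows "(\<lambda>t. gauss (f t) (g t :: real ^ 'n)) \<in> borel_measurable M"
  unfolding gauss_eq by measurable

lemma dgauss_measurable [measurable (raw)]:
  assumes [measurable]: "f \<in> borel_measurable M" "g \<in> borel_measurable M"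
  shows "(\<lambda>t. dgauss j (f t) (g t :: real ^ 'n)) \<in> borel_measurable M"
  unfolding dgauss_def by measurable

lemma cis_sum: "finite A \<Longrightarrow> cis (\<Sum>i\<in>A. f i) = (\<Prod>i\<in>A. cis (f i))"
  by (induction A rule: finite_induct) (auto simp: cis_mult[symmetric])

lemma cis_inner_prod:
  fixes x \<xi> :: "real ^ 'n"
  shows "cis (- (x \<bullet> \<xi>)) = (\<Prod>i\<in>UNIV. cis (- (x $ i * \<xi> $ i)))"
  by (simp add: inner_vec_def cis_sum[symmetric] sum_negf)

lemma fourier_normal_density:
  assumes s: "0 < s"
  shows "(LINT u|lborel. cis (- (u * t)) * of_real (normal_density 0 s u))
    = of_real (exp (- s\<^sup>2 * t\<^sup>2 / 2))"
proof -
  have "(LINT u|lborel. cis (- (u * t)) * of_real (normal_density 0 s u))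
     = \<bar>s\<bar> *\<^sub>R (LINT v|lborel. cis (- ((0 + s * v) * t)) * of_real (normal_density 0 s (0 + s * v)))"
    by (rule lborel_integral_real_affine) (use s in auto)
  also have "\<dots> = (LINT v|lborel. std_normal_density v *\<^sub>R cis (- s * t * v))"
  proof -
    have "normal_density 0 s (s * v) = std_normal_density v / s" for v
      using s by (simp add: normal_density_def real_sqrt_mult power_mult_distrib field_simps)
    then show ?thesis
      using s by (simp add: scaleR_conv_of_real mult_ac)
  qed
  also have "\<dots> = char std_normal_distribution (- s * t)"
    unfolding char_def by (subst integral_density) (auto simp: cis_conv_exp)
  also have "\<dots> = of_real (exp (- s\<^sup>2 * t\<^sup>2 / 2))"
    by (simp add: char_std_normal_distribution power_mult_distrib)
  finally show ?thesis .
qed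

lemma integrable_normal_density_times:
  assumes "0 < s"
  shows "integrable lborel (\<lambda>u. of_real (u * normal_density 0 s u) :: complex)"
  using integrable_normal_moment[OF assms, of 0 1] by (intro integrable_of_real) (simp add: mult.commute)

text \<open>Integration by parts: \<open>n' e - \<i> t n e\<close> is the derivative of \<open>n e\<close>, with \<open>n\<close> the density and \<open>e = cis (- u t)\<close>.\<close>

lemma fourier_normal_density_deriv:
  assumes s: "0 < s"
  shows "(LINT u|lborel. cis (- (u * t)) * of_real (- (u / s\<^sup>2) * normal_density 0 s u))
    = \<i> * of_real t * of_real (exp (- s\<^sup>2 * t\<^sup>2 / 2))"
proof -
  define F where "F u = of_real (normal_density 0 s u) * cis (- (u * t))" for u
  define f where "f u = cis (- (u * t)) * of_real (- (u / s\<^sup>2) * normal_density 0 s u)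
      - \<i> * of_real t * (cis (- (u * t)) * of_real (normal_density 0 s u))" for u
  have int1: "integrable lborel (\<lambda>u. cis (- (u * t)) * of_real (- (u / s\<^sup>2) * normal_density 0 s u))"
    by (rule Bochner_Integration.integrable_bound[OF integrable_mult_right[OF integrable_normal_density_times[OF s], of "of_real (1/s\<^sup>2)"]])
       (auto simp: norm_mult norm_divide)
  have int2: "integrable lborel (\<lambda>u. cis (- (u * t)) * of_real (normal_density 0 s u))"
    by (rule Bochner_Integration.integrable_bound[OF integrable_normal_density[OF s, of 0]])
       (auto simp: norm_mult norm_divide)
  have int: "integrable lborel f"
    unfolding f_def using int1 int2 by (intro Bochner_Integration.integrable_diff integrable_mult_right)
  have "(LBINT u=-\<infinity>..\<infinity>. f u) = 0 - 0"
  proof (rule interval_integral_FTC_integrable)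
    show "(F has_vector_derivative f u) (at u)" for u
    proof -
      have d1: "((\<lambda>u. normal_density 0 s u) has_real_derivative (- (u / s\<^sup>2) * normal_density 0 s u)) (at u)"
        unfolding normal_density_def using s
        by (auto intro!: derivative_eq_intros simp: field_simps)
      have d2: "((\<lambda>u. cis (- (u * t))) has_vector_derivative (- \<i> * of_real t * cis (- (u * t)))) (at u)"
      proof -
        have "((\<lambda>z. exp (z * (- \<i> * of_real t))) has_field_derivative
            (- \<i> * of_real t * exp (of_real u * (- \<i> * of_real t)))) (at (of_real u))"
          by (auto intro!: derivative_eq_intros)
        from has_vector_derivative_real_field[OF this] show ?thesis
          by (simp add: cis_conv_exp mult_ac)
      qed
      show ?thesis
        unfolding F_def f_def
        by (rule has_vector_derivative_eq_rhs[OF has_vector_derivative_mult[OF has_vector_derivative_of_real[OF d1] d2]])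
           (simp add: algebra_simps)
    qed
    show "isCont f u" for u
    proof -
      have "continuous_on UNIV f"
        unfolding f_def normal_density_def using s by (intro continuous_intros) auto
      then show ?thesis by (simp add: continuous_on_eq_continuous_at)
    qed
    show "set_integrable lborel (einterval (-\<infinity>) \<infinity>) f"
      using int by (simp add: set_integrable_def)
    have lim: "((\<lambda>u. normal_density 0 s u) \<longlongrightarrow> 0) at_top" "((\<lambda>u. normal_density 0 s u) \<longlongrightarrow> 0) at_bot"
      unfolding normal_density_def using s by real_asymp+
    have "(F \<longlongrightarrow> 0) at_top" "(F \<longlongrightarrow> 0) at_bot"
      by (rule tendsto_norm_zero_cancel, use lim in \<open>simp add: F_def norm_mult\<close>)+
    then show "((F \<circ> real_of_ereal) \<longlongrightarrow> 0) (at_right (-\<infinity>))" "((F \<circ> real_of_ereal) \<longlongrightarrow> 0) (at_left \<infinity>)"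
      by (auto simp: ereal_tendsto_simps)
  qed simp
  then have "(LINT u|lborel. f u) = 0"
    by (simp add: interval_lebesgue_integral_def set_lebesgue_integral_def)
  then show ?thesis
    unfolding f_def fourier_normal_density[OF s, of t, symmetric]
    by (subst (asm) Bochner_Integration.integral_diff[OF int1 integrable_mult_right[OF int2]]) simp
qed

lemma
  fixes s :: real
  assumes s: "0 < s"
  shows integrable_gauss: "integrable lborel (gauss s :: real ^ 'n \<Rightarrow> real)"
    and fourier_gauss: "fourier (\<lambda>x :: real ^ 'n. of_real (gauss s x)) \<xi> = of_real (exp (- s\<^sup>2 * (norm \<xi>)\<^sup>2 / 2))"
    and integral_gauss: "(LINT x|lborel. gauss s (x :: real ^ 'n)) = 1"
proof -
  have n: "integrable lborel (\<lambda>u. of_real (normal_density 0 s u) :: complex)"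
    using integrable_normal_density[OF s] by (intro integrable_of_real)
  have "integrable lborel (\<lambda>x :: real ^ 'n. \<Prod>i\<in>UNIV. of_real (normal_density 0 s (x $ i)) :: complex)"
    by (rule integrable_prod_nth) (rule n)
  then have "integrable lborel (\<lambda>x :: real ^ 'n. of_real (gauss s x) :: complex)"
    by (simp add: gauss_def)
  then have "integrable lborel (\<lambda>x :: real ^ 'n. Re (of_real (gauss s x) :: complex))"
    by (rule integrable_Re)
  then show "integrable lborel (gauss s :: real ^ 'n \<Rightarrow> real)" by simp
  have F: "fourier (\<lambda>x :: real ^ 'n. of_real (gauss s x)) \<xi> = of_real (exp (- s\<^sup>2 * (norm \<xi>)\<^sup>2 / 2))" for \<xi>
  proof -
    have "fourier (\<lambda>x :: real ^ 'n. of_real (gauss s x)) \<xi>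
       = (LINT x|(lborel :: (real ^ 'n) measure). (\<Prod>i\<in>UNIV. cis (- (x $ i * \<xi> $ i)) * of_real (normal_density 0 s (x $ i))))"
      by (simp add: fourier_def gauss_def cis_inner_prod prod.distrib)
    also have "\<dots> = (\<Prod>i\<in>UNIV. (LINT u|lborel. cis (- (u * \<xi> $ i)) * of_real (normal_density 0 s u)))"
      by (rule integral_prod_nth, rule Bochner_Integration.integrable_bound[OF n])
       (auto simp: norm_mult norm_divide)
    also have "\<dots> = of_real (exp (- s\<^sup>2 * (norm \<xi>)\<^sup>2 / 2))"
      by (simp add: fourier_normal_density[OF s] exp_sum[symmetric] norm_sq_vec
         sum_distrib_left sum_divide_distrib sum_negf flip: of_real_prod)
    finally show ?thesis .
  qed
  show "fourier (\<lambda>x :: real ^ 'n. of_real (gauss s x)) \<xi> = of_real (exp (- s\<^sup>2 * (norm \<xi>)\<^sup>2 / 2))"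
    by (rule F)
  have "of_real (LINT x|lborel. gauss s (x :: real ^ 'n)) = fourier (\<lambda>x :: real ^ 'n. of_real (gauss s x)) 0"
    by (simp add: fourier_def)
  then have "of_real (LINT x|lborel. gauss s (x :: real ^ 'n)) = (1::complex)"
    unfolding F by simp
  then show "(LINT x|lborel. gauss s (x :: real ^ 'n)) = 1" by (simp only: of_real_eq_1_iff)
qed

lemma
  fixes s :: real
  assumes s: "0 < s"
  shows integrable_dgauss: "integrable lborel (dgauss j s :: real ^ 'n \<Rightarrow> real)"
    and fourier_dgauss: "fourier (\<lambda>x :: real ^ 'n. of_real (dgauss j s x)) \<xi>
      = \<i> * of_real (\<xi> $ j) * of_real (exp (- s\<^sup>2 * (norm \<xi>)\<^sup>2 / 2))"
proof -
  \<comment> \<open>Only the \<open>j\<close>-th factor of the product is differentiated.\<close>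
  define c :: "'n \<Rightarrow> real \<Rightarrow> real" where "c i u = (if i = j then - (u / s\<^sup>2) else 1)" for i u
  have d: "of_real (dgauss j s x) = (\<Prod>i\<in>UNIV. of_real (c i (x $ i) * normal_density 0 s (x $ i)) :: complex)" for x
  proof -
    have "(\<Prod>i\<in>UNIV. c i (x $ i)) = - (x $ j / s\<^sup>2)"
      unfolding c_def by (subst prod.delta) auto
    then have "dgauss j s x = (\<Prod>i\<in>UNIV. c i (x $ i) * normal_density 0 s (x $ i))"
      unfolding prod.distrib dgauss_def gauss_def by simp
    then show ?thesis by simp
  qed
  have n: "integrable lborel (\<lambda>u. of_real (c i u * normal_density 0 s u) :: complex)" for i
    using integrable_normal_density[OF s, of 0] integrable_normal_density_times[OF s]
      integrable_mult_right[OF integrable_normal_density_times[OF s], of "of_real (- 1/s\<^sup>2)"]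
    by (cases "i = j") (auto simp: c_def mult.assoc intro: integrable_of_real)
  have "integrable lborel (\<lambda>x :: real ^ 'n. \<Prod>i\<in>UNIV. of_real (c i (x $ i) * normal_density 0 s (x $ i)) :: complex)"
    by (rule integrable_prod_nth) (rule n)
  then have "integrable lborel (\<lambda>x :: real ^ 'n. of_real (dgauss j s x) :: complex)"
    unfolding d .
  then have "integrable lborel (\<lambda>x :: real ^ 'n. Re (of_real (dgauss j s x) :: complex))"
    by (rule integrable_Re)
  then show "integrable lborel (dgauss j s :: real ^ 'n \<Rightarrow> real)" by simp
  have "fourier (\<lambda>x :: real ^ 'n. of_real (dgauss j s x)) \<xi>
     = (LINT x|(lborel :: (real ^ 'n) measure). (\<Prod>i\<in>UNIV. cis (- (x $ i * \<xi> $ i)) * of_real (c i (x $ i) * normal_density 0 s (x $ i))))"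
    unfolding fourier_def d by (simp add: cis_inner_prod prod.distrib)
  also have "\<dots> = (\<Prod>i\<in>UNIV. (LINT u|lborel. cis (- (u * \<xi> $ i)) * of_real (c i u * normal_density 0 s u)))"
    by (rule integral_prod_nth, rule Bochner_Integration.integrable_bound[OF n], unfold c_def)
       (auto simp: norm_mult norm_divide)
  also have "\<dots> = (\<Prod>i\<in>UNIV. (if i = j then \<i> * of_real (\<xi> $ i) else 1) * of_real (exp (- s\<^sup>2 * (\<xi> $ i)\<^sup>2 / 2)))"
    using fourier_normal_density_deriv[OF s] fourier_normal_density[OF s]
    by (intro prod.cong) (auto simp: c_def)
  also have "\<dots> = \<i> * of_real (\<xi> $ j) * of_real (exp (- s\<^sup>2 * (norm \<xi>)\<^sup>2 / 2))"
    by (simp add: prod.distrib prod.delta exp_sum[symmetric] norm_sq_vec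
         sum_distrib_left sum_divide_distrib sum_negf flip: of_real_prod)
  finally show "fourier (\<lambda>x :: real ^ 'n. of_real (dgauss j s x)) \<xi>
      = \<i> * of_real (\<xi> $ j) * of_real (exp (- s\<^sup>2 * (norm \<xi>)\<^sup>2 / 2))" .
qed

lemma power_le_fact_exp:
  assumes "0 \<le> (u :: real)"
  shows "u ^ k \<le> fact k * exp u"
proof -
  have "u ^ k / fact k \<le> (\<Sum>i<Suc k. u ^ i / fact i)"
    using assms by (intro member_le_sum) auto
  also have "\<dots> \<le> exp u"
    using assms sum_le_suminf[OF summable_exp[of u], of "{..<Suc k}"]
    by (auto simp: exp_def divide_inverse mult_ac)
  finally show ?thesis by (simp add: field_simps)
qed

lemma sqrt_normal_const: "0 < s \<Longrightarrow> sqrt (2 * pi * s\<^sup>2) = sqrt (2 * pi) * s"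
  by (simp add: real_sqrt_mult)

lemma gauss_double:
  fixes x :: "real ^ 'n"
  assumes "0 < s"
  shows "gauss s x = 2 ^ CARD('n) * gauss (2 * s) x * exp (- 3 / 8 * (norm x / s)\<^sup>2)"
proof -
  have 1: "1 / sqrt (2 * pi * s\<^sup>2) = 2 * (1 / sqrt (2 * pi * (2 * s)\<^sup>2))"
    using assms sqrt_normal_const[of s] sqrt_normal_const[of "2 * s"] by simp
  have 2: "- (norm x)\<^sup>2 / (2 * s\<^sup>2) = - (norm x)\<^sup>2 / (2 * (2 * s)\<^sup>2) + (- 3 / 8 * (norm x / s)\<^sup>2)"
    using assms by (simp add: field_simps)
  show ?thesis
    unfolding gauss_eq 1 2 exp_add power_mult_distrib by (simp add: mult_ac)
qed

text \<open>
  Polynomial factors are absorbed by doubling the width. All \<open>L\<^sup>1\<close> bounds for \<open>dgauss\<close> follow from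
  this pointwise estimate and \<open>integral_gauss\<close>.
\<close>

lemma gauss_decay:
  fixes x :: "real ^ 'n"
  assumes s: "0 < s"
  shows "norm x ^ k * gauss s x \<le> 2 ^ CARD('n) * fact k * exp 1 * s ^ k * gauss (2 * s) x"
proof -
  define u where "u = norm x / s"
  have u: "0 \<le> u" "norm x = s * u" using s by (auto simp: u_def)
  \<comment> \<open>Completing the square gives \<open>u - 3/8 u\<^sup>2 \<le> 2/3\<close>.\<close>
  have "0 \<le> 3 / 8 * (u - 4 / 3)\<^sup>2" by simp
  then have "u - 3 / 8 * u\<^sup>2 \<le> 2 / 3" by (simp add: power2_eq_square algebra_simps)
  then have "exp u * exp (- 3 / 8 * u\<^sup>2) \<le> exp 1"
    unfolding exp_add[symmetric] exp_le_cancel_iff by simp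
  then have e: "fact k * (exp u * exp (- 3 / 8 * u\<^sup>2)) \<le> fact k * exp 1"
    by (intro mult_left_mono) auto
  have "u ^ k * exp (- 3 / 8 * u\<^sup>2) \<le> fact k * exp u * exp (- 3 / 8 * u\<^sup>2)"
    by (intro mult_right_mono power_le_fact_exp u) auto
  also have "\<dots> \<le> fact k * exp 1"
    using e by (simp only: mult.assoc)
  finally have "(2 ^ CARD('n) * s ^ k * gauss (2 * s) x) * (u ^ k * exp (- 3 / 8 * u\<^sup>2))
      \<le> (2 ^ CARD('n) * s ^ k * gauss (2 * s) x) * (fact k * exp 1)"
    using s by (intro mult_left_mono) auto
  then show ?thesis
    unfolding gauss_double[OF s, of x] u_def[symmetric] u(2) power_mult_distrib
    using s by (simp add: mult_ac)
qed

lemma norm_dgauss_le: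
  fixes x :: "real ^ 'n"
  assumes s: "0 < s"
  shows "\<bar>dgauss j s x\<bar> \<le> 2 ^ CARD('n) * exp 1 / s * gauss (2 * s) x"
    and "(norm x)\<^sup>2 * \<bar>dgauss j s x\<bar> \<le> 2 ^ CARD('n) * 6 * exp 1 * s * gauss (2 * s) x"
proof -
  have le: "\<bar>dgauss j s x\<bar> \<le> norm x * gauss s x / s\<^sup>2"
    using component_le_norm_cart[of x j]
    by (simp add: dgauss_def abs_mult mult_right_mono divide_right_mono)
  show "\<bar>dgauss j s x\<bar> \<le> 2 ^ CARD('n) * exp 1 / s * gauss (2 * s) x"
    using divide_right_mono[OF gauss_decay[OF s, of x 1], of "s\<^sup>2"] s
    by (intro order_trans[OF le]) (simp add: power2_eq_square field_simps)
  have "(norm x)\<^sup>2 * \<bar>dgauss j s x\<bar> \<le> (norm x)\<^sup>2 * (norm x * gauss s x / s\<^sup>2)"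
    using le by (intro mult_left_mono) auto
  also have "\<dots> = norm x ^ 3 * gauss s x / s\<^sup>2"
    by (simp add: power2_eq_square power3_eq_cube)
  also have "\<dots> \<le> 2 ^ CARD('n) * 6 * exp 1 * s * gauss (2 * s) x"
    using divide_right_mono[OF gauss_decay[OF s, of x 3], of "s\<^sup>2"] s
    by (simp add: power2_eq_square power3_eq_cube fact_numeral field_simps)
  finally show "(norm x)\<^sup>2 * \<bar>dgauss j s x\<bar> \<le> 2 ^ CARD('n) * 6 * exp 1 * s * gauss (2 * s) x" .
qed

lemma gauss_shift:
  fixes x z :: "real ^ 'n"
  assumes s: "0 < s" and xz: "norm (z - x) \<le> s"
  shows "gauss (2 * s) z \<le> 2 ^ CARD('n) * exp 1 * gauss (4 * s) x"
proof -
  have "(norm x)\<^sup>2 \<le> (norm z + s)\<^sup>2"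
    using xz norm_triangle_sub[of x z] by (intro power_mono) (auto simp: norm_minus_commute)
  also have "\<dots> \<le> 4 * (norm z)\<^sup>2 + 2 * s\<^sup>2"
    using sum_squares_bound[of "norm z" s] zero_le_power2[of "norm z"] unfolding power2_sum by linarith
  also have "\<dots> \<le> 4 * (norm z)\<^sup>2 + s\<^sup>2 * 32"
    using zero_le_power2[of s] by linarith
  finally have "- (norm z)\<^sup>2 / (2 * (2 * s)\<^sup>2) \<le> 1 + - (norm x)\<^sup>2 / (2 * (4 * s)\<^sup>2)"
    using s by (simp add: field_simps)
  then have e: "exp (- (norm z)\<^sup>2 / (2 * (2 * s)\<^sup>2)) \<le> exp 1 * exp (- (norm x)\<^sup>2 / (2 * (4 * s)\<^sup>2))"
    unfolding exp_add[symmetric] by simp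
  have c: "1 / sqrt (2 * pi * (2 * s)\<^sup>2) = 2 * (1 / sqrt (2 * pi * (4 * s)\<^sup>2))"
    using s sqrt_normal_const[of "2 * s"] sqrt_normal_const[of "4 * s"] by simp
  have "gauss (2 * s) z = (2 * (1 / sqrt (2 * pi * (4 * s)\<^sup>2))) ^ CARD('n) * exp (- (norm z)\<^sup>2 / (2 * (2 * s)\<^sup>2))"
    unfolding gauss_eq c ..
  also have "\<dots> \<le> (2 * (1 / sqrt (2 * pi * (4 * s)\<^sup>2))) ^ CARD('n) * (exp 1 * exp (- (norm x)\<^sup>2 / (2 * (4 * s)\<^sup>2)))"
    by (rule mult_left_mono[OF e]) simp
  also have "\<dots> = 2 ^ CARD('n) * exp 1 * gauss (4 * s) x"
    by (simp only: gauss_eq power_mult_distrib mult_ac)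
  finally show ?thesis .
qed

text \<open>
  The mean value theorem along the segment from \<open>x\<close> to \<open>x + v\<close>. As its length is at most \<open>s\<close>, the Gaussian at the
  intermediate point is dominated by a wider Gaussian at \<open>x\<close> itself.
\<close>

lemma dgauss_lipschitz:
  fixes x v :: "real ^ 'n"
  assumes s: "0 < s" and v: "norm v \<le> s"
  shows "\<bar>dgauss j s (x + v) - dgauss j s x\<bar>
    \<le> 3 * 4 ^ CARD('n) * (exp 1)\<^sup>2 * norm v / s\<^sup>2 * gauss (4 * s) x"
proof -
  define z where "z u = x + u *\<^sub>R v" for u
  have nz: "(norm (z u))\<^sup>2 = (norm x)\<^sup>2 + 2 * u * (x \<bullet> v) + u\<^sup>2 * (norm v)\<^sup>2" for u
    unfolding z_def power2_norm_eq_inner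
    by (simp add: inner_add_left inner_add_right inner_commute power2_eq_square algebra_simps)
  have zj: "z u $ j = x $ j + u * v $ j" for u by (simp add: z_def)
  have zv: "z u \<bullet> v = x \<bullet> v + u * (norm v)\<^sup>2" for u
    by (simp add: z_def inner_add_left power2_norm_eq_inner)
  define d where "d u = - (v $ j / s\<^sup>2) * gauss s (z u) + (z u $ j / s\<^sup>2) * ((z u \<bullet> v) / s\<^sup>2) * gauss s (z u)" for u
  have der: "((\<lambda>u. dgauss j s (z u)) has_real_derivative d u) (at u)" for u
  proof -
    have "((\<lambda>u. gauss s (z u)) has_real_derivative (- ((z u \<bullet> v) / s\<^sup>2) * gauss s (z u))) (at u)"
      unfolding gauss_eq nz zv using s
      by (auto intro!: derivative_eq_intros simp: field_simps)
    then show ?thesis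
      unfolding dgauss_def d_def zj using s
      by (auto intro!: derivative_eq_intros simp: field_simps)
  qed
  obtain u where u: "0 < u" "u < 1" and eq: "dgauss j s (z 1) - dgauss j s (z 0) = (1 - 0) * d u"
    using MVT2[of 0 1 "\<lambda>u. dgauss j s (z u)" d] der by auto
  have "\<bar>d u\<bar> \<le> \<bar>v $ j / s\<^sup>2\<bar> * gauss s (z u) + \<bar>z u $ j / s\<^sup>2\<bar> * \<bar>(z u \<bullet> v) / s\<^sup>2\<bar> * gauss s (z u)"
    unfolding d_def by (rule order_trans[OF abs_triangle_ineq]) (simp add: abs_mult)
  also have "\<dots> \<le> norm v / s\<^sup>2 * gauss s (z u) + (norm (z u) / s\<^sup>2) * (norm (z u) * norm v / s\<^sup>2) * gauss s (z u)"
    using component_le_norm_cart[of v j] component_le_norm_cart[of "z u" j] Cauchy_Schwarz_ineq2[of "z u" v]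
    by (intro add_mono mult_right_mono mult_mono) (auto simp: abs_divide divide_right_mono)
  also have "\<dots> = norm v / s\<^sup>2 * (norm (z u) ^ 0 * gauss s (z u) + 1 / s\<^sup>2 * (norm (z u) ^ 2 * gauss s (z u)))"
    using s by (simp add: power2_eq_square field_simps)
  also have "\<dots> \<le> norm v / s\<^sup>2 * (2 ^ CARD('n) * fact 0 * exp 1 * s ^ 0 * gauss (2 * s) (z u)
     + 1 / s\<^sup>2 * (2 ^ CARD('n) * fact 2 * exp 1 * s ^ 2 * gauss (2 * s) (z u)))"
    by (intro mult_left_mono add_mono gauss_decay[OF s]) auto
  also have "\<dots> = norm v / s\<^sup>2 * (3 * 2 ^ CARD('n) * exp 1) * gauss (2 * s) (z u)"
    using s by (simp add: fact_numeral field_simps)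
  also have "\<dots> \<le> norm v / s\<^sup>2 * (3 * 2 ^ CARD('n) * exp 1) * (2 ^ CARD('n) * exp 1 * gauss (4 * s) x)"
  proof (intro mult_left_mono gauss_shift[OF s])
    have "norm (z u - x) = u * norm v" using u by (simp add: z_def)
    also have "\<dots> \<le> 1 * norm v" using u by (intro mult_right_mono) auto
    finally show "norm (z u - x) \<le> s" using v by simp
  qed auto
  also have "\<dots> = 3 * 4 ^ CARD('n) * (exp 1)\<^sup>2 * norm v / s\<^sup>2 * gauss (4 * s) x"
    by (simp add: power2_eq_square power_mult_distrib[symmetric] mult_ac)
  finally show ?thesis using eq by (simp add: z_def)
qed

text \<open>The Fourier inversion formula for Gaussians: up to a constant, \<open>exp (- s\<^sup>2 \<bar>\<xi>\<bar>\<^sup>2 / 2)\<close> is \<open>gauss (1 / s)\<close>.\<close>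

lemma gauss_inverse:
  fixes x :: "real ^ 'n"
  assumes s: "0 < s"
  shows integrable_exp_norm: "integrable lborel (\<lambda>\<xi> :: real ^ 'n. exp (- s\<^sup>2 * (norm \<xi>)\<^sup>2 / 2))"
    and integral_exp_norm_cis: "(LINT \<xi>|lborel. of_real (exp (- s\<^sup>2 * (norm \<xi>)\<^sup>2 / 2)) * cis (\<xi> \<bullet> x))
      = of_real ((2 * pi) ^ CARD('n) * gauss s x)"
proof -
  define c where "c = (sqrt (2 * pi) / s) ^ CARD('n)"
  have c: "exp (- s\<^sup>2 * (norm \<xi>)\<^sup>2 / 2) = c * gauss (1 / s) \<xi>" for \<xi> :: "real ^ 'n"
    unfolding gauss_eq c_def using s
    by (simp add: real_sqrt_mult real_sqrt_divide power_divide power_mult_distrib)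
  show "integrable lborel (\<lambda>\<xi> :: real ^ 'n. exp (- s\<^sup>2 * (norm \<xi>)\<^sup>2 / 2))"
    unfolding c using integrable_gauss[where 'n = 'n, of "1 / s"] s by simp
  have "(LINT \<xi>|lborel. of_real (exp (- s\<^sup>2 * (norm \<xi>)\<^sup>2 / 2)) * cis (\<xi> \<bullet> x))
      = of_real c * fourier (\<lambda>\<xi>. of_real (gauss (1 / s) \<xi>)) (- x)"
    unfolding c fourier_def by (simp add: mult_ac)
  also have "\<dots> = of_real (c * exp (- (1 / s)\<^sup>2 * (norm x)\<^sup>2 / 2))"
    using s by (subst fourier_gauss) auto
  also have "c * exp (- (1 / s)\<^sup>2 * (norm x)\<^sup>2 / 2) = (2 * pi) ^ CARD('n) * gauss s x"
  proof -
    have "sqrt (2 * pi) / s = 2 * pi * (1 / sqrt (2 * pi * s\<^sup>2))"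
      using s by (simp add: real_sqrt_mult field_simps)
    then show ?thesis
      unfolding c_def gauss_eq by (simp only: power_mult_distrib) (simp add: power_divide mult_ac)
  qed
  finally show "(LINT \<xi>|lborel. of_real (exp (- s\<^sup>2 * (norm \<xi>)\<^sup>2 / 2)) * cis (\<xi> \<bullet> x))
      = of_real ((2 * pi) ^ CARD('n) * gauss s x)" .
qed

section \<open>The Gaussian approximate identity\<close>

text \<open>Convolution with \<open>gauss e\<close>.\<close>

definition mollify :: "real \<Rightarrow> (real ^ 'n \<Rightarrow> complex) \<Rightarrow> real ^ 'n \<Rightarrow> complex" where
  "mollify e = convol (\<lambda>x. of_real (gauss e x))"

lemma integrable_gauss_complex:
  "0 < e \<Longrightarrow> integrable lborel (\<lambda>x :: real ^ 'n. of_real (gauss e x) :: complex)"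
  by (intro integrable_of_real integrable_gauss)

lemma
  fixes g :: "real ^ 'n \<Rightarrow> complex"
  assumes e: "0 < e" and g: "integrable lborel g"
  shows integrable_mollify: "integrable lborel (mollify e g)"
    and norm_mollify: "norm1 (mollify e g) \<le> norm1 g"
    and fourier_mollify: "fourier (mollify e g) \<xi> = of_real (exp (- e\<^sup>2 * (norm \<xi>)\<^sup>2 / 2)) * fourier g \<xi>"
  unfolding mollify_def
  using integrable_convol[OF integrable_gauss_complex[OF e] g]
    norm_convol[OF integrable_gauss_complex[OF e] g]
    fourier_convol[OF integrable_gauss_complex[OF e] g]
  by (simp_all add: integral_gauss[OF e] fourier_gauss[OF e])

lemma mollify_bounded:
  fixes g :: "real ^ 'n \<Rightarrow> complex"
  assumes e: "0 < e" and g: "integrable lborel g"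
  shows "norm (mollify e g x) \<le> (1 / sqrt (2 * pi * e\<^sup>2)) ^ CARD('n) * norm1 g"
proof -
  have le: "gauss e z \<le> (1 / sqrt (2 * pi * e\<^sup>2)) ^ CARD('n)" for z :: "real ^ 'n"
    unfolding gauss_eq by (rule mult_left_le) auto
  have [measurable]: "g \<in> borel_measurable borel" using g by simp
  have "norm (mollify e g x) \<le> (LINT y|lborel. norm (of_real (gauss e (x - y)) * g y))"
    unfolding mollify_def convol_def by (rule integral_norm_bound)
  also have "\<dots> \<le> (LINT y|lborel. (1 / sqrt (2 * pi * e\<^sup>2)) ^ CARD('n) * norm (g y))"
  proof (rule integral_mono)
    show int: "integrable lborel (\<lambda>y. (1 / sqrt (2 * pi * e\<^sup>2)) ^ CARD('n) * norm (g y))"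
      using g by simp
    show "integrable lborel (\<lambda>y. norm (of_real (gauss e (x - y)) * g y))"
      by (rule Bochner_Integration.integrable_bound[OF int])
         (use le in \<open>auto simp: norm_mult intro!: mult_mono\<close>)
    show "norm (of_real (gauss e (x - y)) * g y) \<le> (1 / sqrt (2 * pi * e\<^sup>2)) ^ CARD('n) * norm (g y)" for y
      using le[of "x - y"] by (simp add: norm_mult mult_right_mono)
  qed
  finally show ?thesis by simp
qed

lemma mollify_diff:
  fixes f g :: "real ^ 'n \<Rightarrow> complex"
  assumes e: "0 < e" and f: "integrable lborel f" and g: "integrable lborel g"
  shows "AE x in lborel. mollify e (\<lambda>x. f x - g x) x = mollify e f x - mollify e g x"
proof -
  have "AE x in lborel. integrable lborel (\<lambda>y. of_real (gauss e (x - y)) * h y)"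
    if "integrable lborel h" for h :: "real ^ 'n \<Rightarrow> complex"
    using lborel_pair.AE_integrable_snd[OF integrable_convol_kernel[OF integrable_gauss_complex[OF e] that]] .
  from this[OF f] this[OF g] show ?thesis
    by eventually_elim (simp add: mollify_def convol_def right_diff_distrib)
qed

text \<open>
  The functions that are the \<open>L\<^sup>1\<close> limit of their mollifications. The widths are restricted to the sequence
  \<open>1 / (k + 1)\<close>, which suffices for passing to the limit. That all \<open>L\<^sup>1\<close> functions have this property
  (\<open>approximable_integrable\<close>) follows by density from the indicators of open sets.
\<close>

definition approximable :: "(real ^ 'n \<Rightarrow> complex) \<Rightarrow> bool" where
  "approximable g \<longleftrightarrow> integrable lborel g \<and>
     (\<lambda>k. LINT x|lborel. norm (mollify (inverse (real (Suc k))) g x - g x)) \<longlonglongrightarrow> 0"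

lemma mollify_error:
  fixes f g :: "real ^ 'n \<Rightarrow> complex"
  assumes e: "0 < e" and f: "integrable lborel f" and g: "integrable lborel g"
  shows "dist1 (mollify e g) g
    \<le> dist1 (mollify e f) f + 2 * dist1 g f"
proof -
  note sf = integrable_mollify[OF e f] and sg = integrable_mollify[OF e g]
  have "dist1 (mollify e g) (mollify e f) = (LINT x|lborel. norm (mollify e (\<lambda>x. g x - f x) x))"
    using mollify_diff[OF e g f] sf sg integrable_mollify[OF e Bochner_Integration.integrable_diff[OF g f]]
    by (intro integral_cong_AE) auto
  also have "\<dots> \<le> dist1 g f"
    using norm_mollify[OF e Bochner_Integration.integrable_diff[OF g f]] by simp
  finally have 1: "dist1 (mollify e g) (mollify e f) \<le> dist1 g f" .
  have 2: "dist1 f g = dist1 g f"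
    by (simp add: norm_minus_commute)
  from L1_norm_triangle[OF sg sf g] L1_norm_triangle[OF sf f g] 1 2 show ?thesis by linarith
qed

lemma approximable_closed:
  fixes g :: "real ^ 'n \<Rightarrow> complex"
  assumes g: "integrable lborel g"
    and ex: "\<And>\<eta>. 0 < \<eta> \<Longrightarrow> \<exists>f. approximable f \<and> (LINT x|lborel. norm (g x - f x)) \<le> \<eta>"
  shows "approximable g"
  unfolding approximable_def
proof (intro conjI g LIMSEQ_I)
  fix r :: real assume r: "0 < r"
  obtain f where f: "approximable f" and fg: "dist1 g f \<le> r / 4"
    using ex[of "r / 4"] r by auto
  from f have fi: "integrable lborel f"
    and "(\<lambda>k. LINT x|lborel. norm (mollify (inverse (real (Suc k))) f x - f x)) \<longlonglongrightarrow> 0"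
    by (auto simp: approximable_def)
  from LIMSEQ_D[OF this(2), of "r / 2"] r obtain K where
    K: "\<And>k. k \<ge> K \<Longrightarrow> (LINT x|lborel. norm (mollify (inverse (real (Suc k))) f x - f x)) < r / 2"
    by auto
  show "\<exists>no. \<forall>k\<ge>no. norm ((LINT x|lborel. norm (mollify (inverse (real (Suc k))) g x - g x)) - 0) < r"
  proof (intro exI allI impI)
    fix k assume k: "K \<le> k"
    have "(LINT x|lborel. norm (mollify (inverse (real (Suc k))) g x - g x)) < r"
      using mollify_error[OF _ fi g, of "inverse (real (Suc k))"] K[OF k] fg by simp
    then show "norm ((LINT x|lborel. norm (mollify (inverse (real (Suc k))) g x - g x)) - 0) < r"
      by simp
  qed
qed

lemma complex_indicator: "(indicator A :: 'a \<Rightarrow> complex) = (\<lambda>x. of_real (indicator A x))"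
  by (auto simp: indicator_def)

text \<open>
  Mollifications \<open>\<phi>\<close> of the indicator of an open set \<open>U\<close> converge to 1 pointwise in \<open>U\<close>. No convergence
  off \<open>U\<close> is needed: as \<open>\<integral> \<phi> \<le> \<bar>U\<bar>\<close>, the distance in \<open>L\<^sup>1\<close> is at most
  \<open>2 \<bar>U\<bar> - 2 \<integral>\<^sub>U \<phi>\<close>.
\<close>

lemma approximable_open:
  fixes U :: "(real ^ 'n) set"
  assumes U: "open U" and fin: "emeasure lborel U < \<infinity>"
  shows "approximable (indicator U)"
proof -
  define ep where "ep k = inverse (real (Suc k))" for k
  have ep: "0 < ep k" for k by (simp add: ep_def)
  have [measurable]: "U \<in> sets borel" using U by simp
  have iU: "integrable lborel (indicator U :: real ^ 'n \<Rightarrow> real)"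
    using fin by (intro integrable_real_indicator) auto
  have iUc: "integrable lborel (indicator U :: real ^ 'n \<Rightarrow> complex)"
    unfolding complex_indicator using iU by (rule integrable_of_real)
  define \<phi> where "\<phi> k x = (LINT y|lborel. gauss (ep k) (x - y) * indicator U y)" for k x
  have s\<phi>: "mollify (ep k) (indicator U) x = of_real (\<phi> k x)" for k x
    unfolding mollify_def convol_def \<phi>_def
    by (subst integral_complex_of_real[symmetric]) (auto simp: indicator_def intro!: Bochner_Integration.integral_cong)
  have int: "integrable lborel (\<lambda>y. gauss (ep k) (x - y) * indicator V y)" if "V \<in> sets borel" for k V and x :: "real ^ 'n"
    by (rule Bochner_Integration.integrable_bound[OF integrable_reflect[OF integrable_gauss[OF ep]]])
       (use that in \<open>auto simp: indicator_def\<close>)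
  have \<phi>0: "0 \<le> \<phi> k x" for k x unfolding \<phi>_def by (intro Bochner_Integration.integral_nonneg) auto
  have \<phi>1: "\<phi> k x = 1 - (LINT y|lborel. gauss (ep k) (x - y) * indicator (- U) y)" for k x
  proof -
    have "\<phi> k x + (LINT y|lborel. gauss (ep k) (x - y) * indicator (- U) y)
        = (LINT y|lborel. gauss (ep k) (x - y) * indicator U y + gauss (ep k) (x - y) * indicator (- U) y)"
      unfolding \<phi>_def by (rule Bochner_Integration.integral_add[symmetric]) (auto intro!: int)
    also have "\<dots> = (LINT y|lborel. gauss (ep k) (x - y))"
      by (intro Bochner_Integration.integral_cong) (auto simp: indicator_def)
    also have "\<dots> = 1"
      using integral_reflect[OF integrable_gauss[OF ep]] integral_gauss[OF ep] by metis
    finally show ?thesis by simp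
  qed
  have \<phi>le: "\<phi> k x \<le> 1" for k x
    unfolding \<phi>1 by (simp add: Bochner_Integration.integral_nonneg)
  have i\<phi>: "integrable lborel (\<phi> k)" for k
    using integrable_Re[OF integrable_mollify[OF ep iUc, of k]] by (simp add: s\<phi>)
  have nU: "norm (indicator U x :: complex) = indicator U x" for x :: "real ^ 'n"
    by (simp add: indicator_def)
  have \<phi>int: "(LINT x|lborel. \<phi> k x) \<le> measure lborel U" for k
    using norm_mollify[OF ep iUc, of k] \<phi>0 by (simp add: s\<phi> nU)
  have lim: "(\<lambda>k. indicator U x * \<phi> k x) \<longlonglongrightarrow> indicator U x" for x
  proof (cases "x \<in> U")
    case True
    then obtain \<rho> where \<rho>: "0 < \<rho>" "ball x \<rho> \<subseteq> U"
      using U by (auto simp: open_contains_ball)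
    define C where "C = 2 ^ CARD('n) * exp 1 / \<rho>"
    have near: "1 - \<phi> k x \<le> C * ep k" for k
    proof -
      have "1 - \<phi> k x = (LINT y|lborel. gauss (ep k) (x - y) * indicator (- U) y)"
        unfolding \<phi>1 by simp
      also have "\<dots> \<le> (LINT y|lborel. C * ep k * gauss (2 * ep k) (x - y))"
      proof (rule integral_mono)
        show "integrable lborel (\<lambda>y. gauss (ep k) (x - y) * indicator (- U) y)"
          by (rule int) auto
        show "integrable lborel (\<lambda>y. C * ep k * gauss (2 * ep k) (x - y))"
          using ep[of k] by (intro integrable_mult_right integrable_reflect integrable_gauss) auto
        fix y
        show "gauss (ep k) (x - y) * indicator (- U) y \<le> C * ep k * gauss (2 * ep k) (x - y)"
        proof (cases "y \<in> U")
          case False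
          then have "y \<notin> ball x \<rho>" using \<rho> by auto
          then have "\<rho> \<le> norm (x - y)" by (simp add: dist_norm)
          then have "\<rho> * gauss (ep k) (x - y) \<le> norm (x - y) * gauss (ep k) (x - y)"
            by (rule mult_right_mono) simp
          then show ?thesis
            using gauss_decay[OF ep, of "x - y" 1 k] False \<rho>(1)
            by (simp add: C_def field_simps)
        qed (use ep[of k] \<rho>(1) in \<open>simp add: C_def\<close>)
      qed
      also have "\<dots> = C * ep k"
        using integral_reflect[OF integrable_gauss[of "2 * ep k"], of x] integral_gauss[of "2 * ep k", where 'n = 'n] ep[of k]
        by simp
      finally show ?thesis .
    qed
    have "norm (\<phi> k x - 1) \<le> C * ep k" for k
      using near[of k] \<phi>le[of k x] unfolding real_norm_def by linarith
    moreover have "(\<lambda>k. C * ep k) \<longlonglongrightarrow> 0"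
      unfolding ep_def using tendsto_mult_right_zero[OF LIMSEQ_inverse_real_of_nat] by simp
    ultimately have "(\<lambda>k. \<phi> k x - 1) \<longlonglongrightarrow> 0"
      by (rule Lim_null_comparison[OF always_eventually[OF allI]])
    then show ?thesis using True by (simp add: Lim_null[symmetric])
  qed simp
  have iU\<phi>: "integrable lborel (\<lambda>x. indicator U x * \<phi> k x)" for k
    by (rule Bochner_Integration.integrable_bound[OF i\<phi>[of k]])
       (use borel_measurable_integrable[OF i\<phi>[of k]] in \<open>auto simp: indicator_def\<close>)
  have "(\<lambda>k. LINT x|lborel. indicator U x * \<phi> k x) \<longlonglongrightarrow> (LINT x|lborel. indicator U x)"
  proof (rule integral_dominated_convergence[OF _ _ iU AE_I2[OF lim]])
    show "AE x in lborel. norm (indicator U x * \<phi> k x) \<le> indicator U x" for k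
      using \<phi>0[of k] \<phi>le[of k] by (intro AE_I2) (simp add: indicator_def)
  qed (use borel_measurable_integrable[OF iU\<phi>] borel_measurable_integrable[OF iU] in auto)
  then have "(\<lambda>k. 2 * measure lborel U - 2 * (LINT x|lborel. indicator U x * \<phi> k x))
      \<longlonglongrightarrow> 2 * measure lborel U - 2 * measure lborel U"
    by (intro tendsto_intros) simp
  then have up: "(\<lambda>k. 2 * measure lborel U - 2 * (LINT x|lborel. indicator U x * \<phi> k x)) \<longlonglongrightarrow> 0"
    by simp
  have "(LINT x|lborel. norm (mollify (ep k) (indicator U) x - indicator U x))
      \<le> 2 * measure lborel U - 2 * (LINT x|lborel. indicator U x * \<phi> k x)" for k
  proof -
    have "norm (mollify (ep k) (indicator U) x - indicator U x)
        = indicator U x - 2 * (indicator U x * \<phi> k x) + \<phi> k x" for x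
    proof -
      have "mollify (ep k) (indicator U) x - indicator U x = of_real (\<phi> k x - indicator U x)"
        unfolding s\<phi> by (simp add: complex_indicator)
      then have "norm (mollify (ep k) (indicator U) x - indicator U x) = \<bar>\<phi> k x - indicator U x\<bar>"
        by (simp only: norm_of_real)
      then show ?thesis
        using \<phi>0[of k x] \<phi>le[of k x] by (cases "x \<in> U") auto
    qed
    then have "(LINT x|lborel. norm (mollify (ep k) (indicator U) x - indicator U x))
        = measure lborel U - 2 * (LINT x|lborel. indicator U x * \<phi> k x) + (LINT x|lborel. \<phi> k x)"
      using iU iU\<phi>[of k] i\<phi>[of k] by simp
    with \<phi>int[of k] show ?thesis by simp
  qed
  then have "(\<lambda>k. LINT x|lborel. norm (mollify (ep k) (indicator U) x - indicator U x)) \<longlonglongrightarrow> 0"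
    by (intro tendsto_sandwich[OF _ _ tendsto_const up]) auto
  then show ?thesis
    using iUc unfolding approximable_def ep_def by simp
qed

lemma approximable_scale:
  assumes "approximable f"
  shows "approximable (\<lambda>x. c * f x)"
proof -
  have s: "mollify e (\<lambda>x. c * f x) x = c * mollify e f x" for e x
    by (simp add: mollify_def convol_def mult.left_commute[of _ c])
  show ?thesis
    using assms tendsto_mult_right_zero[of _ sequentially "norm c"]
    by (auto simp: approximable_def s norm_mult simp flip: right_diff_distrib)
qed

lemma approximable_add:
  fixes f g :: "real ^ 'n \<Rightarrow> complex"
  assumes f: "approximable f" and g: "approximable g"
  shows "approximable (\<lambda>x. f x + g x)"
proof -
  have fi: "integrable lborel f" and gi: "integrable lborel g"
    using f g by (auto simp: approximable_def)
  define ep where "ep k = inverse (real (Suc k))" for k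
  have ep: "0 < ep k" for k by (simp add: ep_def)
  have lim: "(\<lambda>k. (LINT x|lborel. norm (mollify (ep k) f x - f x)) + dist1 (mollify (ep k) g) g) \<longlonglongrightarrow> 0"
    using f g unfolding approximable_def ep_def by (auto intro!: tendsto_add_zero)
  have le: "(LINT x|lborel. norm (mollify (ep k) (\<lambda>x. f x + g x) x - (f x + g x)))
      \<le> dist1 (mollify (ep k) f) f + dist1 (mollify (ep k) g) g" for k
  proof -
    note si = integrable_mollify[OF ep[of k] fi] integrable_mollify[OF ep[of k] gi]
      integrable_mollify[OF ep[of k] Bochner_Integration.integrable_add[OF fi gi]]
    have "AE x in lborel. mollify (ep k) (\<lambda>x. (f x + g x) - g x) x
        = mollify (ep k) (\<lambda>x. f x + g x) x - mollify (ep k) g x"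
      by (rule mollify_diff[OF ep]) (use fi gi in auto)
    then have ae: "AE x in lborel. mollify (ep k) (\<lambda>x. f x + g x) x = mollify (ep k) f x + mollify (ep k) g x"
      by eventually_elim simp
    have "(LINT x|lborel. norm (mollify (ep k) (\<lambda>x. f x + g x) x - (f x + g x)))
      \<le> (LINT x|lborel. norm (mollify (ep k) f x - f x) + norm (mollify (ep k) g x - g x))"
    proof (rule integral_mono_AE)
      show "AE x in lborel. norm (mollify (ep k) (\<lambda>x. f x + g x) x - (f x + g x))
          \<le> norm (mollify (ep k) f x - f x) + norm (mollify (ep k) g x - g x)"
        using ae by eventually_elim (metis add_diff_add norm_triangle_ineq)
    qed (use fi gi si in auto)
    also have "\<dots> = dist1 (mollify (ep k) f) f + dist1 (mollify (ep k) g) g"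
      by (rule Bochner_Integration.integral_add) (use fi gi si in auto)
    finally show ?thesis .
  qed
  have "(\<lambda>k. LINT x|lborel. norm (mollify (ep k) (\<lambda>x. f x + g x) x - (f x + g x))) \<longlonglongrightarrow> 0"
    by (rule tendsto_sandwich[OF _ _ tendsto_const lim]) (use le in auto)
  then show ?thesis
    using fi gi unfolding approximable_def ep_def by simp
qed

lemma approximable_integrable:
  fixes g :: "real ^ 'n \<Rightarrow> complex"
  assumes "integrable lborel g"
  shows "approximable g"
  using assms
proof (induction rule: integrable_induct)
  case (base A c)
  have [measurable]: "A \<in> sets borel" using base by simp
  have iA: "integrable lborel (indicator A :: real ^ 'n \<Rightarrow> complex)" 
    unfolding complex_indicator using integrable_real_indicator[OF base] by (rule integrable_of_real)
  have "approximable (indicator A :: real ^ 'n \<Rightarrow> complex)"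
  proof (rule approximable_closed[OF iA])
    fix \<eta> :: real assume \<eta>: "0 < \<eta>"
    \<comment> \<open>Outer regularity reduces Borel sets to open sets.\<close>
    obtain U where U: "open U" "A \<subseteq> U" "emeasure lborel (U - A) < ennreal \<eta>"
      by (rule outer_regular_lborel[of A \<eta>]) (use \<eta> in auto)
    have [measurable]: "U \<in> sets borel" using U by simp
    have "emeasure lborel U = emeasure lborel A + emeasure lborel (U - A)"
      using U by (subst plus_emeasure) (auto simp: Un_absorb1)
    also have "\<dots> < \<infinity>" using base U(3) by (auto simp: ennreal_add_less_top intro: less_trans)
    finally have "approximable (indicator U :: real ^ 'n \<Rightarrow> complex)"
      using U by (intro approximable_open) auto
    moreover have "(LINT x|lborel. norm (indicator A x - indicator U x :: complex)) = measure lborel (U - A)"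
    proof -
      have "norm (indicator A x - indicator U x :: complex) = indicator (U - A) x" for x
        using U(2) by (auto simp: indicator_def)
      then show ?thesis by simp
    qed
    moreover have "measure lborel (U - A) \<le> \<eta>"
      using U(3) \<eta> unfolding measure_def by (intro enn2real_leI) auto
    ultimately show "\<exists>f. approximable f \<and> (LINT x|lborel. norm (indicator A x - f x)) \<le> \<eta>"
      by auto
  qed
  moreover have "(\<lambda>x. indicator A x *\<^sub>R c) = (\<lambda>x :: real ^ 'n. c * indicator A x)"
    by (auto simp: indicator_def)
  ultimately show ?case
    using approximable_scale[of "indicator A" c] by simp
next
  case (add f g)
  then show ?case by (intro approximable_add)
next
  case (lim f s)
  show ?case
  proof (rule approximable_closed[OF lim.hyps(4)])
    fix \<eta> :: real assume \<eta>: "0 < \<eta>"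
    have "(\<lambda>i. LINT x|lborel. norm (f x - s i x)) \<longlonglongrightarrow> (LINT x|(lborel :: (real ^ 'n) measure). 0)"
    proof (rule integral_dominated_convergence[where w = "\<lambda>x. 3 * norm (f x)"])
      show "AE x in lborel. (\<lambda>i. norm (f x - s i x)) \<longlonglongrightarrow> 0"
        using tendsto_norm[OF tendsto_diff[OF tendsto_const lim.hyps(2)]]
        by (intro AE_I2) (metis diff_self norm_zero)
      show "AE x in lborel. norm (norm (f x - s i x)) \<le> 3 * norm (f x)" for i
        using lim.hyps(3)[of _ i] by (intro AE_I2) (auto intro: order_trans[OF norm_triangle_ineq4])
    qed (use lim.hyps in auto)
    then have "(\<lambda>i. LINT x|lborel. norm (f x - s i x)) \<longlonglongrightarrow> 0" by simp
    from LIMSEQ_D[OF this \<eta>] obtain i where "(LINT x|lborel. norm (f x - s i x)) < \<eta>" by auto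
    then show "\<exists>h. approximable h \<and> (LINT x|lborel. norm (f x - h x)) \<le> \<eta>"
      using lim.IH[of i] by (intro exI[of _ "s i"] conjI) auto
  qed
qed

section \<open>Plancherel inequalities and uniqueness\<close>

lemma fourier_measurable:
  fixes f :: "real ^ 'n \<Rightarrow> complex"
  assumes "integrable lborel f"
  shows "fourier f \<in> borel_measurable borel"
  by (intro borel_measurable_continuous_onI continuous_at_imp_continuous_on ballI isCont_fourier assms)

lemma liminf_le_const:
  fixes X :: "nat \<Rightarrow> ennreal"
  assumes "\<And>k. X k \<le> C"
  shows "liminf X \<le> C"
  using Liminf_le_Limsup[of sequentially X] Limsup_bounded[of X C sequentially] assms
  by (auto intro: order_trans)

lemma ennreal_le_divideI:
  assumes "0 < c" "ennreal c * A \<le> B"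
  shows "A \<le> B / ennreal c"
proof -
  have "A = ennreal c * A / ennreal c"
    using assms(1) by (simp add: ennreal_mult_divide_eq mult.commute)
  also have "\<dots> \<le> B / ennreal c"
    by (rule divide_right_mono_ennreal[OF assms(2)])
  finally show ?thesis .
qed

lemma ennreal_mult_divide_cancel: "0 < c \<Longrightarrow> ennreal c * (A / ennreal c) = A"
  by (simp add: ennreal_times_divide ennreal_mult_divide_eq mult.commute)

lemma cnj_measurable [measurable (raw)]:
  assumes [measurable]: "f \<in> borel_measurable M"
  shows "(\<lambda>t. cnj (f t)) \<in> borel_measurable M"
proof -
  have "cnj \<in> borel_measurable borel"
    by (intro borel_measurable_continuous_onI continuous_on_cnj continuous_on_id)
  from measurable_compose[OF assms this] show ?thesis .
qed

lemma mollify_inversion: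
  fixes g :: "real ^ 'n \<Rightarrow> complex"
  assumes e: "0 < e" and g: "integrable lborel g"
  shows "of_real ((2 * pi) ^ CARD('n)) * mollify e g x
    = (LINT \<xi>|lborel. of_real (exp (- e\<^sup>2 * (norm \<xi>)\<^sup>2 / 2)) * cis (\<xi> \<bullet> x) * fourier g \<xi>)"
proof -
  have [measurable]: "g \<in> borel_measurable borel" using g by simp
  define E where "E \<xi> = exp (- e\<^sup>2 * (norm \<xi>)\<^sup>2 / 2)" for \<xi> :: "real ^ 'n"
  have [measurable]: "E \<in> borel_measurable borel" unfolding E_def by measurable
  have E: "integrable lborel E" unfolding E_def by (rule integrable_exp_norm[OF e])
  have E01: "0 \<le> E \<xi>" "E \<xi> \<le> 1" for \<xi> by (auto simp: E_def)
  have k: "integrable (lborel \<Otimes>\<^sub>M lborel) (\<lambda>(\<xi>, y). of_real (E \<xi>) * cis (\<xi> \<bullet> (x - y)) * g y)"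
  proof (rule integrable_pairI[where B = "\<lambda>\<xi>. E \<xi> * (LINT y|lborel. norm (g y))"])
    show "integrable lborel (\<lambda>y. of_real (E \<xi>) * cis (\<xi> \<bullet> (x - y)) * g y)" for \<xi>
      by (rule Bochner_Integration.integrable_bound[OF g]) (auto simp: norm_mult E01 intro!: AE_I2 mult_left_le_one_le)
    show "(\<lambda>(\<xi>, y). of_real (E \<xi>) * cis (\<xi> \<bullet> (x - y)) * g y) \<in> borel_measurable (lborel \<Otimes>\<^sub>M lborel)"
      by measurable
    show "(LINT y|lborel. norm (of_real (E \<xi>) * cis (\<xi> \<bullet> (x - y)) * g y)) \<le> E \<xi> * (LINT y|lborel. norm (g y))" for \<xi>
      by (simp add: norm_mult E_def)
  qed (use E in \<open>auto intro: sigma_finite_lborel\<close>)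
  have "(LINT y|lborel. (LINT \<xi>|lborel. of_real (E \<xi>) * cis (\<xi> \<bullet> (x - y)) * g y))
      = (LINT \<xi>|lborel. (LINT y|lborel. of_real (E \<xi>) * cis (\<xi> \<bullet> (x - y)) * g y))"
    by (rule lborel_pair.Fubini_integral[OF k])
  also have "(\<lambda>y. LINT \<xi>|lborel. of_real (E \<xi>) * cis (\<xi> \<bullet> (x - y)) * g y)
      = (\<lambda>y. of_real ((2 * pi) ^ CARD('n)) * (of_real (gauss e (x - y)) * g y))"
    unfolding E_def integral_mult_left_zero integral_exp_norm_cis[OF e] by (simp add: mult.assoc)
  also have "(\<lambda>\<xi>. LINT y|lborel. of_real (E \<xi>) * cis (\<xi> \<bullet> (x - y)) * g y)
      = (\<lambda>\<xi>. of_real (E \<xi>) * cis (\<xi> \<bullet> x) * fourier g \<xi>)"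
  proof
    fix \<xi>
    have "cis (\<xi> \<bullet> (x - y)) = cis (\<xi> \<bullet> x) * cis (- (y \<bullet> \<xi>))" for y
      by (simp add: cis_mult inner_diff_right inner_commute)
    then have eq: "of_real (E \<xi>) * cis (\<xi> \<bullet> (x - y)) * g y
        = (of_real (E \<xi>) * cis (\<xi> \<bullet> x)) * (cis (- (y \<bullet> \<xi>)) * g y)" for y
      by (simp add: mult.assoc)
    show "(LINT y|lborel. of_real (E \<xi>) * cis (\<xi> \<bullet> (x - y)) * g y)
        = of_real (E \<xi>) * cis (\<xi> \<bullet> x) * fourier g \<xi>"
      unfolding fourier_def eq by (rule integral_mult_right_zero)
  qed
  finally show ?thesis
    unfolding mollify_def convol_def E_def by simp
qed

lemma
  fixes g :: "real ^ 'n \<Rightarrow> complex"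
  assumes e: "0 < e" and g: "integrable lborel g"
  shows integrable_mollify_sq: "integrable lborel (\<lambda>x. (norm (mollify e g x))\<^sup>2)"
    and integrable_fourier_sq: "integrable lborel (\<lambda>\<xi>. (norm (fourier g \<xi>))\<^sup>2 * exp (- e\<^sup>2 * (norm \<xi>)\<^sup>2))"
    and plancherel_mollify: "(2 * pi) ^ CARD('n) * (LINT x|lborel. (norm (mollify e g x))\<^sup>2)
      = (LINT \<xi>|lborel. (norm (fourier g \<xi>))\<^sup>2 * exp (- e\<^sup>2 * (norm \<xi>)\<^sup>2))"
proof -
  have [measurable]: "g \<in> borel_measurable borel" using g by simp
  have F[measurable]: "fourier g \<in> borel_measurable borel" using g by (rule fourier_measurable)
  define S where "S = mollify e g"
  have S: "integrable lborel S" unfolding S_def by (rule integrable_mollify[OF e g])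
  have [measurable]: "S \<in> borel_measurable borel" using S by simp
  obtain B where B: "norm (S x) \<le> B" for x
    using mollify_bounded[OF e g] unfolding S_def by blast
  have B0: "0 \<le> B" using order_trans[OF norm_ge_zero B[of undefined]] .
  define G where "G = norm1 g"
  have G: "norm (fourier g \<xi>) \<le> G" for \<xi> unfolding G_def by (rule fourier_bound[OF g])
  have G0: "0 \<le> G" using order_trans[OF norm_ge_zero G[of undefined]] .
  define E where "E \<xi> = exp (- e\<^sup>2 * (norm \<xi>)\<^sup>2 / 2)" for \<xi> :: "real ^ 'n"
  have [measurable]: "E \<in> borel_measurable borel" unfolding E_def by measurable
  have E: "integrable lborel E" unfolding E_def by (rule integrable_exp_norm[OF e])
  have E0: "0 \<le> E \<xi>" "E \<xi> \<le> 1" for \<xi> by (auto simp: E_def)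
  have E2: "exp (- e\<^sup>2 * (norm \<xi>)\<^sup>2) = E \<xi> * E \<xi>" for \<xi> :: "real ^ 'n"
    by (simp add: E_def exp_add[symmetric])
  show i1: "integrable lborel (\<lambda>x. (norm (mollify e g x))\<^sup>2)"
    unfolding S_def[symmetric]
    by (rule Bochner_Integration.integrable_bound[OF integrable_mult_right[OF S, of "of_real B"]])
       (use B B0 in \<open>auto simp: norm_mult power2_eq_square mult_right_mono\<close>)
  show i2: "integrable lborel (\<lambda>\<xi>. (norm (fourier g \<xi>))\<^sup>2 * exp (- e\<^sup>2 * (norm \<xi>)\<^sup>2))"
    unfolding E2
  proof (rule Bochner_Integration.integrable_bound[OF integrable_mult_right[OF E, of "G\<^sup>2"]])
    show "AE \<xi> in lborel. norm ((norm (fourier g \<xi>))\<^sup>2 * (E \<xi> * E \<xi>)) \<le> norm (G\<^sup>2 * E \<xi>)"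
      using G G0 E0 by (intro AE_I2) (auto simp: abs_mult intro!: mult_mono power_mono mult_left_le)
  qed measurable
  have k: "integrable (lborel \<Otimes>\<^sub>M lborel) (\<lambda>(\<xi>, x). of_real (E \<xi>) * cis (\<xi> \<bullet> x) * fourier g \<xi> * cnj (S x))"
  proof (rule integrable_pairI[where B = "\<lambda>\<xi>. E \<xi> * (G * norm1 S)"])
    show "(LINT x|lborel. norm (of_real (E \<xi>) * cis (\<xi> \<bullet> x) * fourier g \<xi> * cnj (S x)))
        \<le> E \<xi> * (G * norm1 S)" for \<xi>
      using G E0 by (simp add: norm_mult mult.assoc mult_left_mono mult_right_mono)
    show "integrable lborel (\<lambda>x. of_real (E \<xi>) * cis (\<xi> \<bullet> x) * fourier g \<xi> * cnj (S x))" for \<xi>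
      by (rule Bochner_Integration.integrable_bound[OF integrable_mult_right[OF S, of "of_real (E \<xi>) * fourier g \<xi>"]])
         (auto simp: norm_mult)
    show "(\<lambda>(\<xi>, x). of_real (E \<xi>) * cis (\<xi> \<bullet> x) * fourier g \<xi> * cnj (S x)) \<in> borel_measurable (lborel \<Otimes>\<^sub>M lborel)"
      by measurable
  qed (use E in \<open>auto intro: sigma_finite_lborel\<close>)
  have "(LINT x|lborel. (LINT \<xi>|lborel. of_real (E \<xi>) * cis (\<xi> \<bullet> x) * fourier g \<xi> * cnj (S x)))
      = (LINT \<xi>|lborel. (LINT x|lborel. of_real (E \<xi>) * cis (\<xi> \<bullet> x) * fourier g \<xi> * cnj (S x)))"
    by (rule lborel_pair.Fubini_integral[OF k])
  also have "(\<lambda>x. LINT \<xi>|lborel. of_real (E \<xi>) * cis (\<xi> \<bullet> x) * fourier g \<xi> * cnj (S x))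
      = (\<lambda>x. of_real ((2 * pi) ^ CARD('n) * (norm (S x))\<^sup>2))"
  proof
    fix x
    have "(LINT \<xi>|lborel. of_real (E \<xi>) * cis (\<xi> \<bullet> x) * fourier g \<xi> * cnj (S x))
       = of_real ((2 * pi) ^ CARD('n)) * S x * cnj (S x)"
      unfolding E_def S_def mollify_inversion[OF e g] by simp
    then show "(LINT \<xi>|lborel. of_real (E \<xi>) * cis (\<xi> \<bullet> x) * fourier g \<xi> * cnj (S x))
       = of_real ((2 * pi) ^ CARD('n) * (norm (S x))\<^sup>2)"
      by (simp only: mult.assoc complex_norm_square[symmetric] of_real_mult of_real_power)
  qed
  also have "(\<lambda>\<xi>. LINT x|lborel. of_real (E \<xi>) * cis (\<xi> \<bullet> x) * fourier g \<xi> * cnj (S x))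
      = (\<lambda>\<xi>. of_real ((norm (fourier g \<xi>))\<^sup>2 * exp (- e\<^sup>2 * (norm \<xi>)\<^sup>2)))"
  proof
    fix \<xi>
    have "(LINT x|lborel. of_real (E \<xi>) * cis (\<xi> \<bullet> x) * fourier g \<xi> * cnj (S x))
        = (LINT x|lborel. (of_real (E \<xi>) * fourier g \<xi>) * cnj (cis (- (x \<bullet> \<xi>)) * S x))"
      by (intro Bochner_Integration.integral_cong) (simp_all add: cis_cnj inner_commute)
    also have "\<dots> = of_real (E \<xi>) * fourier g \<xi> * cnj (fourier S \<xi>)"
      unfolding fourier_def[of S] by (simp only: integral_mult_right_zero Bochner_Integration.integral_cnj)
    also have "\<dots> = of_real (E \<xi> * E \<xi>) * (fourier g \<xi> * cnj (fourier g \<xi>))"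
      unfolding S_def fourier_mollify[OF e g] E_def by simp
    also have "\<dots> = of_real ((norm (fourier g \<xi>))\<^sup>2 * exp (- e\<^sup>2 * (norm \<xi>)\<^sup>2))"
      unfolding E2 by (simp only: complex_norm_square[symmetric] of_real_mult of_real_power mult.commute)
    finally show "(LINT x|lborel. of_real (E \<xi>) * cis (\<xi> \<bullet> x) * fourier g \<xi> * cnj (S x))
      = of_real ((norm (fourier g \<xi>))\<^sup>2 * exp (- e\<^sup>2 * (norm \<xi>)\<^sup>2))" .
  qed
  finally have "of_real (LINT x|lborel. (2 * pi) ^ CARD('n) * (norm (S x))\<^sup>2)
      = (of_real (LINT \<xi>|lborel. (norm (fourier g \<xi>))\<^sup>2 * exp (- e\<^sup>2 * (norm \<xi>)\<^sup>2)) :: complex)"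
    unfolding integral_complex_of_real .
  then show "(2 * pi) ^ CARD('n) * (LINT x|lborel. (norm (mollify e g x))\<^sup>2)
      = (LINT \<xi>|lborel. (norm (fourier g \<xi>))\<^sup>2 * exp (- e\<^sup>2 * (norm \<xi>)\<^sup>2))"
    unfolding of_real_eq_iff S_def by simp
qed

text \<open>
  One half of Plancherel's theorem, for every \<open>L\<^sup>1\<close> function: the identity for mollifications passes to
  the limit by Fatou's lemma along an almost everywhere convergent subsequence.
\<close>

lemma nn_integral_norm_sq_le_fourier:
  fixes g :: "real ^ 'n \<Rightarrow> complex"
  assumes g: "integrable lborel g"
  shows "ennreal ((2 * pi) ^ CARD('n)) * norm2_sq g
    \<le> norm2_sq (fourier g)"
proof -
  define ep where "ep k = inverse (real (Suc k))" for k
  have ep: "0 < ep k" for k by (simp add: ep_def)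
  have [measurable]: "g \<in> borel_measurable borel" "fourier g \<in> borel_measurable borel"
    using g fourier_measurable by auto
  have [measurable]: "mollify (ep k) g \<in> borel_measurable borel" for k
    using integrable_mollify[OF ep g] by simp
  have "(\<lambda>k. LINT x|lborel. norm (mollify (ep k) g x - g x)) \<longlonglongrightarrow> 0"
    using approximable_integrable[OF g] by (simp add: approximable_def ep_def)
  from tendsto_L1_AE_subseq[OF _ this] obtain r where
    r: "strict_mono r" "AE x in lborel. (\<lambda>k. mollify (ep (r k)) g x - g x) \<longlonglongrightarrow> 0"
    using g integrable_mollify[OF ep g] by auto
  have b: "ennreal ((2 * pi) ^ CARD('n)) * norm2_sq (mollify (ep k) g)
      \<le> norm2_sq (fourier g)" for k
  proof -
    have "ennreal ((2 * pi) ^ CARD('n)) * norm2_sq (mollify (ep k) g)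
       = ennreal ((2 * pi) ^ CARD('n) * (LINT x|lborel. (norm (mollify (ep k) g x))\<^sup>2))"
      by (subst nn_integral_eq_integral[OF integrable_mollify_sq[OF ep g]]) (auto simp: ennreal_mult)
    also have "\<dots> = (\<integral>\<^sup>+\<xi>. ennreal ((norm (fourier g \<xi>))\<^sup>2 * exp (- (ep k)\<^sup>2 * (norm \<xi>)\<^sup>2)) \<partial>lborel)"
      unfolding plancherel_mollify[OF ep g]
      by (subst nn_integral_eq_integral[OF integrable_fourier_sq[OF ep g]]) auto
    also have "\<dots> \<le> norm2_sq (fourier g)"
      by (intro nn_integral_mono ennreal_leI mult_left_le) auto
    finally show ?thesis .
  qed
  have "norm2_sq g
     = (\<integral>\<^sup>+x. liminf (\<lambda>k. ennreal ((norm (mollify (ep (r k)) g x))\<^sup>2)) \<partial>lborel)"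
  proof (rule nn_integral_cong_AE)
    show "AE x in lborel. ennreal ((norm (g x))\<^sup>2) = liminf (\<lambda>k. ennreal ((norm (mollify (ep (r k)) g x))\<^sup>2))"
      using r(2)
    proof eventually_elim
      case (elim x)
      then have "(\<lambda>k. mollify (ep (r k)) g x) \<longlonglongrightarrow> g x" by (rule Lim_null[THEN iffD2])
      then have "(\<lambda>k. ennreal ((norm (mollify (ep (r k)) g x))\<^sup>2)) \<longlonglongrightarrow> ennreal ((norm (g x))\<^sup>2)"
        by (intro tendsto_ennrealI tendsto_intros)
      from lim_imp_Liminf[OF _ this] show ?case by simp
    qed
  qed
  also have "\<dots> \<le> liminf (\<lambda>k. \<integral>\<^sup>+x. ennreal ((norm (mollify (ep (r k)) g x))\<^sup>2) \<partial>lborel)"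
    by (rule nn_integral_liminf) measurable
  also have "\<dots> \<le> norm2_sq (fourier g) / ennreal ((2 * pi) ^ CARD('n))"
  proof (rule liminf_le_const)
    fix k
    show "norm2_sq (mollify (ep (r k)) g)
       \<le> norm2_sq (fourier g) / ennreal ((2 * pi) ^ CARD('n))"
      by (rule ennreal_le_divideI[OF _ b]) simp
  qed
  finally have "ennreal ((2 * pi) ^ CARD('n)) * norm2_sq g
     \<le> ennreal ((2 * pi) ^ CARD('n)) * (norm2_sq (fourier g) / ennreal ((2 * pi) ^ CARD('n)))"
    by (intro mult_left_mono) auto
  also have "\<dots> = norm2_sq (fourier g)"
    by (rule ennreal_mult_divide_cancel) simp
  finally show ?thesis .
qed

lemma fourier_unique:
  fixes f :: "real ^ 'n \<Rightarrow> complex"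
  assumes f: "integrable lborel f" and 0: "AE \<xi> in lborel. fourier f \<xi> = 0"
  shows "AE x in lborel. f x = 0"
proof -
  have [measurable]: "f \<in> borel_measurable borel" using f by simp
  have "norm2_sq (fourier f) = (\<integral>\<^sup>+\<xi>. 0 \<partial>(lborel :: (real ^ 'n) measure))"
    using 0 by (intro nn_integral_cong_AE) auto
  with nn_integral_norm_sq_le_fourier[OF f]
  have "norm2_sq f = 0" by simp
  then have "AE x in lborel. ennreal ((norm (f x))\<^sup>2) = 0"
    by (subst (asm) nn_integral_0_iff_AE) auto
  then show ?thesis by eventually_elim simp
qed

lemma fourier_eq_imp_AE_eq:
  fixes f g :: "real ^ 'n \<Rightarrow> complex"
  assumes "integrable lborel f" "integrable lborel g" "AE \<xi> in lborel. fourier f \<xi> = fourier g \<xi>"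
  shows "AE x in lborel. f x = g x"
proof -
  have "AE \<xi> in lborel. fourier (\<lambda>x. f x - g x) \<xi> = 0"
    using assms(3) by eventually_elim (simp add: fourier_diff[OF assms(1,2)])
  from fourier_unique[OF Bochner_Integration.integrable_diff[OF assms(1,2)] this] show ?thesis by eventually_elim simp
qed


text \<open>Mollification is a contraction on \<open>L\<^sup>2\<close>, by the Cauchy-Schwarz inequality with respect to \<open>gauss e (x - y) dy\<close>.\<close>

lemma nn_integral_mollify_sq_le:
  fixes a :: "real ^ 'n \<Rightarrow> complex"
  assumes e: "0 < e" and a: "integrable lborel a"
  shows "norm2_sq (mollify e a) \<le> norm2_sq a"
proof -
  have [measurable]: "a \<in> borel_measurable borel" using a by simp
  have one: "(\<integral>\<^sup>+y. ennreal (gauss e (y - x)) \<partial>lborel) = 1" "(\<integral>\<^sup>+y. ennreal (gauss e (x - y)) \<partial>lborel) = 1"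
    for x :: "real ^ 'n"
    using nn_integral_eq_integral[OF integrable_translate[OF integrable_gauss[OF e], of x]]
      nn_integral_eq_integral[OF integrable_reflect[OF integrable_gauss[OF e], of x]]
    by (simp_all add: integral_translate[OF integrable_gauss[OF e]] integral_reflect[OF integrable_gauss[OF e]]
        integral_gauss[OF e])
  have "ennreal ((norm (mollify e a x))\<^sup>2) \<le> (\<integral>\<^sup>+y. ennreal (gauss e (x - y)) * ennreal ((norm (a y))\<^sup>2) \<partial>lborel)" for x
  proof -
    have "ennreal (norm (mollify e a x)) \<le> (\<integral>\<^sup>+y. ennreal (norm (of_real (gauss e (x - y)) * a y)) \<partial>lborel)"
      unfolding mollify_def convol_def
    proof (cases "integrable lborel (\<lambda>y. complex_of_real (gauss e (x - y)) * a y)")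
      case True
      then show "ennreal (norm (LINT y|lborel. of_real (gauss e (x - y)) * a y))
          \<le> (\<integral>\<^sup>+y. ennreal (norm (of_real (gauss e (x - y)) * a y)) \<partial>lborel)"
        by (rule integral_norm_bound_ennreal)
    qed (simp add: not_integrable_integral_eq)
    also have "\<dots> = (\<integral>\<^sup>+y. ennreal (sqrt (gauss e (x - y))) * ennreal (sqrt (gauss e (x - y)) * norm (a y)) \<partial>lborel)"
      by (intro nn_integral_cong) (simp add: norm_mult ennreal_mult[symmetric] mult.assoc[symmetric])
    finally have "ennreal ((norm (mollify e a x))\<^sup>2)
       \<le> (\<integral>\<^sup>+y. ennreal (sqrt (gauss e (x - y))) * ennreal (sqrt (gauss e (x - y)) * norm (a y)) \<partial>lborel)\<^sup>2"
      by (simp add: ennreal_power[symmetric] power_mono)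
    also have "\<dots> \<le> (\<integral>\<^sup>+y. (ennreal (sqrt (gauss e (x - y))))\<^sup>2 \<partial>lborel)
       * (\<integral>\<^sup>+y. (ennreal (sqrt (gauss e (x - y)) * norm (a y)))\<^sup>2 \<partial>lborel)"
      by (rule Cauchy_Schwarz_nn_integral) measurable
    also have "\<dots> = (\<integral>\<^sup>+y. ennreal (gauss e (x - y)) * ennreal ((norm (a y))\<^sup>2) \<partial>lborel)"
      by (simp add: ennreal_power power_mult_distrib one ennreal_mult)
    finally show ?thesis .
  qed
  then have "norm2_sq (mollify e a)
     \<le> (\<integral>\<^sup>+x. (\<integral>\<^sup>+y. ennreal (gauss e (x - y)) * ennreal ((norm (a y))\<^sup>2) \<partial>lborel) \<partial>lborel)"
    by (rule nn_integral_mono)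
  also have "\<dots> = (\<integral>\<^sup>+y. (\<integral>\<^sup>+x. ennreal (gauss e (x - y)) * ennreal ((norm (a y))\<^sup>2) \<partial>lborel) \<partial>lborel)"
    by (rule lborel_pair.Fubini') measurable
  also have "\<dots> = (\<integral>\<^sup>+y. ennreal ((norm (a y))\<^sup>2) \<partial>lborel)"
    by (simp add: nn_integral_multc one)
  finally show ?thesis .
qed

text \<open>The other half of Plancherel's theorem; the right-hand side may be infinite.\<close>

lemma nn_integral_fourier_sq_le:
  fixes a :: "real ^ 'n \<Rightarrow> complex"
  assumes a: "integrable lborel a"
  shows "norm2_sq (fourier a)
    \<le> ennreal ((2 * pi) ^ CARD('n)) * norm2_sq a"
proof -
  define ep where "ep k = inverse (real (Suc k))" for k
  have ep: "0 < ep k" for k by (simp add: ep_def)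
  have [measurable]: "fourier a \<in> borel_measurable borel"
    using a by (rule fourier_measurable)
  have ep0: "ep \<longlonglongrightarrow> 0" unfolding ep_def by (rule LIMSEQ_inverse_real_of_nat)
  have "norm2_sq (fourier a)
     = (\<integral>\<^sup>+\<xi>. liminf (\<lambda>k. ennreal ((norm (fourier a \<xi>))\<^sup>2 * exp (- (ep k)\<^sup>2 * (norm \<xi>)\<^sup>2))) \<partial>lborel)"
  proof (rule nn_integral_cong)
    fix \<xi> :: "real ^ 'n"
    have "(\<lambda>k. (norm (fourier a \<xi>))\<^sup>2 * exp (- (ep k)\<^sup>2 * (norm \<xi>)\<^sup>2))
        \<longlonglongrightarrow> (norm (fourier a \<xi>))\<^sup>2 * exp (- 0\<^sup>2 * (norm \<xi>)\<^sup>2)"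
      by (intro tendsto_intros ep0)
    then have "(\<lambda>k. ennreal ((norm (fourier a \<xi>))\<^sup>2 * exp (- (ep k)\<^sup>2 * (norm \<xi>)\<^sup>2)))
        \<longlonglongrightarrow> ennreal ((norm (fourier a \<xi>))\<^sup>2)"
      by (intro tendsto_ennrealI) simp
    from lim_imp_Liminf[OF _ this]
    show "ennreal ((norm (fourier a \<xi>))\<^sup>2) = liminf (\<lambda>k. ennreal ((norm (fourier a \<xi>))\<^sup>2 * exp (- (ep k)\<^sup>2 * (norm \<xi>)\<^sup>2)))"
      by simp
  qed
  also have "\<dots> \<le> liminf (\<lambda>k. \<integral>\<^sup>+\<xi>. ennreal ((norm (fourier a \<xi>))\<^sup>2 * exp (- (ep k)\<^sup>2 * (norm \<xi>)\<^sup>2)) \<partial>lborel)"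
    by (rule nn_integral_liminf) measurable
  also have "\<dots> \<le> ennreal ((2 * pi) ^ CARD('n)) * norm2_sq a"
  proof (rule liminf_le_const)
    fix k
    have "(\<integral>\<^sup>+\<xi>. ennreal ((norm (fourier a \<xi>))\<^sup>2 * exp (- (ep k)\<^sup>2 * (norm \<xi>)\<^sup>2)) \<partial>lborel)
       = ennreal ((2 * pi) ^ CARD('n) * (LINT x|lborel. (norm (mollify (ep k) a x))\<^sup>2))"
      unfolding plancherel_mollify[OF ep a]
      by (subst nn_integral_eq_integral[OF integrable_fourier_sq[OF ep a]]) auto
    also have "\<dots> = ennreal ((2 * pi) ^ CARD('n)) * norm2_sq (mollify (ep k) a)"
      by (subst nn_integral_eq_integral[OF integrable_mollify_sq[OF ep a]]) (auto simp: ennreal_mult)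
    also have "\<dots> \<le> ennreal ((2 * pi) ^ CARD('n)) * norm2_sq a"
      by (intro mult_left_mono nn_integral_mollify_sq_le[OF ep a]) auto
    finally show "(\<integral>\<^sup>+\<xi>. ennreal ((norm (fourier a \<xi>))\<^sup>2 * exp (- (ep k)\<^sup>2 * (norm \<xi>)\<^sup>2)) \<partial>lborel)
      \<le> ennreal ((2 * pi) ^ CARD('n)) * norm2_sq a" .
  qed
  finally show ?thesis .
qed

section \<open>The operator \<open>U\<^sup>1\<^sup>/\<^sup>2\<close> on \<open>L\<^sup>1\<close>\<close>

lemma
  fixes a :: real
  assumes a: "0 < a"
  shows half_gaussian: "has_bochner_integral lborel (\<lambda>s. indicator {0..} s * exp (- a * s\<^sup>2 / 2)) (sqrt (pi / (2 * a)))"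
    and half_gaussian_moment: "has_bochner_integral lborel (\<lambda>s. indicator {0..} s * (s * exp (- a * s\<^sup>2 / 2))) (1 / a)"
proof -
  define c where "c = sqrt (a / 2)"
  have c: "0 < c" "c\<^sup>2 = a / 2" using a by (auto simp: c_def)
  have ind: "indicator {0..} (0 + c * s) = (indicator {0..} s :: real)" for s
    using c(1) by (auto simp: indicator_def zero_le_mult_iff)
  have e: "exp (- (0 + c * s)\<^sup>2) = exp (- a * s\<^sup>2 / 2)" for s
    by (simp add: power_mult_distrib c(2))
  have "has_bochner_integral lborel (\<lambda>s. indicator {0..} (0 + c * s) *\<^sub>R exp (- (0 + c * s)\<^sup>2)) ((sqrt pi / 2) /\<^sub>R \<bar>c\<bar>)"
    by (subst lborel_has_bochner_integral_real_affine_iff[symmetric]) (use c gaussian_moment_0 in auto)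
  moreover have "(sqrt pi / 2) /\<^sub>R \<bar>c\<bar> = sqrt (pi / (2 * a))"
    using a by (simp add: c_def real_sqrt_divide real_sqrt_mult field_simps)
  ultimately show "has_bochner_integral lborel (\<lambda>s. indicator {0..} s * exp (- a * s\<^sup>2 / 2)) (sqrt (pi / (2 * a)))"
    unfolding ind e by simp
  have "has_bochner_integral lborel (\<lambda>s. indicator {0..} (0 + c * s) *\<^sub>R (exp (- (0 + c * s)\<^sup>2) * (0 + c * s) ^ (2 * 0 + 1))) ((fact 0 / 2) /\<^sub>R \<bar>c\<bar>)"
    by (subst lborel_has_bochner_integral_real_affine_iff[symmetric]) (use c gaussian_moment_odd_pos[of 0] in auto)
  from has_bochner_integral_mult_right[OF this, of "1 / c"]
  have "has_bochner_integral lborel (\<lambda>s. 1 / c * (indicator {0..} s *\<^sub>R (exp (- a * s\<^sup>2 / 2) * (0 + c * s) ^ (2 * 0 + 1)))) (1 / c * ((fact 0 / 2) /\<^sub>R \<bar>c\<bar>))"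
    unfolding ind e by simp
  moreover have "1 / c * ((fact 0 / 2) /\<^sub>R \<bar>c\<bar>) = 1 / a"
    using c by (simp add: power2_eq_square field_simps)
  moreover have "1 / c * (indicator {0..} s *\<^sub>R (exp (- a * s\<^sup>2 / 2) * (0 + c * s) ^ (2 * 0 + 1)))
      = indicator {0..} s * (s * exp (- a * s\<^sup>2 / 2))" for s
    using c(1) by simp
  ultimately show "has_bochner_integral lborel (\<lambda>s. indicator {0..} s * (s * exp (- a * s\<^sup>2 / 2))) (1 / a)"
    by simp
qed

text \<open>The kernel of \<open>(I + L)\<^sup>-\<^sup>1\<close>, as the superposition \<open>\<integral> s exp (- s\<^sup>2 / 2) gauss s ds\<close> over \<open>s \<ge> 0\<close>.\<close>

lemma bessel_kernel:
  obtains J :: "real ^ 'n \<Rightarrow> complex" where "integrable lborel J"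
    "norm1 J \<le> 1" "\<And>\<xi>. fourier J \<xi> = of_real (1 / (1 + (norm \<xi>)\<^sup>2))"
proof -
  define w where "w s = indicator {0..} s * (s * exp (- s\<^sup>2 / 2))" for s :: real
  have [measurable]: "w \<in> borel_measurable borel" unfolding w_def by measurable
  have w: "has_bochner_integral lborel w 1"
    unfolding w_def using half_gaussian_moment[of 1] by simp
  have w0: "0 \<le> w s" "s \<le> 0 \<Longrightarrow> w s = 0" for s by (auto simp: w_def indicator_def)
  define k where "k s x = (of_real (w s * gauss s x) :: complex)" for s and x :: "real ^ 'n"
  have ki: "integrable lborel (k s)" and kn: "(LINT x|lborel. norm (k s x)) = w s"
    and kf: "fourier (k s) \<xi> = of_real (w s * exp (- s\<^sup>2 * (norm \<xi>)\<^sup>2 / 2))" for s \<xi>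
  proof -
    consider "0 < s" | "s \<le> 0" by linarith
    then have "integrable lborel (k s) \<and> (LINT x|lborel. norm (k s x)) = w s
      \<and> fourier (k s) \<xi> = of_real (w s * exp (- s\<^sup>2 * (norm \<xi>)\<^sup>2 / 2))"
    proof cases
      case 1
      have "fourier (k s) \<xi> = of_real (w s) * fourier (\<lambda>x. of_real (gauss s x)) \<xi>"
        unfolding k_def of_real_mult by (rule fourier_cmult)
      then show ?thesis
        using 1 integrable_gauss_complex[OF 1, where 'n = 'n] w0(1)[of s]
        by (simp add: k_def[abs_def] norm_mult abs_mult integral_gauss fourier_gauss)
    next
      case 2
      then show ?thesis by (simp add: k_def[abs_def] w0 fourier_def)
    qed
    then show "integrable lborel (k s)" "(LINT x|lborel. norm (k s x)) = w s"
      "fourier (k s) \<xi> = of_real (w s * exp (- s\<^sup>2 * (norm \<xi>)\<^sup>2 / 2))" by auto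
  qed
  have km: "(\<lambda>(s, x). k s x) \<in> borel_measurable (lborel \<Otimes>\<^sub>M lborel)"
    unfolding k_def by measurable
  have K: "integrable (lborel \<Otimes>\<^sub>M lborel) (\<lambda>(s, x). k s x)"
    by (rule integrable_pairI[where B = w])
       (use w km in \<open>auto simp: sigma_finite_lborel ki kn has_bochner_integral_iff\<close>)
  show thesis
  proof
    show "integrable lborel (\<lambda>x. LINT s|lborel. k s x)"
      by (rule superposition_integrable[OF sigma_finite_lborel K])
    show "(LINT x|lborel. norm (LINT s|lborel. k s x)) \<le> 1"
      using superposition_norm[OF sigma_finite_lborel K] w by (simp add: kn has_bochner_integral_iff)
    fix \<xi> :: "real ^ 'n"
    have "0 < 1 + (norm \<xi>)\<^sup>2" by (simp add: add_pos_nonneg)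
    from half_gaussian_moment[OF this]
    have "(LINT s|lborel. indicator {0..} s * (s * exp (- (1 + (norm \<xi>)\<^sup>2) * s\<^sup>2 / 2))) = 1 / (1 + (norm \<xi>)\<^sup>2)"
      by (simp add: has_bochner_integral_iff)
    moreover have "w s * exp (- s\<^sup>2 * (norm \<xi>)\<^sup>2 / 2) = indicator {0..} s * (s * exp (- (1 + (norm \<xi>)\<^sup>2) * s\<^sup>2 / 2))" for s
      by (simp add: w_def mult.assoc exp_add[symmetric] algebra_simps add_divide_distrib diff_divide_distrib)
    ultimately show "fourier (\<lambda>x. LINT s|lborel. k s x) \<xi> = of_real (1 / (1 + (norm \<xi>)\<^sup>2))"
      unfolding superposition_fourier[OF sigma_finite_lborel K] kf integral_complex_of_real by simp
  qed
qed

lemma gbinomial_step: "(a :: real) gchoose Suc m = (a gchoose m) * ((a - real m) / (real m + 1))"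
  using gbinomial_mult_1[of a m] by (simp add: field_simps)

text \<open>
  The coefficients of the binomial series of \<open>sqrt (1 - z)\<close> are negative from the second on, and their partial
  sums are nonnegative. As the first one is 1, the absolute values have sum at most 2.
\<close>

lemma half_binomial_coeffs:
  defines "c \<equiv> \<lambda>m. ((1/2 :: real) gchoose m) * (-1) ^ m"
  shows "(\<Sum>m<N. \<bar>c m\<bar>) \<le> 2" and "\<bar>z\<bar> < 1 \<Longrightarrow> (\<lambda>m. c m * z ^ m) sums sqrt (1 - z)"
proof -
  have neg: "c (Suc m) \<le> 0" for m
  proof (induction m)
    case 0
    show ?case by (simp add: c_def)
  next
    case (Suc m)
    have "c (Suc (Suc m)) = c (Suc m) * ((real m + 1 / 2) / (real m + 2))"
      unfolding c_def gbinomial_step[of _ "Suc m"] by (simp add: field_simps)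
    then show ?case using Suc by (simp add: mult_nonpos_nonneg divide_nonpos_pos)
  qed
  have pos: "0 \<le> ((-1/2 :: real) gchoose m) * (-1) ^ m" for m
  proof (induction m)
    case (Suc m)
    have "((-1/2 :: real) gchoose Suc m) * (-1) ^ Suc m = (((-1/2 :: real) gchoose m) * (-1) ^ m) * ((real m + 1 / 2) / (real m + 1))"
      unfolding gbinomial_step[of _ m] by (simp add: field_simps)
    then show ?case using Suc by simp
  qed simp
  \<comment> \<open>The partial sums at \<open>z = 1\<close> are, up to sign, again binomial coefficients, with upper index \<open>- 1/2\<close>.\<close>
  have part: "(\<Sum>m\<le>N. c m) \<ge> 0" for N
    unfolding c_def using gbinomial_sum_lower_neg[of "1/2 :: real" N] pos[of N] by (simp add: mult.commute)
  have "(\<Sum>m<Suc N. \<bar>c m\<bar>) \<le> 2" for N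
  proof -
    have "(\<Sum>m<Suc N. \<bar>c m\<bar>) = 2 * c 0 - (\<Sum>m<Suc N. c m)"
      using neg unfolding sum.lessThan_Suc_shift by (simp add: c_def sum_negf)
    also have "\<dots> \<le> 2" using part[of N] by (simp add: c_def lessThan_Suc_atMost)
    finally show ?thesis .
  qed
  then show "(\<Sum>m<N. \<bar>c m\<bar>) \<le> 2" by (cases N) auto
  assume "\<bar>z\<bar> < 1"
  then have "(\<lambda>n. ((1/2) gchoose n) * (- z) ^ n) sums sqrt (1 + (- z))"
    by (intro sqrt_series) auto
  then show "(\<lambda>m. c m * z ^ m) sums sqrt (1 - z)"
    by (simp add: c_def power_minus[of z] mult_ac)
qed

text \<open>
  \<open>U\<^sup>1\<^sup>/\<^sup>2 f\<close> is the sum of the binomial series in \<open>(I + L)\<^sup>-\<^sup>1\<close>, applied to \<open>f\<close>. On the Fourier side the series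
  is summed only where \<open>\<xi> \<noteq> 0\<close>, that is, inside the disc of convergence.
\<close>

lemma U_half_exists:
  fixes f :: "real ^ 'n \<Rightarrow> complex"
  assumes f: "integrable lborel f"
  obtains g where "U_half f g" "norm1 g \<le> 2 * norm1 f"
proof -
  obtain J :: "real ^ 'n \<Rightarrow> complex" where J: "integrable lborel J" "norm1 J \<le> 1"
    "\<And>\<xi>. fourier J \<xi> = of_real (1 / (1 + (norm \<xi>)\<^sup>2))" using bessel_kernel by blast
  define F where "F m = (convol J ^^ m) f" for m
  have F: "integrable lborel (F m) \<and> (LINT x|lborel. norm (F m x)) \<le> norm1 f
     \<and> (\<forall>\<xi>. fourier (F m) \<xi> = of_real ((1 / (1 + (norm \<xi>)\<^sup>2)) ^ m) * fourier f \<xi>)" for m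
  proof (induction m)
    case (Suc m)
    have S: "F (Suc m) = convol J (F m)" by (simp add: F_def)
    have "(LINT x|lborel. norm (F (Suc m) x)) \<le> norm1 J * norm1 (F m)"
      unfolding S using J Suc by (intro norm_convol) auto
    also have "\<dots> \<le> 1 * norm1 f"
      using J Suc by (intro mult_mono) auto
    finally show ?case
      using J Suc by (auto simp: S fourier_convol intro: integrable_convol)
  qed (use f in \<open>auto simp: F_def\<close>)
  define c where "c m = ((1/2 :: real) gchoose m) * (-1) ^ m" for m
  note c = half_binomial_coeffs[folded c_def]
  have cs: "summable (\<lambda>m. \<bar>c m\<bar>)" by (rule summableI_nonneg_bounded) (use c(1) in auto)
  have c2: "(\<Sum>m. \<bar>c m\<bar>) \<le> 2" by (rule suminf_le_const[OF cs]) (use c(1) in auto)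
  define v where "v m x = of_real (c m) * F m x" for m x
  have v: "integrable lborel (v m)" for m using F by (simp add: v_def[abs_def])
  have vn: "norm1 (v m) \<le> \<bar>c m\<bar> * norm1 f" for m
    using F[of m] by (simp add: v_def norm_mult mult_left_mono)
  have vs: "summable (\<lambda>m. LINT x|lborel. norm (v m x))"
    by (rule summable_comparison_test'[OF summable_mult2[OF cs, of "LINT x|lborel. norm (f x)"], of 0]) (use vn in auto)
  from L1_series[OF v vs] obtain g where g: "integrable lborel g"
    and lim: "(\<lambda>N. LINT x|lborel. norm (g x - (\<Sum>i<N. v i x))) \<longlonglongrightarrow> 0"
    and gn: "norm1 g \<le> (\<Sum>m. LINT x|lborel. norm (v m x))" by blast
  have "(\<Sum>m. LINT x|lborel. norm (v m x)) \<le> (\<Sum>m. \<bar>c m\<bar> * norm1 f)"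
    by (rule suminf_le[OF vn vs summable_mult2[OF cs]])
  also have "\<dots> = (\<Sum>m. \<bar>c m\<bar>) * norm1 f"
    by (rule suminf_mult2[OF cs, symmetric])
  also have "\<dots> \<le> 2 * norm1 f"
    using c2 by (intro mult_right_mono) auto
  finally have n2: "norm1 g \<le> 2 * norm1 f" using gn by linarith
  have "fourier g \<xi> = of_real (norm \<xi> / sqrt (1 + (norm \<xi>)\<^sup>2)) * fourier f \<xi>" if "\<xi> \<noteq> 0" for \<xi>
  proof -
    define z where "z = 1 / (1 + (norm \<xi>)\<^sup>2)"
    have p: "0 < 1 + (norm \<xi>)\<^sup>2" by (simp add: add_pos_nonneg)
    have z: "\<bar>z\<bar> < 1" using that p by (simp add: z_def abs_of_pos)
    have sq: "sqrt (1 - z) = norm \<xi> / sqrt (1 + (norm \<xi>)\<^sup>2)"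
    proof -
      have "1 - z = (norm \<xi>)\<^sup>2 / (1 + (norm \<xi>)\<^sup>2)" using p by (simp add: z_def field_simps)
      then show ?thesis by (simp add: real_sqrt_divide)
    qed
    have "fourier (\<lambda>x. \<Sum>i<N. v i x) \<xi> = of_real (\<Sum>i<N. c i * z ^ i) * fourier f \<xi>" for N
      using F by (simp add: fourier_sum v v_def[abs_def] fourier_cmult z_def sum_distrib_right mult.assoc)
    with fourier_tendsto[OF _ g lim, of \<xi>] v
    have "(\<lambda>N. of_real (\<Sum>i<N. c i * z ^ i) * fourier f \<xi>) \<longlonglongrightarrow> fourier g \<xi>" by simp
    moreover have "(\<lambda>N. of_real (\<Sum>i<N. c i * z ^ i) * fourier f \<xi>) \<longlonglongrightarrow> of_real (sqrt (1 - z)) * fourier f \<xi>"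
      using c(2)[OF z] unfolding sums_def by (intro tendsto_intros)
    ultimately show ?thesis unfolding sq[symmetric] by (rule LIMSEQ_unique)
  qed
  moreover have "AE \<xi> in lborel. (\<xi> :: real ^ 'n) \<noteq> 0" by (rule AE_lborel_singleton)
  ultimately have "U_half f g"
    unfolding U_half_def fourier_multiplier_def using f g by auto
  then show thesis using n2 that by blast
qed

section \<open>Local Riesz transforms of atoms\<close>

text \<open>
  The part of \<open>1 / sqrt (1 + \<bar>\<xi>\<bar>\<^sup>2)\<close> that comes from the scales in \<open>A\<close>. By \<open>half_gaussian\<close>, all
  nonnegative scales together give the full symbol (\<open>rmult_total\<close>).
\<close>

definition rmult :: "real set \<Rightarrow> real ^ 'n \<Rightarrow> real" where
  "rmult A \<xi> = sqrt (2 / pi) * (LINT s|lborel. indicator A s * exp (- (1 + (norm \<xi>)\<^sup>2) * s\<^sup>2 / 2))"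

text \<open>
  The part of \<open>\<partial>\<^sub>j (I + L)\<^sup>-\<^sup>1\<^sup>/\<^sup>2 a\<close> that comes from the scales in \<open>A\<close>; its symbol is \<open>\<i> \<xi>\<^sub>j rmult A \<xi>\<close>. The
  integral converges absolutely in \<open>L\<^sup>1\<close> if \<open>A\<close> is bounded away from 0.
\<close>

definition riesz_part :: "'n \<Rightarrow> real set \<Rightarrow> (real ^ 'n \<Rightarrow> complex) \<Rightarrow> real ^ 'n \<Rightarrow> complex" where
  "riesz_part j A a x = (LINT s|lborel. of_real (sqrt (2 / pi) * indicator A s * exp (- s\<^sup>2 / 2)) *
     convol (\<lambda>z. of_real (dgauss j s z)) a x)"

lemma integrable_rmult:
  fixes \<xi> :: "real ^ 'n"
  assumes [measurable]: "A \<in> sets borel" and A: "A \<subseteq> {0..}"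
  shows "integrable lborel (\<lambda>s. indicator A s * exp (- (1 + (norm \<xi>)\<^sup>2) * s\<^sup>2 / 2))"
proof (rule Bochner_Integration.integrable_bound)
  have "0 < 1 + (norm \<xi>)\<^sup>2" by (simp add: add_pos_nonneg)
  from half_gaussian[OF this]
  show "integrable lborel (\<lambda>s. indicator {0..} s * exp (- (1 + (norm \<xi>)\<^sup>2) * s\<^sup>2 / 2))"
    by (simp add: has_bochner_integral_iff)
qed (use A in \<open>auto simp: indicator_def\<close>)

lemma rmult_total:
  fixes \<xi> :: "real ^ 'n"
  shows "rmult {0..} \<xi> = 1 / sqrt (1 + (norm \<xi>)\<^sup>2)"
proof -
  define q where "q = 1 + (norm \<xi>)\<^sup>2"
  have p: "0 < q" by (simp add: q_def add_pos_nonneg)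
  show ?thesis
    using half_gaussian[OF p] p unfolding rmult_def q_def[symmetric]
    by (simp add: has_bochner_integral_iff real_sqrt_divide real_sqrt_mult)
qed

lemma rmult_nonneg: "0 \<le> rmult A \<xi>"
  unfolding rmult_def by (intro mult_nonneg_nonneg Bochner_Integration.integral_nonneg) auto

lemma rmult_mono:
  assumes "A \<in> sets borel" "B \<in> sets borel" "A \<subseteq> B" "B \<subseteq> {0..}"
  shows "rmult A \<xi> \<le> rmult B \<xi>"
  unfolding rmult_def
  by (intro mult_left_mono integral_mono integrable_rmult) (use assms in \<open>auto simp: indicator_def\<close>)

lemma rmult_add:
  assumes "A \<in> sets borel" "B \<in> sets borel" "A \<inter> B = {}" "A \<union> B \<subseteq> {0..}"
  shows "rmult (A \<union> B) \<xi> = rmult A \<xi> + rmult B \<xi>"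
proof -
  have "indicator (A \<union> B) s * t = indicator A s * t + indicator B s * t" for s t :: real
    using assms(3) by (auto simp: indicator_def)
  moreover have "integrable lborel (\<lambda>s. indicator A s * exp (- (1 + (norm \<xi>)\<^sup>2) * s\<^sup>2 / 2))"
    "integrable lborel (\<lambda>s. indicator B s * exp (- (1 + (norm \<xi>)\<^sup>2) * s\<^sup>2 / 2))"
    using integrable_rmult[of A \<xi>] integrable_rmult[of B \<xi>] assms by auto
  ultimately show ?thesis
    unfolding rmult_def by (simp only: Bochner_Integration.integral_add distrib_left)
qed

lemma rmult_measurable [measurable]:
  assumes [measurable]: "A \<in> sets borel"
  shows "rmult A \<in> borel_measurable borel"
  unfolding rmult_def[abs_def] by measurable

lemma rmult_le_1:
  assumes "A \<in> sets borel" "A \<subseteq> {0..}"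
  shows "\<bar>\<xi> $ j * rmult A \<xi>\<bar> \<le> 1"
proof -
  have p: "0 < 1 + (norm \<xi>)\<^sup>2" by (simp add: add_pos_nonneg)
  have "\<bar>\<xi> $ j * rmult A \<xi>\<bar> \<le> norm \<xi> * (1 / sqrt (1 + (norm \<xi>)\<^sup>2))"
  proof -
    have "rmult A \<xi> \<le> 1 / sqrt (1 + (norm \<xi>)\<^sup>2)"
      using rmult_mono[OF assms(1) _ assms(2), of \<xi>] by (simp add: rmult_total)
    then show ?thesis
      unfolding abs_mult abs_of_nonneg[OF rmult_nonneg]
      by (intro mult_mono component_le_norm_cart rmult_nonneg) auto
  qed
  also have "\<dots> \<le> 1"
    using p real_le_rsqrt[of "norm \<xi>" "1 + (norm \<xi>)\<^sup>2"] by (simp add: divide_le_eq)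
  finally show ?thesis .
qed

lemma rmult_shrink:
  fixes \<xi> :: "real ^ 'n"
  assumes "d \<longlonglongrightarrow> 0" "\<And>k :: nat. 0 < d k"
  shows "(\<lambda>k. rmult {0..<d k} \<xi>) \<longlonglongrightarrow> 0"
proof -
  have "(\<lambda>k. LINT s|lborel. indicator {0..<d k} s * exp (- (1 + (norm \<xi>)\<^sup>2) * s\<^sup>2 / 2))
     \<longlonglongrightarrow> (LINT s|(lborel :: real measure). 0)"
  proof (rule integral_dominated_convergence[OF _ _ integrable_rmult[of "{0..}" \<xi>]])
    show "AE s in lborel. (\<lambda>k. indicator {0..<d k} s * exp (- (1 + (norm \<xi>)\<^sup>2) * s\<^sup>2 / 2)) \<longlonglongrightarrow> 0"
      using AE_lborel_singleton[of 0]
    proof eventually_elim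
      case (elim s)
      have "eventually (\<lambda>k. d k < \<bar>s\<bar>) sequentially"
        using order_tendstoD(2)[OF assms(1)] elim by auto
      then have "eventually (\<lambda>k. indicator {0..<d k} s * exp (- (1 + (norm \<xi>)\<^sup>2) * s\<^sup>2 / 2) = 0) sequentially"
        by eventually_elim (auto simp: indicator_def)
      then show ?case by (rule tendsto_eventually)
    qed
  qed (auto simp: indicator_def)
  from tendsto_mult_right_zero[OF this[unfolded Bochner_Integration.integral_zero], of "sqrt (2 / pi)"]
  show ?thesis unfolding rmult_def .
qed

lemma integrable_dgauss_complex:
  "0 < s \<Longrightarrow> integrable lborel (\<lambda>x :: real ^ 'n. of_real (dgauss j s x) :: complex)"
  by (intro integrable_of_real integrable_dgauss)

text \<open>A common constant, depending on the dimension only, for the following bounds of \<open>dgauss\<close>.\<close>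

definition gauss_const :: "'n itself \<Rightarrow> real" where
  "gauss_const _ = 3 * 4 ^ CARD('n) * (exp 1)\<^sup>2"

lemma gauss_const_ge:
  "2 ^ CARD('n) * exp 1 \<le> gauss_const TYPE('n)" "2 ^ CARD('n) * 6 * exp 1 \<le> 6 * gauss_const TYPE('n)"
  "0 < gauss_const TYPE('n)"
proof -
  have "(2::real) ^ CARD('n) \<le> 3 * 4 ^ CARD('n)"
  proof -
    have "(2::real) ^ CARD('n) \<le> 4 ^ CARD('n)" by (rule power_mono) auto
    also have "\<dots> \<le> 3 * 4 ^ CARD('n)" by simp
    finally show ?thesis .
  qed
  moreover have "exp 1 \<le> (exp 1 :: real)\<^sup>2"
    by (simp add: power2_eq_square)
  ultimately show *: "2 ^ CARD('n) * exp 1 \<le> gauss_const TYPE('n)"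
    unfolding gauss_const_def by (rule mult_mono) simp_all
  then show "2 ^ CARD('n) * 6 * exp 1 \<le> 6 * gauss_const TYPE('n)" by simp
  show "0 < gauss_const TYPE('n)" by (simp add: gauss_const_def)
qed

lemma norm_dgauss_L1:
  assumes s: "0 < s"
  shows "(LINT x|lborel. norm (of_real (dgauss j s (x :: real ^ 'n)) :: complex)) \<le> gauss_const TYPE('n) / s"
proof -
  have "(LINT x|lborel. norm (of_real (dgauss j s x) :: complex)) \<le> (LINT x|lborel. gauss_const TYPE('n) / s * gauss (2 * s) (x :: real ^ 'n))"
  proof (rule integral_mono)
    fix x :: "real ^ 'n"
    have "\<bar>dgauss j s x\<bar> \<le> 2 ^ CARD('n) * exp 1 / s * gauss (2 * s) x"
      by (rule norm_dgauss_le[OF s])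
    also have "\<dots> \<le> gauss_const TYPE('n) / s * gauss (2 * s) x"
      using s gauss_const_ge(1)[where 'n = 'n] by (intro mult_right_mono divide_right_mono) auto
    finally show "norm (of_real (dgauss j s x) :: complex) \<le> gauss_const TYPE('n) / s * gauss (2 * s) x"
      by simp
    show "integrable lborel (\<lambda>x :: real ^ 'n. gauss_const TYPE('n) / s * gauss (2 * s) x)"
      by (intro integrable_mult_right integrable_gauss) (use s in simp)
    show "integrable lborel (\<lambda>x :: real ^ 'n. norm (of_real (dgauss j s x) :: complex))"
      by (intro integrable_norm integrable_dgauss_complex s)
  qed
  also have "\<dots> = gauss_const TYPE('n) / s"
    using s by (simp add: integral_gauss)
  finally show ?thesis .
qed

abbreviation "dconv j s \<equiv> convol (\<lambda>z. of_real (dgauss j s z))"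

lemma convol_dgauss_norm:
  fixes a :: "real ^ 'n \<Rightarrow> complex"
  assumes s: "0 < s" and a: "integrable lborel a"
  shows "(LINT x|lborel. norm (dconv j s a x))
    \<le> gauss_const TYPE('n) / s * norm1 a"
proof -
  have "(LINT x|lborel. norm (of_real (dgauss j s x) :: complex)) * norm1 a
      \<le> gauss_const TYPE('n) / s * norm1 a"
    by (rule mult_right_mono[OF norm_dgauss_L1[OF s]]) simp
  with norm_convol[OF integrable_dgauss_complex[OF s] a, of j] show ?thesis by (rule order_trans)
qed

text \<open>
  For a function with mean zero, \<open>dgauss j s (x - y)\<close> may be replaced by its difference to the value at the centre
  \<open>y = c\<close>. This gains the factor \<open>r / s\<close> over \<open>convol_dgauss_norm\<close> at scales above the radius of the support.
\<close>

lemma convol_dgauss_cancel: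
  fixes a :: "real ^ 'n \<Rightarrow> complex"
  assumes s: "0 < s" and rs: "0 < r" "r \<le> s" and a: "integrable lborel a"
    and supp: "AE x in lborel. x \<notin> ball c r \<longrightarrow> a x = 0" and zero: "(LINT x|lborel. a x) = 0"
  shows "(LINT x|lborel. norm (dconv j s a x))
    \<le> gauss_const TYPE('n) * r / s\<^sup>2 * norm1 a"
proof -
  have ae: "AE x in lborel. integrable lborel (\<lambda>y. of_real (dgauss j s (x - y)) * a y)"
    using lborel_pair.AE_integrable_snd[OF integrable_convol_kernel[OF integrable_dgauss_complex[OF s] a]] .
  have "(LINT x|lborel. norm (dconv j s a x))
     \<le> (LINT x|lborel. gauss_const TYPE('n) * r / s\<^sup>2 * gauss (4 * s) (x - c) * (LINT y|lborel. norm (a y)))"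
  proof (rule integral_mono_AE)
    show "integrable lborel (\<lambda>x. norm (dconv j s a x))"
      by (intro integrable_norm integrable_convol integrable_dgauss_complex s a)
    show "integrable lborel (\<lambda>x. gauss_const TYPE('n) * r / s\<^sup>2 * gauss (4 * s) (x - c) * (LINT y|lborel. norm (a y)))"
      using s by (intro integrable_mult_right integrable_mult_left integrable_translate integrable_gauss) auto
    show "AE x in lborel. norm (dconv j s a x)
       \<le> gauss_const TYPE('n) * r / s\<^sup>2 * gauss (4 * s) (x - c) * (LINT y|lborel. norm (a y))"
      using ae
    proof eventually_elim
      case (elim x)
      have "dconv j s a x
          = (LINT y|lborel. of_real (dgauss j s (x - y)) * a y) - of_real (dgauss j s (x - c)) * (LINT y|lborel. a y)"
        by (simp add: convol_def zero)
      also have "\<dots> = (LINT y|lborel. of_real (dgauss j s (x - y)) * a y - of_real (dgauss j s (x - c)) * a y)"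
        using elim a by simp
      also have "norm \<dots> \<le> (LINT y|lborel. norm (of_real (dgauss j s (x - y)) * a y - of_real (dgauss j s (x - c)) * a y))"
        by (rule integral_norm_bound)
      also have "\<dots> \<le> (LINT y|lborel. gauss_const TYPE('n) * r / s\<^sup>2 * gauss (4 * s) (x - c) * norm (a y))"
      proof (rule integral_mono_AE)
        show "AE y in lborel. norm (of_real (dgauss j s (x - y)) * a y - of_real (dgauss j s (x - c)) * a y)
            \<le> gauss_const TYPE('n) * r / s\<^sup>2 * gauss (4 * s) (x - c) * norm (a y)"
          using supp
        proof eventually_elim
          case (elim y)
          show ?case
          proof (cases "y \<in> ball c r")
            case True
            then have cy: "norm (c - y) \<le> r" by (simp add: dist_norm)
            have "\<bar>dgauss j s (x - y) - dgauss j s (x - c)\<bar> \<le> gauss_const TYPE('n) * norm (c - y) / s\<^sup>2 * gauss (4 * s) (x - c)"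
              using dgauss_lipschitz[OF s, of "c - y" j "x - c"] cy rs by (simp add: gauss_const_def)
            also have "\<dots> \<le> gauss_const TYPE('n) * r / s\<^sup>2 * gauss (4 * s) (x - c)"
              using cy gauss_const_ge(3)[where 'n = 'n] by (intro mult_right_mono divide_right_mono mult_left_mono) auto
            finally have le: "\<bar>dgauss j s (x - y) - dgauss j s (x - c)\<bar> \<le> gauss_const TYPE('n) * r / s\<^sup>2 * gauss (4 * s) (x - c)" .
            have "norm (of_real (dgauss j s (x - y)) * a y - of_real (dgauss j s (x - c)) * a y)
                = \<bar>dgauss j s (x - y) - dgauss j s (x - c)\<bar> * norm (a y)"
              by (simp only: left_diff_distrib[symmetric] of_real_diff[symmetric] norm_mult norm_of_real)
            with mult_right_mono[OF le, of "norm (a y)"] show ?thesis by simp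
          qed (use elim in simp)
        qed
      qed (use elim a in auto)
      finally show ?case by simp
    qed
  qed
  also have "\<dots> = gauss_const TYPE('n) * r / s\<^sup>2 * norm1 a"
    using s integral_translate[OF integrable_gauss[of "4 * s", where 'n = 'n], of c] integral_gauss[of "4 * s", where 'n = 'n]
    by simp
  finally show ?thesis .
qed

text \<open>
  Off the doubled ball, \<open>\<bar>x - y\<bar> \<ge> r\<close> for \<open>y\<close> in the support, and the factor \<open>\<bar>x - y\<bar>\<^sup>2 / r\<^sup>2 \<ge> 1\<close> can be inserted.
  The result is integrable over the scales \<open>s < r\<close>, unlike the bound \<open>convol_dgauss_norm\<close>.
\<close>

lemma convol_dgauss_far:
  fixes a :: "real ^ 'n \<Rightarrow> complex"
  assumes s: "0 < s" and r: "0 < r" and a: "integrable lborel a"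
    and supp: "AE x in lborel. x \<notin> ball c r \<longrightarrow> a x = 0"
  shows "(LINT x|lborel. norm (indicator (- ball c (2 * r)) x * dconv j s a x))
    \<le> 6 * gauss_const TYPE('n) * s / r\<^sup>2 * norm1 a"
proof -
  define C where "C = 6 * gauss_const TYPE('n) * s / r\<^sup>2"
  have C0: "0 \<le> C" using s gauss_const_ge(3)[where 'n = 'n] by (simp add: C_def)
  define b where "b y = (of_real (norm (a y)) :: complex)" for y
  have b: "integrable lborel b" unfolding b_def using a by (intro integrable_of_real integrable_norm)
  have s2: "0 < 2 * s" using s by simp
  have ae: "AE x in lborel. integrable lborel (\<lambda>y. of_real (dgauss j s (x - y)) * a y)"
    using lborel_pair.AE_integrable_snd[OF integrable_convol_kernel[OF integrable_dgauss_complex[OF s] a]] .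
  have aeb: "AE x in lborel. integrable lborel (\<lambda>y. of_real (gauss (2 * s) (x - y)) * b y)"
    using lborel_pair.AE_integrable_snd[OF integrable_convol_kernel[OF integrable_gauss_complex[OF s2] b]] .
  have iD: "integrable lborel (dconv j s a)"
    by (intro integrable_convol integrable_dgauss_complex s a)
  have mD: "(\<lambda>x. indicator (- ball c (2 * r)) x * dconv j s a x) \<in> borel_measurable lborel"
    using borel_measurable_integrable[OF iD] by (intro borel_measurable_times borel_measurable_indicator) auto
  have "(LINT x|lborel. norm (indicator (- ball c (2 * r)) x * dconv j s a x))
     \<le> (LINT x|lborel. C * norm (mollify (2 * s) b x))"
  proof (rule integral_mono_AE)
    show "integrable lborel (\<lambda>x. norm (indicator (- ball c (2 * r)) x * dconv j s a x))"
      by (rule integrable_norm, rule Bochner_Integration.integrable_bound[OF iD mD])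
         (auto simp: norm_mult indicator_def)
    show "integrable lborel (\<lambda>x. C * norm (mollify (2 * s) b x))"
      using integrable_mollify[OF s2 b] by simp
    show "AE x in lborel. norm (indicator (- ball c (2 * r)) x * dconv j s a x)
        \<le> C * norm (mollify (2 * s) b x)"
      using ae aeb
    proof eventually_elim
      case (elim x)
      show ?case
      proof (cases "x \<in> ball c (2 * r)")
        case False
        have R: "mollify (2 * s) b x = of_real (LINT y|lborel. gauss (2 * s) (x - y) * norm (a y))"
          unfolding mollify_def convol_def b_def by (simp flip: integral_complex_of_real)
        have iR: "integrable lborel (\<lambda>y. gauss (2 * s) (x - y) * norm (a y))"
          using integrable_Re[OF elim(2)] by (simp add: b_def)
        have "norm (dconv j s a x) \<le> (LINT y|lborel. norm (of_real (dgauss j s (x - y)) * a y))"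
          unfolding convol_def by (rule integral_norm_bound)
        also have "\<dots> \<le> (LINT y|lborel. C * (gauss (2 * s) (x - y) * norm (a y)))"
        proof (rule integral_mono_AE)
          show "AE y in lborel. norm (of_real (dgauss j s (x - y)) * a y) \<le> C * (gauss (2 * s) (x - y) * norm (a y))"
            using supp
          proof eventually_elim
            case (elim y)
            show ?case
            proof (cases "y \<in> ball c r")
              case True
              have "r \<le> norm (x - y)"
                using True False dist_triangle[of c x y] by (simp add: dist_norm norm_minus_commute)
              then have "r\<^sup>2 \<le> (norm (x - y))\<^sup>2" using r by (intro power_mono) auto
              then have "r\<^sup>2 * \<bar>dgauss j s (x - y)\<bar> \<le> (norm (x - y))\<^sup>2 * \<bar>dgauss j s (x - y)\<bar>"
                by (intro mult_right_mono) auto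
              also have "\<dots> \<le> 2 ^ CARD('n) * 6 * exp 1 * s * gauss (2 * s) (x - y)"
                by (rule norm_dgauss_le(2)[OF s])
              also have "\<dots> \<le> 6 * gauss_const TYPE('n) * s * gauss (2 * s) (x - y)"
                using s gauss_const_ge(2)[where 'n = 'n] by (intro mult_right_mono) auto
              finally have "\<bar>dgauss j s (x - y)\<bar> \<le> C * gauss (2 * s) (x - y)"
                using r by (simp add: C_def field_simps)
              from mult_right_mono[OF this, of "norm (a y)"] show ?thesis
                by (simp add: norm_mult mult.assoc)
            qed (use elim in simp)
          qed
        qed (use elim iR in auto)
        also have "\<dots> = C * (LINT y|lborel. gauss (2 * s) (x - y) * norm (a y))" by simp
        also have "\<dots> \<le> C * norm (mollify (2 * s) b x)"
          unfolding R norm_of_real by (intro mult_left_mono C0) auto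
        finally show ?thesis using False by simp
      qed (use C0 in simp)
    qed
  qed
  also have "\<dots> = C * norm1 (mollify (2 * s) b)" by simp
  also have "\<dots> \<le> C * norm1 a"
    using norm_mollify[OF s2 b] by (intro mult_left_mono C0) (simp add: b_def)
  finally show ?thesis by (simp add: C_def)
qed

lemma L2_on_set:
  fixes h :: "real ^ 'n \<Rightarrow> complex"
  assumes [measurable]: "h \<in> borel_measurable borel" "E \<in> sets borel"
    and E: "emeasure lborel E < \<infinity>" and q: "0 \<le> q"
    and h: "norm2_sq h \<le> ennreal (q\<^sup>2)"
  shows "(\<integral>\<^sup>+x. ennreal (norm (indicator E x * h x)) \<partial>lborel) \<le> ennreal (sqrt (measure lborel E) * q)"
proof -
  define X where "X = (\<integral>\<^sup>+x. ennreal (norm (indicator E x * h x)) \<partial>lborel)"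
  have "X = (\<integral>\<^sup>+x. indicator E x * ennreal (norm (h x)) \<partial>lborel)"
    unfolding X_def by (intro nn_integral_cong) (auto simp: indicator_def)
  then have "X\<^sup>2 \<le> (\<integral>\<^sup>+x. (indicator E x)\<^sup>2 \<partial>lborel) * (\<integral>\<^sup>+x. (ennreal (norm (h x)))\<^sup>2 \<partial>lborel)"
    using Cauchy_Schwarz_nn_integral[of "indicator E" lborel "\<lambda>x. ennreal (norm (h x))"] by simp
  also have "(\<integral>\<^sup>+x. (indicator E x)\<^sup>2 \<partial>lborel) = ennreal (measure lborel E)"
  proof -
    have "(\<integral>\<^sup>+x. (indicator E x)\<^sup>2 \<partial>lborel) = (\<integral>\<^sup>+x. indicator E x \<partial>lborel)"
      by (intro nn_integral_cong) (auto simp: indicator_def)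
    also have "\<dots> = emeasure lborel E" by simp
    also have "\<dots> = ennreal (measure lborel E)" using E by (simp add: emeasure_eq_ennreal_measure)
    finally show ?thesis .
  qed
  also have "ennreal (measure lborel E) * (\<integral>\<^sup>+x. (ennreal (norm (h x)))\<^sup>2 \<partial>lborel)
      \<le> ennreal (measure lborel E) * ennreal (q\<^sup>2)"
    using h by (intro mult_left_mono) (auto simp: ennreal_power)
  also have "ennreal (measure lborel E) * ennreal (q\<^sup>2) = ennreal ((sqrt (measure lborel E) * q)\<^sup>2)"
    by (simp add: ennreal_mult[symmetric] power_mult_distrib)
  finally have le: "X\<^sup>2 \<le> ennreal ((sqrt (measure lborel E) * q)\<^sup>2)" .
  show ?thesis
    unfolding X_def[symmetric]
  proof (cases X)
    case (real x)
    then have "X\<^sup>2 = ennreal (x\<^sup>2)" by (simp add: ennreal_power)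
    with le have "ennreal (x\<^sup>2) \<le> ennreal ((sqrt (measure lborel E) * q)\<^sup>2)" by (simp only:)
    then have "x\<^sup>2 \<le> (sqrt (measure lborel E) * q)\<^sup>2" by (rule ennreal_le_iff[THEN iffD1, rotated]) (rule zero_le_power2)
    then have "x \<le> sqrt (measure lborel E) * q" by (rule power2_le_imp_le) (use q in simp)
    then show "X \<le> ennreal (sqrt (measure lborel E) * q)" using real by (simp add: ennreal_leI)
  next
    case top
    then show "X \<le> ennreal (sqrt (measure lborel E) * q)" using le by (simp add: top_unique power2_eq_square)
  qed
qed

text \<open>The indicator of \<open>E\<close> allows for norms over subsets of the space, in particular off the doubled ball.\<close>

lemma riesz_part_kernel:
  fixes a :: "real ^ 'n \<Rightarrow> complex"
  assumes a: "integrable lborel a" and [measurable]: "A \<in> sets borel" "E \<in> sets borel"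
    and e: "0 < e" and A: "A \<subseteq> {e..}"
  shows "integrable (lborel \<Otimes>\<^sub>M lborel) (\<lambda>(s, x). indicator E x *
      (of_real (sqrt (2 / pi) * indicator A s * exp (- s\<^sup>2 / 2)) * dconv j s a x))"
proof (rule integrable_pairI[where B = "\<lambda>s. sqrt (2 / pi) * (indicator {0..} s * exp (- 1 * s\<^sup>2 / 2)) * (gauss_const TYPE('n) / e * norm1 a)"])
  have [measurable]: "a \<in> borel_measurable borel" using a by simp
  show "(\<lambda>(s, x). indicator E x * (of_real (sqrt (2 / pi) * indicator A s * exp (- s\<^sup>2 / 2)) *
      dconv j s a x)) \<in> borel_measurable (lborel \<Otimes>\<^sub>M lborel)"
    unfolding convol_def by measurable
  show "integrable lborel (\<lambda>s. sqrt (2 / pi) * (indicator {0..} s * exp (- 1 * s\<^sup>2 / 2)) * (gauss_const TYPE('n) / e * norm1 a))"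
    using half_gaussian[of 1] by (intro integrable_mult_left integrable_mult_right) (simp add: has_bochner_integral_iff)
  fix s :: real
  let ?c = "dconv j s a"
  show "integrable lborel (\<lambda>x. indicator E x * (of_real (sqrt (2 / pi) * indicator A s * exp (- s\<^sup>2 / 2)) * ?c x))"
  proof (cases "s \<in> A")
    case True
    then have s: "0 < s" using e A by auto
    have i: "integrable lborel (\<lambda>x. of_real (sqrt (2 / pi) * indicator A s * exp (- s\<^sup>2 / 2)) * ?c x)"
      by (intro integrable_mult_right integrable_convol integrable_dgauss_complex s a)
    show ?thesis
      by (rule Bochner_Integration.integrable_bound[OF i])
         (use borel_measurable_integrable[OF i] in \<open>auto simp: norm_mult indicator_def\<close>)
  qed simp
  show "(LINT x|lborel. norm (indicator E x * (of_real (sqrt (2 / pi) * indicator A s * exp (- s\<^sup>2 / 2)) * ?c x)))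
    \<le> sqrt (2 / pi) * (indicator {0..} s * exp (- 1 * s\<^sup>2 / 2)) * (gauss_const TYPE('n) / e * norm1 a)"
  proof (cases "s \<in> A")
    case True
    then have s: "0 < s" "e \<le> s" using e A by auto
    have i: "integrable lborel ?c" by (intro integrable_convol integrable_dgauss_complex s a)
    have "(LINT x|lborel. norm (indicator E x * (of_real (sqrt (2 / pi) * indicator A s * exp (- s\<^sup>2 / 2)) * ?c x)))
       \<le> (LINT x|lborel. sqrt (2 / pi) * exp (- s\<^sup>2 / 2) * norm (?c x))"
    proof (rule integral_mono_AE')
      show "integrable lborel (\<lambda>x. sqrt (2 / pi) * exp (- s\<^sup>2 / 2) * norm (?c x))"
        using i by simp
    qed (use True in \<open>auto simp: norm_mult indicator_def\<close>)
    also have "\<dots> = sqrt (2 / pi) * exp (- s\<^sup>2 / 2) * (LINT x|lborel. norm (?c x))" by simp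
    also have "\<dots> \<le> sqrt (2 / pi) * exp (- s\<^sup>2 / 2) * (gauss_const TYPE('n) / e * norm1 a)"
    proof (intro mult_left_mono)
      show "(LINT x|lborel. norm (?c x)) \<le> gauss_const TYPE('n) / e * norm1 a"
        using s e gauss_const_ge(3)[where 'n = 'n]
        by (intro order_trans[OF convol_dgauss_norm[OF s(1) a]] mult_right_mono divide_left_mono) auto
    qed auto
    finally show ?thesis using s by simp
  next
    case False
    then show ?thesis using e gauss_const_ge(3)[where 'n = 'n] by simp
  qed
qed (rule sigma_finite_lborel)+

lemma
  fixes a :: "real ^ 'n \<Rightarrow> complex"
  assumes a: "integrable lborel a" and A: "A \<in> sets borel" and e: "0 < e" "A \<subseteq> {e..}"
  shows integrable_riesz_part: "integrable lborel (riesz_part j A a)"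
    and fourier_riesz_part: "fourier (riesz_part j A a) \<xi> = \<i> * of_real (\<xi> $ j * rmult A \<xi>) * fourier a \<xi>"
proof -
  have K: "integrable (lborel \<Otimes>\<^sub>M lborel) (\<lambda>(s, x). of_real (sqrt (2 / pi) * indicator A s * exp (- s\<^sup>2 / 2)) *
      dconv j s a x)"
    using riesz_part_kernel[OF a A _ e, of UNIV j] by simp
  show "integrable lborel (riesz_part j A a)"
    using superposition_integrable[OF sigma_finite_lborel K] unfolding riesz_part_def[abs_def] .
  have "fourier (riesz_part j A a) \<xi>
      = (LINT s|lborel. fourier (\<lambda>x. of_real (sqrt (2 / pi) * indicator A s * exp (- s\<^sup>2 / 2)) * dconv j s a x) \<xi>)"
    using superposition_fourier[OF sigma_finite_lborel K] unfolding riesz_part_def[abs_def] .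
  also have "\<dots> = (LINT s|lborel. (\<i> * of_real (\<xi> $ j * sqrt (2 / pi)) * fourier a \<xi>) *
      of_real (indicator A s * exp (- (1 + (norm \<xi>)\<^sup>2) * s\<^sup>2 / 2)))"
  proof (intro Bochner_Integration.integral_cong refl)
    fix s :: real
    have ex: "exp (- s\<^sup>2 / 2) * exp (- s\<^sup>2 * (norm \<xi>)\<^sup>2 / 2) = exp (- (1 + (norm \<xi>)\<^sup>2) * s\<^sup>2 / 2)"
      by (simp add: exp_add[symmetric] algebra_simps add_divide_distrib diff_divide_distrib)
    show "fourier (\<lambda>x. of_real (sqrt (2 / pi) * indicator A s * exp (- s\<^sup>2 / 2)) * dconv j s a x) \<xi>
        = (\<i> * of_real (\<xi> $ j * sqrt (2 / pi)) * fourier a \<xi>) *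
          of_real (indicator A s * exp (- (1 + (norm \<xi>)\<^sup>2) * s\<^sup>2 / 2))"
    proof (cases "s \<in> A")
      case True
      then have s: "0 < s" using e by auto
      show ?thesis
        unfolding fourier_cmult fourier_convol[OF integrable_dgauss_complex[OF s] a] fourier_dgauss[OF s]
          ex[symmetric] using True by (simp only: of_real_mult) (simp add: mult_ac)
    qed (simp add: fourier_def)
  qed
  also have "\<dots> = \<i> * of_real (\<xi> $ j * rmult A \<xi>) * fourier a \<xi>"
    unfolding integral_mult_right_zero integral_complex_of_real rmult_def by (simp add: mult_ac)
  finally show "fourier (riesz_part j A a) \<xi> = \<i> * of_real (\<xi> $ j * rmult A \<xi>) * fourier a \<xi>" .
qed

lemma norm_riesz_part_le:
  fixes a :: "real ^ 'n \<Rightarrow> complex"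
  assumes a: "integrable lborel a" and A: "A \<in> sets borel" and E: "E \<in> sets borel" and e: "0 < e" "A \<subseteq> {e..}"
    and le: "\<And>s. s \<in> A \<Longrightarrow> exp (- s\<^sup>2 / 2) *
        (LINT x|lborel. norm (indicator E x * dconv j s a x)) \<le> b s"
    and b: "integrable lborel (\<lambda>s. indicator A s * b s)"
  shows "(LINT x|lborel. norm (indicator E x * riesz_part j A a x)) \<le> (LINT s|lborel. indicator A s * b s)"
proof -
  let ?w = "\<lambda>s. of_real (sqrt (2 / pi) * indicator A s * exp (- s\<^sup>2 / 2)) :: complex"
  let ?c = "\<lambda>s. dconv j s a"
  have K: "integrable (lborel \<Otimes>\<^sub>M lborel) (\<lambda>(s, x). indicator E x * (?w s * ?c s x))"
    by (rule riesz_part_kernel[OF a A E e])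
  have "(LINT x|lborel. norm (indicator E x * riesz_part j A a x))
      = (LINT x|lborel. norm (LINT s|lborel. indicator E x * (?w s * ?c s x)))"
    unfolding riesz_part_def integral_mult_right_zero ..
  also have "\<dots> \<le> (LINT s|lborel. LINT x|lborel. norm (indicator E x * (?w s * ?c s x)))"
    by (rule superposition_norm[OF sigma_finite_lborel K])
  also have "\<dots> \<le> (LINT s|lborel. indicator A s * b s)"
  proof (rule integral_mono[OF _ b])
    show "integrable lborel (\<lambda>s. LINT x|lborel. norm (indicator E x * (?w s * ?c s x)))"
      using lborel_pair.integrable_fst'[OF integrable_norm[OF K]] by simp
    fix s
    show "(LINT x|lborel. norm (indicator E x * (?w s * ?c s x))) \<le> indicator A s * b s"
    proof (cases "s \<in> A")
      case True
      have "(LINT x|lborel. norm (indicator E x * (?w s * ?c s x)))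
          = sqrt (2 / pi) * (exp (- s\<^sup>2 / 2) * (LINT x|lborel. norm (indicator E x * ?c s x)))"
        using True by (simp add: norm_mult mult_ac flip: integral_mult_right_zero)
      also have "\<dots> \<le> 1 * b s"
        using pi_ge_two by (intro mult_mono le[OF True]) auto
      finally show ?thesis using True by simp
    qed simp
  qed
  finally show ?thesis .
qed

lemma inverse_square_tail:
  assumes r: "(0::real) < r"
  shows "has_bochner_integral lborel (\<lambda>s. indicator {r..} s * (r / s\<^sup>2)) 1"
proof -
  have "(\<integral>\<^sup>+s. ennreal (r / s\<^sup>2) * indicator {r..} s \<partial>lborel) = ennreal (0 - (- r / r))"
  proof (rule nn_integral_FTC_atLeast[where F = "\<lambda>s. - r / s"])
    show "((\<lambda>s. - r / s) \<longlongrightarrow> 0) at_top" by real_asymp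
    fix s assume "r \<le> s"
    then show "((\<lambda>s. - r / s) has_real_derivative r / s\<^sup>2) (at s)"
      using r by (auto intro!: derivative_eq_intros simp: power2_eq_square)
  qed (use r in auto)
  also have "(\<integral>\<^sup>+s. ennreal (r / s\<^sup>2) * indicator {r..} s \<partial>lborel) = (\<integral>\<^sup>+s. ennreal (indicator {r..} s * (r / s\<^sup>2)) \<partial>lborel)"
    by (intro nn_integral_cong) (auto simp: indicator_def)
  finally show ?thesis
    using r by (intro has_bochner_integral_nn_integral) auto
qed

lemma measure_ball:
  assumes r: "0 < r"
  shows "0 < measure lborel (ball (c :: real ^ 'n) r)"
    and "measure lborel (ball c (2 * r)) = 2 ^ CARD('n) * measure lborel (ball c r)"
  using r by (simp_all add: content_ball power_mult_distrib)

lemma local_atomD: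
  fixes a :: "real ^ 'n \<Rightarrow> complex"
  assumes "local_atom a"
  obtains c r where "0 < r" "r \<le> 1" "(LINT x|lborel. a x) = 0 \<or> r = 1"
    "AE x in lborel. x \<notin> ball c r \<longrightarrow> a x = 0"
    "norm2_sq a \<le> ennreal ((1 / sqrt (measure lborel (ball c r)))\<^sup>2)"
    "integrable lborel a" "norm1 a \<le> 1"
proof -
  have am [measurable]: "a \<in> borel_measurable borel" and a2: "integrable lborel (\<lambda>x. (norm (a x))\<^sup>2)"
    using assms by (auto simp: local_atom_def)
  obtain c r where r: "0 < r" and supp: "AE x in lborel. x \<notin> ball c r \<longrightarrow> a x = 0"
    and size: "sqrt (LINT x|lborel. (norm (a x))\<^sup>2) \<le> measure lborel (ball c r) powr (- 1 / 2)"
    and alt: "r \<le> 1 \<and> (LINT x|lborel. a x) = 0 \<or> r = 1"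
    using assms by (auto simp: local_atom_def)
  define m where "m = measure lborel (ball c r)"
  have m: "0 < m" unfolding m_def by (rule measure_ball[OF r])
  have "m powr (- 1 / 2) = 1 / sqrt m"
    using m powr_minus[of m "1 / 2"] powr_half_sqrt[of m] by (simp add: inverse_eq_divide)
  then have "sqrt (LINT x|lborel. (norm (a x))\<^sup>2) \<le> 1 / sqrt m" using size by (simp add: m_def)
  then have "(sqrt (LINT x|lborel. (norm (a x))\<^sup>2))\<^sup>2 \<le> (1 / sqrt m)\<^sup>2"
    by (intro power_mono) auto
  then have sq: "(LINT x|lborel. (norm (a x))\<^sup>2) \<le> (1 / sqrt m)\<^sup>2" by simp
  have nn: "norm2_sq a \<le> ennreal ((1 / sqrt m)\<^sup>2)"
    using sq by (subst nn_integral_eq_integral[OF a2]) (auto intro: ennreal_leI)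
  have "(\<integral>\<^sup>+x. ennreal (norm (a x)) \<partial>lborel) = (\<integral>\<^sup>+x. ennreal (norm (indicator (ball c r) x * a x)) \<partial>lborel)"
    by (intro nn_integral_cong_AE eventually_mono[OF supp]) (auto simp: indicator_def)
  also have "\<dots> \<le> ennreal (sqrt (measure lborel (ball c r)) * (1 / sqrt m))"
    by (rule L2_on_set[OF am _ emeasure_lborel_ball_finite _ nn]) (use m in auto)
  also have "sqrt (measure lborel (ball c r)) * (1 / sqrt m) = 1" using m by (simp add: m_def)
  finally have le1: "(\<integral>\<^sup>+x. ennreal (norm (a x)) \<partial>lborel) \<le> ennreal 1" .
  have a: "integrable lborel a"
    using le1 by (intro integrableI_bounded) (auto intro: le_less_trans)
  have "norm1 a \<le> 1"
    by (rule integral_real_bounded[OF _ le1]) simp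
  with that[OF r _ _ supp nn[unfolded m_def] a] alt show thesis by auto
qed

text \<open>
  Scales above the radius: the integrand is bounded by a multiple of \<open>r / s\<^sup>2\<close>, either by cancellation or, if \<open>r = 1\<close>,
  because \<open>exp (- s\<^sup>2 / 2) \<le> 1 / s\<close>.
\<close>

lemma riesz_part_large:
  fixes a :: "real ^ 'n \<Rightarrow> complex"
  assumes r: "0 < r" "r \<le> 1" and alt: "(LINT x|lborel. a x) = 0 \<or> r = 1"
    and supp: "AE x in lborel. x \<notin> ball c r \<longrightarrow> a x = 0" and a: "integrable lborel a"
  shows "norm1 (riesz_part j {r..} a) \<le> gauss_const TYPE('n) * norm1 a"
proof -
  define N where "N = norm1 a"
  have N: "0 \<le> N" by (simp add: N_def)
  note g = gauss_const_ge(3)[where 'n = 'n]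
  have int: "has_bochner_integral lborel (\<lambda>s. indicator {r..} s * (r / s\<^sup>2 * (gauss_const TYPE('n) * N))) (1 * (gauss_const TYPE('n) * N))"
    using has_bochner_integral_mult_left[OF inverse_square_tail[OF r(1)], of "gauss_const TYPE('n) * N"] by (simp only: mult.assoc)
  have "(LINT x|lborel. norm (indicator UNIV x * riesz_part j {r..} a x))
     \<le> (LINT s|lborel. indicator {r..} s * (r / s\<^sup>2 * (gauss_const TYPE('n) * N)))"
  proof (rule norm_riesz_part_le[OF a _ _ r(1)])
    fix s assume "s \<in> {r..}"
    then have s: "r \<le> s" "0 < s" using r by auto
    let ?n = "LINT x|lborel. norm (dconv j s a x)"
    have n0: "0 \<le> ?n" by simp
    from alt have "exp (- s\<^sup>2 / 2) * ?n \<le> r / s\<^sup>2 * (gauss_const TYPE('n) * N)"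
    proof
      assume zero: "(LINT x|lborel. a x) = 0"
      have "exp (- s\<^sup>2 / 2) * ?n \<le> 1 * ?n" using n0 by (intro mult_right_mono) auto
      also have "1 * ?n \<le> gauss_const TYPE('n) * r / s\<^sup>2 * N"
        using convol_dgauss_cancel[OF s(2) r(1) s(1) a supp zero, of j] by (simp add: N_def)
      finally show ?thesis by (simp add: mult_ac)
    next
      assume r1: "r = 1"
      have "s * 1 \<le> s * s" using s r1 by (intro mult_left_mono) auto
      then have "s \<le> 1 + s\<^sup>2 / 2" using zero_le_power2[of "s - 1"] by (simp add: power2_eq_square algebra_simps)
      also have "\<dots> \<le> exp (s\<^sup>2 / 2)" by (rule exp_ge_add_one_self)
      finally have e: "exp (- s\<^sup>2 / 2) \<le> 1 / s" using s by (simp add: exp_minus field_simps)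
      have "exp (- s\<^sup>2 / 2) * ?n \<le> 1 / s * (gauss_const TYPE('n) / s * N)"
        using e n0 s convol_dgauss_norm[OF s(2) a, of j] by (intro mult_mono) (auto simp: N_def)
      then show ?thesis using r1 by (simp add: power2_eq_square mult_ac)
    qed
    then show "exp (- s\<^sup>2 / 2) * (LINT x|lborel. norm (indicator UNIV x * dconv j s a x))
        \<le> r / s\<^sup>2 * (gauss_const TYPE('n) * N)" by simp
  qed (use int in \<open>auto simp: has_bochner_integral_iff\<close>)
  also have "\<dots> = gauss_const TYPE('n) * N" using int by (simp add: has_bochner_integral_iff)
  finally show ?thesis by (simp add: N_def)
qed

lemma rmult_sq_le_1: "(\<xi> $ j * rmult {0..<d} \<xi>)\<^sup>2 \<le> 1"
proof -
  have "{0..<d} \<subseteq> {0..}" by auto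
  from rmult_le_1[OF _ this, of \<xi> j] show ?thesis by (simp add: abs_square_le_1)
qed

text \<open>
  An upper bound, obtained from the symbol, for the square of the \<open>L\<^sup>2\<close> norm of the part of \<open>\<partial>\<^sub>j (I + L)\<^sup>-\<^sup>1\<^sup>/\<^sup>2 a\<close> with
  scales below \<open>d\<close>. It tends to 0 with \<open>d\<close>, by dominated convergence.
\<close>

definition energy :: "'n \<Rightarrow> (real ^ 'n \<Rightarrow> complex) \<Rightarrow> real \<Rightarrow> real" where
  "energy j a d = (LINT \<xi>|lborel. (\<xi> $ j * rmult {0..<d} \<xi>)\<^sup>2 * (norm (fourier a \<xi>))\<^sup>2) / (2 * pi) ^ CARD('n)"

lemma
  fixes a :: "real ^ 'n \<Rightarrow> complex"
  assumes a: "integrable lborel a" and q: "0 \<le> q"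
    and aq: "norm2_sq a \<le> ennreal (q\<^sup>2)"
  shows integrable_fourier_sq_L2: "integrable lborel (\<lambda>\<xi>. (norm (fourier a \<xi>))\<^sup>2)"
    and integral_fourier_sq_L2: "(LINT \<xi>|lborel. (norm (fourier a \<xi>))\<^sup>2) \<le> (2 * pi) ^ CARD('n) * q\<^sup>2"
proof -
  have [measurable]: "fourier a \<in> borel_measurable borel" by (rule fourier_measurable[OF a])
  have "norm2_sq (fourier a)
     \<le> ennreal ((2 * pi) ^ CARD('n)) * norm2_sq a"
    by (rule nn_integral_fourier_sq_le[OF a])
  also have "\<dots> \<le> ennreal ((2 * pi) ^ CARD('n)) * ennreal (q\<^sup>2)"
    using aq by (rule mult_left_mono) simp
  also have "\<dots> = ennreal ((2 * pi) ^ CARD('n) * q\<^sup>2)"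
    by (rule ennreal_mult[symmetric]) auto
  finally have le: "norm2_sq (fourier a) \<le> ennreal ((2 * pi) ^ CARD('n) * q\<^sup>2)" .
  show "integrable lborel (\<lambda>\<xi>. (norm (fourier a \<xi>))\<^sup>2)"
    using le by (intro integrableI_bounded) (auto intro: le_less_trans)
  show "(LINT \<xi>|lborel. (norm (fourier a \<xi>))\<^sup>2) \<le> (2 * pi) ^ CARD('n) * q\<^sup>2"
    by (rule integral_real_bounded[OF _ le]) auto
qed

lemma integrable_energy:
  fixes a :: "real ^ 'n \<Rightarrow> complex"
  assumes a: "integrable lborel a" and i: "integrable lborel (\<lambda>\<xi>. (norm (fourier a \<xi>))\<^sup>2)"
  shows "integrable lborel (\<lambda>\<xi>. (\<xi> $ j * rmult {0..<d} \<xi>)\<^sup>2 * (norm (fourier a \<xi>))\<^sup>2)"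
proof (rule Bochner_Integration.integrable_bound[OF i])
  have [measurable]: "fourier a \<in> borel_measurable borel" by (rule fourier_measurable[OF a])
  show "(\<lambda>\<xi>. (\<xi> $ j * rmult {0..<d} \<xi>)\<^sup>2 * (norm (fourier a \<xi>))\<^sup>2) \<in> borel_measurable lborel"
    by measurable
  have "(\<xi> $ j * rmult {0..<d} \<xi>)\<^sup>2 \<le> 1" for \<xi> :: "real ^ 'n"
    by (rule rmult_sq_le_1)
  then show "AE \<xi> in lborel. norm ((\<xi> $ j * rmult {0..<d} \<xi>)\<^sup>2 * (norm (fourier a \<xi>))\<^sup>2) \<le> norm ((norm (fourier a \<xi>))\<^sup>2)"
    by (intro AE_I2) (simp add: abs_mult mult_left_le_one_le)
qed

lemma energy_nonneg: "0 \<le> energy j a d"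
  unfolding energy_def by (intro divide_nonneg_nonneg Bochner_Integration.integral_nonneg) auto

lemma energy_le:
  fixes a :: "real ^ 'n \<Rightarrow> complex"
  assumes a: "integrable lborel a" and q: "0 \<le> q"
    and aq: "norm2_sq a \<le> ennreal (q\<^sup>2)"
  shows "energy j a d \<le> q\<^sup>2"
proof -
  note i = integrable_fourier_sq_L2[OF a q aq]
  have "(\<xi> $ j * rmult {0..<d} \<xi>)\<^sup>2 \<le> 1" for \<xi> :: "real ^ 'n"
    by (rule rmult_sq_le_1)
  then have "(LINT \<xi>|lborel. (\<xi> $ j * rmult {0..<d} \<xi>)\<^sup>2 * (norm (fourier a \<xi>))\<^sup>2) \<le> (LINT \<xi>|lborel. (norm (fourier a \<xi>))\<^sup>2)"
    by (intro integral_mono integrable_energy[OF a i] i) (simp add: mult_left_le_one_le)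
  also have "\<dots> \<le> (2 * pi) ^ CARD('n) * q\<^sup>2" by (rule integral_fourier_sq_L2[OF a q aq])
  finally show ?thesis by (simp add: energy_def divide_le_eq mult.commute)
qed

lemma energy_tendsto:
  fixes a :: "real ^ 'n \<Rightarrow> complex"
  assumes a: "integrable lborel a" and i: "integrable lborel (\<lambda>\<xi>. (norm (fourier a \<xi>))\<^sup>2)"
    and d: "d \<longlonglongrightarrow> 0" "\<And>k :: nat. 0 < d k"
  shows "(\<lambda>k. energy j a (d k)) \<longlonglongrightarrow> 0"
proof -
  have [measurable]: "fourier a \<in> borel_measurable borel" by (rule fourier_measurable[OF a])
  have "(\<lambda>k. LINT \<xi>|lborel. (\<xi> $ j * rmult {0..<d k} \<xi>)\<^sup>2 * (norm (fourier a \<xi>))\<^sup>2)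
     \<longlonglongrightarrow> (LINT \<xi>|(lborel :: (real ^ 'n) measure). 0)"
  proof (rule integral_dominated_convergence[OF _ _ i])
    show "AE \<xi> in lborel. (\<lambda>k. (\<xi> $ j * rmult {0..<d k} \<xi>)\<^sup>2 * (norm (fourier a \<xi>))\<^sup>2) \<longlonglongrightarrow> 0"
    proof (rule AE_I2)
      fix \<xi> :: "real ^ 'n"
      have "(\<lambda>k. (\<xi> $ j * rmult {0..<d k} \<xi>)\<^sup>2 * (norm (fourier a \<xi>))\<^sup>2) \<longlonglongrightarrow> (\<xi> $ j * 0)\<^sup>2 * (norm (fourier a \<xi>))\<^sup>2"
        by (intro tendsto_intros rmult_shrink d)
      then show "(\<lambda>k. (\<xi> $ j * rmult {0..<d k} \<xi>)\<^sup>2 * (norm (fourier a \<xi>))\<^sup>2) \<longlonglongrightarrow> 0" by simp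
    qed
    fix k
    have "(\<xi> $ j * rmult {0..<d k} \<xi>)\<^sup>2 \<le> 1" for \<xi> :: "real ^ 'n"
      by (rule rmult_sq_le_1)
    then show "AE \<xi> in lborel. norm ((\<xi> $ j * rmult {0..<d k} \<xi>)\<^sup>2 * (norm (fourier a \<xi>))\<^sup>2) \<le> (norm (fourier a \<xi>))\<^sup>2"
      by (intro AE_I2) (simp add: abs_mult mult_left_le_one_le)
  qed measurable
  from tendsto_divide[OF this tendsto_const, of "(2 * pi) ^ CARD('n)"]
  show ?thesis unfolding energy_def[abs_def] by simp
qed

text \<open>
  Scales below the radius: the first term accounts for the complement of the doubled ball, the second one for the doubled ball.
  Both tend to 0 as \<open>d\<close> does, uniformly in \<open>e\<close>.
\<close>

lemma riesz_part_small:
  fixes a :: "real ^ 'n \<Rightarrow> complex"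
  assumes e: "0 < e" "e \<le> d" "d \<le> r"
    and supp: "AE x in lborel. x \<notin> ball c r \<longrightarrow> a x = 0" and a: "integrable lborel a"
    and i: "integrable lborel (\<lambda>\<xi>. (norm (fourier a \<xi>))\<^sup>2)"
  shows "norm1 (riesz_part j {e..<d} a)
    \<le> 6 * gauss_const TYPE('n) * (d / r)\<^sup>2 * norm1 a
      + sqrt (measure lborel (ball c (2 * r))) * sqrt (energy j a d)"
proof -
  define B where "B = ball c (2 * r)"
  have [measurable]: "B \<in> sets borel" by (simp add: B_def)
  have r: "0 < r" "0 < d" using e by auto
  define h where "h = riesz_part j {e..<d} a"
  have h: "integrable lborel h" unfolding h_def by (rule integrable_riesz_part[OF a _ e(1)]) auto
  have [measurable]: "h \<in> borel_measurable borel" using h by simp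
  have [measurable]: "fourier a \<in> borel_measurable borel" by (rule fourier_measurable[OF a])
  define N where "N = norm1 a"
  have N: "0 \<le> N" by (simp add: N_def)
  have g: "0 < gauss_const TYPE('n)" by (rule gauss_const_ge)
  have far: "(LINT x|lborel. norm (indicator (- B) x * h x)) \<le> 6 * gauss_const TYPE('n) * (d / r)\<^sup>2 * N"
  proof -
    define b where "b = 6 * gauss_const TYPE('n) * d / r\<^sup>2 * N"
    have b0: "0 \<le> b" using g r N by (simp add: b_def)
    have "(LINT x|lborel. norm (indicator (- B) x * h x)) \<le> (LINT s|lborel. indicator {e..<d} s * b)"
      unfolding h_def
    proof (rule norm_riesz_part_le[OF a _ _ e(1)])
      fix s assume "s \<in> {e..<d}"
      then have s: "0 < s" "s < d" using e by auto
      let ?n = "LINT x|lborel. norm (indicator (- B) x * dconv j s a x)"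
      have "exp (- s\<^sup>2 / 2) * ?n \<le> 1 * ?n" by (intro mult_right_mono) auto
      also have "1 * ?n \<le> 6 * gauss_const TYPE('n) * s / r\<^sup>2 * N"
        using convol_dgauss_far[OF s(1) r(1) a supp, of j] by (simp add: B_def N_def)
      also have "\<dots> \<le> b"
        unfolding b_def using s g N by (intro mult_right_mono divide_right_mono mult_left_mono) auto
      finally show "exp (- s\<^sup>2 / 2) * ?n \<le> b" .
    next
      show "integrable lborel (\<lambda>s. indicator {e..<d} s * b)"
        using e by (intro integrable_mult_left integrable_real_indicator) auto
    qed auto
    also have "\<dots> = (d - e) * b" using e by simp
    also have "\<dots> \<le> d * b" using e b0 by (intro mult_right_mono) auto
    also have "\<dots> = 6 * gauss_const TYPE('n) * (d / r)\<^sup>2 * N" by (simp add: b_def power2_eq_square)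
    finally show ?thesis .
  qed
  have near: "(LINT x|lborel. norm (indicator B x * h x)) \<le> sqrt (measure lborel B) * sqrt (energy j a d)"
  proof (rule integral_real_bounded)
    define P where "P = (2 * pi) ^ CARD('n)"
    have P: "0 < P" by (simp add: P_def)
    have "(norm (fourier h \<xi>))\<^sup>2 \<le> (\<xi> $ j * rmult {0..<d} \<xi>)\<^sup>2 * (norm (fourier a \<xi>))\<^sup>2" for \<xi>
    proof -
      have "\<bar>\<xi> $ j * rmult {e..<d} \<xi>\<bar> \<le> \<bar>\<xi> $ j * rmult {0..<d} \<xi>\<bar>"
        unfolding abs_mult abs_of_nonneg[OF rmult_nonneg] using e
        by (intro mult_left_mono rmult_mono) auto
      then have "(\<xi> $ j * rmult {e..<d} \<xi>)\<^sup>2 \<le> (\<xi> $ j * rmult {0..<d} \<xi>)\<^sup>2" by (simp only: abs_le_square_iff)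
      moreover have "(norm (fourier h \<xi>))\<^sup>2 = (\<xi> $ j * rmult {e..<d} \<xi>)\<^sup>2 * (norm (fourier a \<xi>))\<^sup>2"
      proof -
        have F: "fourier h \<xi> = \<i> * of_real (\<xi> $ j * rmult {e..<d} \<xi>) * fourier a \<xi>"
          unfolding h_def by (rule fourier_riesz_part[OF a _ e(1)]) auto
        show ?thesis unfolding F norm_mult norm_of_real by (simp add: power_mult_distrib)
      qed
      ultimately show ?thesis by (simp add: mult_right_mono)
    qed
    then have "norm2_sq (fourier h)
       \<le> (\<integral>\<^sup>+\<xi>. ennreal ((\<xi> $ j * rmult {0..<d} \<xi>)\<^sup>2 * (norm (fourier a \<xi>))\<^sup>2) \<partial>lborel)"
      by (intro nn_integral_mono ennreal_leI)
    also have "\<dots> = ennreal (P * energy j a d)"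
      using P by (subst nn_integral_eq_integral[OF integrable_energy[OF a i]]) (auto simp: energy_def P_def)
    finally have "norm2_sq (fourier h) \<le> ennreal (P * energy j a d)" .
    with nn_integral_norm_sq_le_fourier[OF h, folded P_def]
    have "ennreal P * norm2_sq h \<le> ennreal (P * energy j a d)"
      by (rule order_trans)
    then have "norm2_sq h \<le> ennreal (P * energy j a d) / ennreal P"
      by (rule ennreal_le_divideI[OF P])
    also have "\<dots> = ennreal ((sqrt (energy j a d))\<^sup>2)"
      using P energy_nonneg[of j a d] by (subst divide_ennreal) auto
    finally show "(\<integral>\<^sup>+x. ennreal (norm (indicator B x * h x)) \<partial>lborel) \<le> ennreal (sqrt (measure lborel B) * sqrt (energy j a d))"
      using emeasure_lborel_ball_finite[of c "2 * r"] by (intro L2_on_set) (auto simp: B_def energy_nonneg)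
  qed (simp add: energy_nonneg)
  have "norm1 h = (LINT x|lborel. norm (indicator (- B) x * h x) + norm (indicator B x * h x))"
    by (intro Bochner_Integration.integral_cong) (auto simp: indicator_def)
  also have "\<dots> = (LINT x|lborel. norm (indicator (- B) x * h x)) + (LINT x|lborel. norm (indicator B x * h x))"
  proof (rule Bochner_Integration.integral_add)
    show "integrable lborel (\<lambda>x. norm (indicator (- B) x * h x))" "integrable lborel (\<lambda>x. norm (indicator B x * h x))"
      by (rule integrable_norm, rule Bochner_Integration.integrable_bound[OF h], (auto simp: norm_mult indicator_def)[2])+
  qed
  finally show ?thesis using far near unfolding h_def B_def N_def by linarith
qed

text \<open>
  The local Riesz transform of an atom is the \<open>L\<^sup>1\<close> limit of the truncations to the scales \<open>s \<ge> r / (k + 1)\<close>. The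
  first truncation is bounded by \<open>riesz_part_large\<close>, the differences by \<open>riesz_part_small\<close>.
\<close>

lemma riesz_atom:
  fixes a :: "real ^ 'n \<Rightarrow> complex"
  assumes "local_atom a"
  obtains h where "integrable lborel h" "norm1 h \<le> 7 * gauss_const TYPE('n) + sqrt (2 ^ CARD('n))"
    "\<And>\<xi>. fourier h \<xi> = \<i> * of_real (\<xi> $ j / sqrt (1 + (norm \<xi>)\<^sup>2)) * fourier a \<xi>"
proof -
  from assms obtain c r where r: "0 < r" "r \<le> 1" and alt: "(LINT x|lborel. a x) = 0 \<or> r = 1"
    and supp: "AE x in lborel. x \<notin> ball c r \<longrightarrow> a x = 0"
    and a2: "norm2_sq a \<le> ennreal ((1 / sqrt (measure lborel (ball c r)))\<^sup>2)"
    and a: "integrable lborel a" and a1: "norm1 a \<le> 1"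
    by (rule local_atomD)
  define q where "q = 1 / sqrt (measure lborel (ball c r))"
  define mB where "mB = sqrt (measure lborel (ball c (2 * r)))"
  have q: "0 \<le> q" by (simp add: q_def)
  have mBq: "mB * q = sqrt (2 ^ CARD('n))"
    using measure_ball[OF r(1), of c] by (simp add: mB_def q_def real_sqrt_mult)
  note a2 = a2[folded q_def]
  note i = integrable_fourier_sq_L2[OF a q a2]
  have g: "0 < gauss_const TYPE('n)" by (rule gauss_const_ge)
  define ep where "ep k = r / real (Suc k)" for k
  have ep: "0 < ep k" "ep k \<le> r" for k using r by (auto simp: ep_def divide_le_eq mult_le_cancel_left1)
  have ep_anti: "ep l \<le> ep k" if "k \<le> l" for k l
    unfolding ep_def using that r by (intro divide_left_mono) auto
  have ep0: "ep \<longlonglongrightarrow> 0"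
    using tendsto_mult_right_zero[OF LIMSEQ_inverse_real_of_nat, of r]
    by (simp add: ep_def[abs_def] divide_inverse)
  define u where "u k = riesz_part j {ep k..} a" for k
  have u: "integrable lborel (u k)" for k
    unfolding u_def by (rule integrable_riesz_part[OF a _ ep(1)]) auto
  have Fu: "fourier (u k) \<xi> = \<i> * of_real (\<xi> $ j * rmult {ep k..} \<xi>) * fourier a \<xi>" for k \<xi>
    unfolding u_def by (rule fourier_riesz_part[OF a _ ep(1)]) auto
  define \<tau> where "\<tau> k = 6 * gauss_const TYPE('n) * (ep k / r)\<^sup>2 + mB * sqrt (energy j a (ep k))" for k
  have \<tau>0: "0 \<le> \<tau> k" for k using g by (simp add: \<tau>_def mB_def energy_nonneg)
  have "\<tau> \<longlonglongrightarrow> 6 * gauss_const TYPE('n) * (0 / r)\<^sup>2 + mB * sqrt 0"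
    unfolding \<tau>_def[abs_def]
    by (intro tendsto_intros ep0 energy_tendsto[OF a i ep0 ep(1)]) (use r in simp)
  then have \<tau>: "\<tau> \<longlonglongrightarrow> 0" by simp
  have diff: "dist1 (u l) (u k) \<le> \<tau> k" if kl: "k \<le> l" for k l
  proof -
    define h where "h = riesz_part j {ep l..<ep k} a"
    have h: "integrable lborel h"
      unfolding h_def by (rule integrable_riesz_part[OF a _ ep(1)]) auto
    have Fh: "fourier h \<xi> = \<i> * of_real (\<xi> $ j * rmult {ep l..<ep k} \<xi>) * fourier a \<xi>" for \<xi>
      unfolding h_def by (rule fourier_riesz_part[OF a _ ep(1)]) auto
    have un: "{ep l..<ep k} \<union> {ep k..} = {ep l..}" using ep_anti[OF kl] by auto
    have add: "rmult {ep l..} \<xi> = rmult {ep l..<ep k} \<xi> + rmult {ep k..} \<xi>" for \<xi> :: "real ^ 'n"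
      unfolding un[symmetric] using ep(1)[of l] ep(1)[of k] by (intro rmult_add) auto
    \<comment> \<open>The two functions have the same Fourier transform, as the symbols add up.\<close>
    have "AE x in lborel. u l x - u k x = h x"
    proof (rule fourier_eq_imp_AE_eq[OF Bochner_Integration.integrable_diff[OF u u] h], rule AE_I2)
      show "fourier (\<lambda>x. u l x - u k x) \<xi> = fourier h \<xi>" for \<xi>
        unfolding fourier_diff[OF u u] Fu Fh add[of \<xi>] by (simp add: algebra_simps)
    qed
    then have "dist1 (u l) (u k) = norm1 h"
      using u h by (intro integral_cong_AE) (auto simp: borel_measurable_integrable elim: eventually_mono)
    also have "\<dots> \<le> 6 * gauss_const TYPE('n) * (ep k / r)\<^sup>2 * norm1 a + mB * sqrt (energy j a (ep k))"
      unfolding h_def mB_def by (rule riesz_part_small[OF ep(1) ep_anti[OF kl] ep(2) supp a i])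
    also have "\<dots> \<le> \<tau> k"
      unfolding \<tau>_def using a1 g by (intro add_right_mono mult_left_le) auto
    finally show ?thesis .
  qed
  \<comment> \<open>The bound \<open>\<tau> k\<close> does not depend on the larger index \<open>l\<close>.\<close>
  have "\<exists>N. \<forall>k\<ge>N. \<forall>l\<ge>N. (LINT x|lborel. norm (u k x - u l x)) < e" if e: "0 < e" for e
  proof -
    from LIMSEQ_D[OF \<tau> e] obtain N where N: "\<And>k. k \<ge> N \<Longrightarrow> \<tau> k < e" using \<tau>0 by auto
    have "dist1 (u k) (u l) < e" if "k \<ge> N" "l \<ge> N" for k l
    proof (cases "k \<le> l")
      case True
      then show ?thesis using diff[OF True] N[OF that(1)] by (simp add: norm_minus_commute)
    next
      case False
      then show ?thesis using diff[of l k] N[OF that(2)] by simp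
    qed
    then show ?thesis by blast
  qed
  from L1_complete[OF u this] obtain h where h: "integrable lborel h"
    and lim: "(\<lambda>k. LINT x|lborel. norm (h x - u k x)) \<longlonglongrightarrow> 0" by blast
  have "norm1 (u k) \<le> 7 * gauss_const TYPE('n) + sqrt (2 ^ CARD('n))" for k
  proof -
    have "norm1 (u k) \<le> dist1 (u k) (u 0) + (LINT x|lborel. norm (u 0 x))"
      using L1_norm_triangle[OF u u, of "\<lambda>x. 0" k 0] by simp
    also have "(LINT x|lborel. norm (u 0 x)) \<le> gauss_const TYPE('n) * norm1 a"
      using riesz_part_large[OF r alt supp a, of j] by (simp add: u_def ep_def)
    also have "\<dots> \<le> gauss_const TYPE('n)" using a1 g by (intro mult_left_le) auto
    also have "dist1 (u k) (u 0) \<le> 6 * gauss_const TYPE('n) + sqrt (2 ^ CARD('n))"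
    proof -
      have "sqrt (energy j a (ep 0)) \<le> sqrt (q\<^sup>2)"
        unfolding real_sqrt_le_iff by (rule energy_le[OF a q a2])
      then have "mB * sqrt (energy j a (ep 0)) \<le> mB * q"
        using q by (intro mult_left_mono) (auto simp: mB_def)
      then have "\<tau> 0 \<le> 6 * gauss_const TYPE('n) + sqrt (2 ^ CARD('n))"
        using r by (simp add: \<tau>_def mBq ep_def)
      with diff[of 0 k] show ?thesis by simp
    qed
    finally show ?thesis by simp
  qed
  then have n: "norm1 h \<le> 7 * gauss_const TYPE('n) + sqrt (2 ^ CARD('n))"
    by (intro LIMSEQ_le_const2[OF L1_norm_tendsto[OF u h lim]]) auto
  have "fourier h \<xi> = \<i> * of_real (\<xi> $ j / sqrt (1 + (norm \<xi>)\<^sup>2)) * fourier a \<xi>" for \<xi>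
  proof -
    have "rmult {ep k..} \<xi> = rmult {0..} \<xi> - rmult {0..<ep k} \<xi>" for k
    proof -
      have un: "{0..<ep k} \<union> {ep k..} = {0..}" using ep(1)[of k] by auto
      show ?thesis
        unfolding un[symmetric] using ep(1)[of k] by (subst rmult_add) auto
    qed
    moreover have "(\<lambda>k. rmult {0..} \<xi> - rmult {0..<ep k} \<xi>) \<longlonglongrightarrow> rmult {0..} \<xi> - 0"
      by (intro tendsto_intros rmult_shrink ep0 ep)
    ultimately have "(\<lambda>k. rmult {ep k..} \<xi>) \<longlonglongrightarrow> 1 / sqrt (1 + (norm \<xi>)\<^sup>2)"
      by (simp add: rmult_total)
    then have "(\<lambda>k. fourier (u k) \<xi>) \<longlonglongrightarrow> \<i> * of_real (\<xi> $ j * (1 / sqrt (1 + (norm \<xi>)\<^sup>2))) * fourier a \<xi>"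
      unfolding Fu by (intro tendsto_intros)
    with fourier_tendsto[OF u h lim, of \<xi>] show ?thesis
      using LIMSEQ_unique by fastforce
  qed
  with h n that show thesis by blast
qed

lemma riesz_atomic:
  fixes f :: "real ^ 'n \<Rightarrow> complex"
  assumes f: "integrable lborel f" and d: "atomic_decomposition f l a"
  obtains h where "integrable lborel h"
    "norm1 h \<le> (7 * gauss_const TYPE('n) + sqrt (2 ^ CARD('n))) * (\<Sum>k. norm (l k))"
    "\<And>\<xi>. fourier h \<xi> = \<i> * of_real (\<xi> $ j / sqrt (1 + (norm \<xi>)\<^sup>2)) * fourier f \<xi>"
proof -
  define C where "C = 7 * gauss_const TYPE('n) + sqrt (2 ^ CARD('n))"
  from d have at: "\<And>k. local_atom (a k)" and sl: "summable (\<lambda>k. norm (l k))"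
    and lim: "(\<lambda>N. LINT x|lborel. norm (f x - (\<Sum>k<N. l k * a k x))) \<longlonglongrightarrow> 0"
    by (auto simp: atomic_decomposition_def)
  have ai: "integrable lborel (a k)" for k using at[of k] by (rule local_atomD)
  have "\<exists>h. integrable lborel h \<and> (LINT x|lborel. norm (h x)) \<le> C
      \<and> (\<forall>\<xi>. fourier h \<xi> = \<i> * of_real (\<xi> $ j / sqrt (1 + (norm \<xi>)\<^sup>2)) * fourier (a k) \<xi>)" for k
    using riesz_atom[OF at[of k], of j] unfolding C_def by metis
  then obtain h where h: "\<And>k. integrable lborel (h k)" "\<And>k. (LINT x|lborel. norm (h k x)) \<le> C"
    "\<And>k \<xi>. fourier (h k) \<xi> = \<i> * of_real (\<xi> $ j / sqrt (1 + (norm \<xi>)\<^sup>2)) * fourier (a k) \<xi>"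
    by metis
  define v where "v k x = l k * h k x" for k x
  have v: "integrable lborel (v k)" for k using h(1) by (simp add: v_def[abs_def])
  have vn: "norm1 (v k) \<le> C * norm (l k)" for k
    using mult_left_mono[OF h(2)[of k], of "norm (l k)"] by (simp add: v_def norm_mult mult.commute)
  have vs: "summable (\<lambda>k. LINT x|lborel. norm (v k x))"
    by (rule summable_comparison_test'[OF summable_mult[OF sl, of C], of 0]) (use vn in auto)
  from L1_series[OF v vs] obtain H where H: "integrable lborel H"
    and limH: "(\<lambda>N. LINT x|lborel. norm (H x - (\<Sum>k<N. v k x))) \<longlonglongrightarrow> 0"
    and Hn: "norm1 H \<le> (\<Sum>k. LINT x|lborel. norm (v k x))" by blast
  have "(\<Sum>k. LINT x|lborel. norm (v k x)) \<le> C * (\<Sum>k. norm (l k))"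
    unfolding suminf_mult[OF sl, symmetric] by (rule suminf_le[OF vn vs summable_mult[OF sl]])
  with Hn have n: "norm1 H \<le> C * (\<Sum>k. norm (l k))" by linarith
  have "fourier H \<xi> = \<i> * of_real (\<xi> $ j / sqrt (1 + (norm \<xi>)\<^sup>2)) * fourier f \<xi>" for \<xi>
  proof -
    let ?m = "\<i> * of_real (\<xi> $ j / sqrt (1 + (norm \<xi>)\<^sup>2)) :: complex"
    have 1: "(\<lambda>N. fourier (\<lambda>x. \<Sum>k<N. v k x) \<xi>) \<longlonglongrightarrow> fourier H \<xi>"
      by (rule fourier_tendsto[OF _ H limH]) (use v in auto)
    have 2: "(\<lambda>N. fourier (\<lambda>x. \<Sum>k<N. l k * a k x) \<xi>) \<longlonglongrightarrow> fourier f \<xi>"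
      by (rule fourier_tendsto[OF _ f lim]) (use ai in auto)
    have "fourier (\<lambda>x. \<Sum>k<N. v k x) \<xi> = ?m * fourier (\<lambda>x. \<Sum>k<N. l k * a k x) \<xi>" for N
      using ai v by (simp add: fourier_sum v_def[abs_def] fourier_cmult h(3) sum_distrib_left mult.left_commute)
    with tendsto_mult_left[OF 2, of ?m] have "(\<lambda>N. fourier (\<lambda>x. \<Sum>k<N. v k x) \<xi>) \<longlonglongrightarrow> ?m * fourier f \<xi>" by simp
    from LIMSEQ_unique[OF 1 this] show ?thesis .
  qed
  with H n that show thesis unfolding C_def by blast
qed

lemma atomic_norm:
  fixes f :: "real ^ 'n \<Rightarrow> complex"
  assumes f: "integrable lborel f" and d: "atomic_decomposition f l a"
  shows "norm1 f \<le> (\<Sum>k. norm (l k))"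
proof -
  from d have at: "\<And>k. local_atom (a k)" and sl: "summable (\<lambda>k. norm (l k))"
    and lim: "(\<lambda>N. LINT x|lborel. norm (f x - (\<Sum>k<N. l k * a k x))) \<longlonglongrightarrow> 0"
    by (auto simp: atomic_decomposition_def)
  have ai: "integrable lborel (a k)" for k using at[of k] by (rule local_atomD)
  have an: "norm1 (a k) \<le> 1" for k using at[of k] by (rule local_atomD)
  have "(LINT x|lborel. norm (\<Sum>k<N. l k * a k x)) \<le> (\<Sum>k. norm (l k))" for N
  proof -
    have "(LINT x|lborel. norm (\<Sum>k<N. l k * a k x)) \<le> (LINT x|lborel. (\<Sum>k<N. norm (l k * a k x)))"
      using ai by (intro integral_mono norm_sum) auto
    also have "\<dots> = (\<Sum>k<N. norm (l k) * norm1 (a k))"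
      using ai by (subst Bochner_Integration.integral_sum) (auto simp: norm_mult)
    also have "\<dots> \<le> (\<Sum>k<N. norm (l k))" using an by (intro sum_mono mult_left_le) auto
    also have "\<dots> \<le> (\<Sum>k. norm (l k))" by (rule sum_le_suminf[OF sl]) auto
    finally show ?thesis .
  qed
  then show ?thesis
    by (intro LIMSEQ_le_const2[OF L1_norm_tendsto[OF _ f lim]]) (use ai in auto)
qed

section \<open>A function of \<open>H\<^sup>1\<close> outside the range\<close>

text \<open>
  The Riesz transforms of \<open>\<partial>\<^sub>i gauss 1\<close>: as \<open>1 / \<bar>\<xi>\<bar> = sqrt (2 / \<pi>) \<integral> exp (- s\<^sup>2 \<bar>\<xi>\<bar>\<^sup>2 / 2) ds\<close>, they are superpositions of
  \<open>\<partial>\<^sub>j \<partial>\<^sub>i gauss (sqrt (1 + s\<^sup>2))\<close>. This second derivative is split as \<open>\<partial>\<^sub>j gauss \<sigma> * \<partial>\<^sub>i gauss \<sigma>\<close> with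
  \<open>2 \<sigma>\<^sup>2 = 1 + s\<^sup>2\<close>, so its \<open>L\<^sup>1\<close> norm is of order \<open>1 / (1 + s\<^sup>2)\<close>, which is integrable.
\<close>

lemma riesz_dgauss:
  fixes j i :: "'n :: finite"
  obtains G :: "real ^ 'n \<Rightarrow> complex" where
    "fourier_multiplier (\<lambda>\<xi>. \<i> * complex_of_real (\<xi> $ j / norm \<xi>)) (\<lambda>x. of_real (dgauss i 1 x)) G"
proof -
  let ?c = "gauss_const TYPE('n)"
  define \<sigma> where "\<sigma> s = sqrt ((1 + s\<^sup>2) / 2)" for s :: real
  have \<sigma>: "0 < \<sigma> s" "(\<sigma> s)\<^sup>2 = (1 + s\<^sup>2) / 2" for s by (auto simp: \<sigma>_def add_pos_nonneg)
  have [measurable]: "\<sigma> \<in> borel_measurable borel" unfolding \<sigma>_def by measurable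
  define w where "w s = sqrt (2 / pi) * indicator {0..} s" for s :: real
  have [measurable]: "w \<in> borel_measurable borel" unfolding w_def by measurable
  have w0: "0 \<le> w s" for s by (simp add: w_def)
  let ?D = "\<lambda>m s x. of_real (dgauss m (\<sigma> s) x) :: complex"
  define k where "k s x = of_real (w s) * convol (?D j s) (?D i s) x" for s and x :: "real ^ 'n"
  have D: "integrable lborel (?D m s :: real ^ 'n \<Rightarrow> complex)" for m s
    by (rule integrable_dgauss_complex[OF \<sigma>(1)])
  have ki: "integrable lborel (k s)" for s
    unfolding k_def[abs_def] by (intro integrable_mult_right integrable_convol D)
  \<comment> \<open>Both factors contribute \<open>gauss_const / \<sigma> s\<close>.\<close>
  define B where "B s = w s * (2 * ?c\<^sup>2 * (1 / (1 + s\<^sup>2)))" for s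
  have kn: "(LINT x|lborel. norm (k s x)) \<le> B s" for s
  proof -
    have "(LINT x|lborel. norm (convol (?D j s) (?D i s) x)) \<le> ?c / \<sigma> s * (?c / \<sigma> s)"
      using \<sigma>(1)[of s] gauss_const_ge(3)[where 'n = 'n]
      by (intro order_trans[OF norm_convol[OF D D]] mult_mono norm_dgauss_L1[OF \<sigma>(1)]) auto
    also have "?c / \<sigma> s * (?c / \<sigma> s) = ?c\<^sup>2 / (\<sigma> s)\<^sup>2"
      by (simp add: power2_eq_square)
    also have "\<dots> = 2 * ?c\<^sup>2 * (1 / (1 + s\<^sup>2))"
      unfolding \<sigma>(2) by simp
    finally have le: "(LINT x|lborel. norm (convol (?D j s) (?D i s) x)) \<le> 2 * ?c\<^sup>2 * (1 / (1 + s\<^sup>2))" .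
    have "(LINT x|lborel. norm (k s x)) = w s * (LINT x|lborel. norm (convol (?D j s) (?D i s) x))"
      using w0[of s] by (simp add: k_def norm_mult)
    also have "\<dots> \<le> B s"
      unfolding B_def by (rule mult_left_mono[OF le w0])
    finally show ?thesis .
  qed
  have "(\<integral>\<^sup>+s. ennreal (1 / (1 + s\<^sup>2)) * indicator {0..} s \<partial>lborel) = ennreal (pi / 2 - arctan 0)"
  proof (rule nn_integral_FTC_atLeast)
    show "(arctan has_real_derivative 1 / (1 + s\<^sup>2)) (at s)" for s
      by (auto intro!: derivative_eq_intros simp: inverse_eq_divide)
  qed (auto intro: tendsto_arctan_at_top simp: add_nonneg_nonneg)
  also have "(\<integral>\<^sup>+s. ennreal (1 / (1 + s\<^sup>2)) * indicator {0..} s \<partial>lborel)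
      = (\<integral>\<^sup>+s. ennreal (norm (indicator {0..} s * (1 / (1 + s\<^sup>2)) :: real)) \<partial>(lborel :: real measure))"
    by (intro nn_integral_cong) (auto simp: indicator_def)
  finally have fin: "integrable lborel (\<lambda>s :: real. indicator {0..} s * (1 / (1 + s\<^sup>2)))"
    by (intro integrableI_bounded) auto
  have B: "integrable lborel B"
    using integrable_mult_right[OF fin, of "sqrt (2 / pi) * (2 * ?c\<^sup>2)"]
    unfolding B_def[abs_def] w_def by (simp add: mult_ac)
  have km: "(\<lambda>(s, x). k s x) \<in> borel_measurable (lborel \<Otimes>\<^sub>M lborel)"
    unfolding k_def convol_def by measurable
  have K: "integrable (lborel \<Otimes>\<^sub>M lborel) (\<lambda>(s, x). k s x)"
    by (rule integrable_pairI[OF sigma_finite_lborel sigma_finite_lborel km ki kn B])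
  define G where "G x = (LINT s|lborel. k s x)" for x
  have G: "integrable lborel G"
    unfolding G_def[abs_def] by (rule superposition_integrable[OF sigma_finite_lborel K])
  have "fourier G \<xi> = \<i> * of_real (\<xi> $ j / norm \<xi>) * fourier (\<lambda>x. of_real (dgauss i 1 x)) \<xi>" if \<xi>: "\<xi> \<noteq> 0" for \<xi>
  proof -
    define \<rho> where "\<rho> = (norm \<xi>)\<^sup>2"
    have \<rho>: "0 < \<rho>" using \<xi> by (simp add: \<rho>_def)
    define z :: complex where "z = \<i> * of_real (\<xi> $ j) * (\<i> * of_real (\<xi> $ i) * of_real (exp (- \<rho> / 2)))"
    have "fourier (k s) \<xi> = z * of_real (w s * exp (- \<rho> * s\<^sup>2 / 2))" for s
    proof -
      have "exp (- (\<sigma> s)\<^sup>2 * \<rho> / 2) * exp (- (\<sigma> s)\<^sup>2 * \<rho> / 2) = exp (- \<rho> / 2) * exp (- \<rho> * s\<^sup>2 / 2)"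
        unfolding exp_add[symmetric] \<sigma>(2) by (simp add: field_simps)
      then have e: "of_real (exp (- (\<sigma> s)\<^sup>2 * \<rho> / 2)) * of_real (exp (- (\<sigma> s)\<^sup>2 * \<rho> / 2))
          = (of_real (exp (- \<rho> / 2)) * of_real (exp (- \<rho> * s\<^sup>2 / 2)) :: complex)"
        by (simp only: of_real_mult[symmetric])
      have "fourier (k s) \<xi> = of_real (w s) * (\<i> * of_real (\<xi> $ j) * (\<i> * of_real (\<xi> $ i))
         * (of_real (exp (- (\<sigma> s)\<^sup>2 * \<rho> / 2)) * of_real (exp (- (\<sigma> s)\<^sup>2 * \<rho> / 2))))"
        unfolding k_def[abs_def] fourier_cmult fourier_convol[OF D D] fourier_dgauss[OF \<sigma>(1)] \<rho>_def[symmetric]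
        by (simp only: mult_ac)
      also have "\<dots> = z * of_real (w s * exp (- \<rho> * s\<^sup>2 / 2))"
        unfolding e z_def of_real_mult by (simp only: mult_ac)
      finally show ?thesis .
    qed
    then have "fourier G \<xi> = z * of_real (LINT s|lborel. w s * exp (- \<rho> * s\<^sup>2 / 2))"
      unfolding G_def[abs_def] superposition_fourier[OF sigma_finite_lborel K]
      by (simp only: integral_mult_right_zero integral_complex_of_real)
    also have "(LINT s|lborel. w s * exp (- \<rho> * s\<^sup>2 / 2)) = 1 / norm \<xi>"
    proof -
      have "(LINT s|lborel. w s * exp (- \<rho> * s\<^sup>2 / 2)) = sqrt (2 / pi) * sqrt (pi / (2 * \<rho>))"
        using half_gaussian[OF \<rho>] by (simp add: w_def mult.assoc has_bochner_integral_iff)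
      also have "\<dots> = sqrt (1 / \<rho>)"
        by (simp add: real_sqrt_mult[symmetric])
      finally show ?thesis by (simp add: \<rho>_def real_sqrt_divide)
    qed
    also have "z * of_real (1 / norm \<xi>) = \<i> * of_real (\<xi> $ j / norm \<xi>) * fourier (\<lambda>x. of_real (dgauss i 1 x)) \<xi>"
      by (simp add: fourier_dgauss z_def \<rho>_def mult_ac)
    finally show ?thesis .
  qed
  moreover have "AE \<xi> in lborel. (\<xi> :: real ^ 'n) \<noteq> 0" by (rule AE_lborel_singleton)
  ultimately have "fourier_multiplier (\<lambda>\<xi>. \<i> * complex_of_real (\<xi> $ j / norm \<xi>)) (\<lambda>x. of_real (dgauss i 1 x)) G"
    unfolding fourier_multiplier_def using G integrable_dgauss_complex[of 1 i] by auto
  then show thesis by (rule that)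
qed

lemma dgauss_in_hardy: "(\<lambda>x :: real ^ 'n. complex_of_real (dgauss i 1 x)) \<in> hardy_H1"
proof -
  let ?g = "\<lambda>x :: real ^ 'n. complex_of_real (dgauss i 1 x)"
  have "\<exists>G. fourier_multiplier (\<lambda>\<xi>. \<i> * complex_of_real (\<xi> $ j / norm \<xi>)) ?g G" for j
    using riesz_dgauss[of j i] by blast
  then obtain G where "\<And>j. fourier_multiplier (\<lambda>\<xi>. \<i> * complex_of_real (\<xi> $ j / norm \<xi>)) ?g (G j)"
    by metis
  then have "riesz_gradient ?g (\<lambda>x. \<chi> j. G j x)"
    by (simp add: riesz_gradient_def)
  then show ?thesis
    using integrable_dgauss_complex[of 1 i] by (auto simp: hardy_H1_def)
qed

lemma continuous_AE_zero:
  fixes F :: "'a :: euclidean_space \<Rightarrow> complex"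
  assumes F: "continuous_on UNIV F" and ae: "AE x in lborel. F x = 0"
  shows "F x = 0"
proof (rule ccontr)
  assume "F x \<noteq> 0"
  have op: "open (F -` (- {0}))"
    using F by (intro open_vimage) (auto simp: open_Compl)
  moreover have "x \<in> F -` (- {0})" using \<open>F x \<noteq> 0\<close> by simp
  ultimately obtain e where e: "0 < e" "ball x e \<subseteq> F -` (- {0})"
    by (meson open_contains_ball)
  have "AE y in lborel. y \<notin> ball x e"
    using ae by eventually_elim (use e in auto)
  then have "emeasure lborel (ball x e) = 0"
    by (subst (asm) AE_iff_measurable[OF _ refl]) (auto simp: mem_ball[symmetric] simp del: mem_ball)
  then have "measure lborel (ball x e) = 0" by (simp add: measure_def)
  then show False using e by simp
qed

lemma norm_axis_real: "norm (axis i (t :: real) :: real ^ 'n) = \<bar>t\<bar>"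
  by (simp add: norm_eq_sqrt_inner inner_axis_axis flip: power2_eq_square)

text \<open>
  The identity that defines a preimage holds everywhere by continuity. Along the \<open>i\<close>-th axis, the Fourier transform of the
  preimage tends to \<open>\<i>\<close> and \<open>- \<i>\<close> from the two sides of the origin.
\<close>

lemma no_preimage_dgauss:
  fixes f :: "real ^ 'n \<Rightarrow> complex"
  shows "\<not> U_half f (\<lambda>x. complex_of_real (dgauss i 1 x))"
proof
  assume U: "U_half f (\<lambda>x. complex_of_real (dgauss i 1 x))"
  then have f: "integrable lborel f"
    and ae: "AE \<xi> in lborel. fourier (\<lambda>x. complex_of_real (dgauss i 1 x)) \<xi>
      = of_real (norm \<xi> / sqrt (1 + (norm \<xi>)\<^sup>2)) * fourier f \<xi>"
    by (auto simp: U_half_def fourier_multiplier_def)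
  define F where "F \<xi> = \<i> * of_real (\<xi> $ i) * of_real (exp (- (norm \<xi>)\<^sup>2 / 2))
      - of_real (norm \<xi> / sqrt (1 + (norm \<xi>)\<^sup>2)) * fourier f \<xi>" for \<xi>
  have nz: "1 + (norm \<xi>)\<^sup>2 \<noteq> 0" for \<xi> :: "real ^ 'n"
    using add_pos_nonneg[OF zero_less_one zero_le_power2[of "norm \<xi>"]] by simp
  have cf: "continuous_on UNIV (fourier f)"
    by (intro continuous_at_imp_continuous_on ballI isCont_fourier f)
  have "continuous_on UNIV F"
    unfolding F_def using nz by (intro continuous_intros cf) auto
  moreover have "AE \<xi> in lborel. F \<xi> = 0"
    using ae by eventually_elim (simp add: F_def fourier_dgauss)
  ultimately have F: "F \<xi> = 0" for \<xi> by (rule continuous_AE_zero)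
  define t where "t k = inverse (real (Suc k))" for k
  have t: "0 < t k" for k by (simp add: t_def)
  have t0: "t \<longlonglongrightarrow> 0" unfolding t_def by (rule LIMSEQ_inverse_real_of_nat)
  have val: "fourier f (axis i (c * t k)) = \<i> * of_real (c * (sqrt (1 + (t k)\<^sup>2) * exp (- (t k)\<^sup>2 / 2)))"
    if "c = 1 \<or> c = -1" for c k
  proof -
    have n: "norm (axis i (c * t k) :: real ^ 'n) = t k" using that t[of k] by (auto simp: norm_axis_real)
    have "1 + (t k)\<^sup>2 > 0" by (simp add: add_pos_nonneg)
    then have "complex_of_real (sqrt (1 + (t k)\<^sup>2)) \<noteq> 0" by simp
    with F[of "axis i (c * t k)"] t[of k] show ?thesis
      unfolding F_def n by (simp add: field_simps)
  qed
  have lim: "fourier f 0 = \<i> * of_real (c * (sqrt (1 + 0\<^sup>2) * exp (- 0\<^sup>2 / 2)))" if c: "c = 1 \<or> c = -1" for c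
  proof -
    have "(\<lambda>k. axis i (c * t k) :: real ^ 'n) \<longlonglongrightarrow> 0"
    proof (rule tendsto_norm_zero_cancel)
      have "norm (axis i (c * t k) :: real ^ 'n) = t k" for k using c t[of k] by (auto simp: norm_axis_real)
      then show "(\<lambda>k. norm (axis i (c * t k) :: real ^ 'n)) \<longlonglongrightarrow> 0" using t0 by simp
    qed
    then have 1: "(\<lambda>k. fourier f (axis i (c * t k))) \<longlonglongrightarrow> fourier f 0"
      using isCont_tendsto_compose[OF isCont_fourier[OF f]] by blast
    have 2: "(\<lambda>k. fourier f (axis i (c * t k))) \<longlonglongrightarrow> \<i> * of_real (c * (sqrt (1 + 0\<^sup>2) * exp (- 0\<^sup>2 / 2)))"
      unfolding val[OF c] by (intro tendsto_intros t0) auto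
    from LIMSEQ_unique[OF 1 2] show ?thesis .
  qed
  from lim[of 1] lim[of "-1"] show False by simp
qed

section \<open>The range of \<open>U\<^sup>1\<^sup>/\<^sup>2\<close> on the local Hardy space\<close>

lemma fourier_multiplier_unique:
  assumes "fourier_multiplier m f g" "fourier_multiplier m f g'"
  shows "AE x in lborel. g x = g' x"
proof (rule fourier_eq_imp_AE_eq)
  have "AE \<xi> in lborel. fourier g \<xi> = m \<xi> * fourier f \<xi>" "AE \<xi> in lborel. fourier g' \<xi> = m \<xi> * fourier f \<xi>"
    using assms unfolding fourier_multiplier_def by blast+
  then show "AE \<xi> in lborel. fourier g \<xi> = fourier g' \<xi>" by eventually_elim simp
qed (use assms in \<open>simp_all add: fourier_multiplier_def\<close>)

lemma U_half_inj:
  fixes f1 f2 :: "real ^ 'n \<Rightarrow> complex"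
  assumes "U_half f1 g" "U_half f2 g"
  shows "AE x in lborel. f1 x = f2 x"
proof (rule fourier_eq_imp_AE_eq)
  have nz: "sqrt (1 + (norm \<xi>)\<^sup>2) \<noteq> 0" for \<xi> :: "real ^ 'n"
    using add_pos_nonneg[OF zero_less_one zero_le_power2[of "norm \<xi>"]] by simp
  have "AE \<xi> in lborel. fourier g \<xi> = of_real (norm \<xi> / sqrt (1 + (norm \<xi>)\<^sup>2)) * fourier f1 \<xi>"
    "AE \<xi> in lborel. fourier g \<xi> = of_real (norm \<xi> / sqrt (1 + (norm \<xi>)\<^sup>2)) * fourier f2 \<xi>"
    using assms by (auto simp: U_half_def fourier_multiplier_def)
  moreover have "AE \<xi> in lborel. (\<xi> :: real ^ 'n) \<noteq> 0" by (rule AE_lborel_singleton)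
  ultimately show "AE \<xi> in lborel. fourier f1 \<xi> = fourier f2 \<xi>"
  proof eventually_elim
    case (elim \<xi>)
    then have "complex_of_real (norm \<xi> / sqrt (1 + (norm \<xi>)\<^sup>2)) \<noteq> 0" using nz[of \<xi>] by simp
    with elim show ?case by (metis mult_cancel_left)
  qed
qed (use assms in \<open>auto simp: U_half_def fourier_multiplier_def\<close>)

text \<open>
  The Riesz transforms of \<open>U\<^sup>1\<^sup>/\<^sup>2 f\<close> are the local Riesz transforms of \<open>f\<close>, since
  \<open>\<xi>\<^sub>j / \<bar>\<xi>\<bar> * \<bar>\<xi>\<bar> / sqrt (1 + \<bar>\<xi>\<bar>\<^sup>2) = \<xi>\<^sub>j / sqrt (1 + \<bar>\<xi>\<bar>\<^sup>2)\<close> for \<open>\<xi> \<noteq> 0\<close>.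
\<close>

lemma U_half_gradient:
  fixes f :: "real ^ 'n \<Rightarrow> complex"
  assumes U: "U_half f g" and d: "atomic_decomposition f l a"
  obtains H where "\<And>j. fourier_multiplier (\<lambda>\<xi>. \<i> * complex_of_real (\<xi> $ j / norm \<xi>)) g (H j)"
    "\<And>j. (LINT x|lborel. norm (H j x)) \<le> (7 * gauss_const TYPE('n) + sqrt (2 ^ CARD('n))) * (\<Sum>k. norm (l k))"
proof -
  from U have f: "integrable lborel f" and g: "integrable lborel g"
    and ae: "AE \<xi> in lborel. fourier g \<xi> = of_real (norm \<xi> / sqrt (1 + (norm \<xi>)\<^sup>2)) * fourier f \<xi>"
    by (auto simp: U_half_def fourier_multiplier_def)
  have "\<exists>h. integrable lborel h \<and> (LINT x|lborel. norm (h x)) \<le> (7 * gauss_const TYPE('n) + sqrt (2 ^ CARD('n))) * (\<Sum>k. norm (l k))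
      \<and> (\<forall>\<xi>. fourier h \<xi> = \<i> * of_real (\<xi> $ j / sqrt (1 + (norm \<xi>)\<^sup>2)) * fourier f \<xi>)" for j
    using riesz_atomic[OF f d, of j] by metis
  then obtain H where H: "\<And>j. integrable lborel (H j)"
    "\<And>j. (LINT x|lborel. norm (H j x)) \<le> (7 * gauss_const TYPE('n) + sqrt (2 ^ CARD('n))) * (\<Sum>k. norm (l k))"
    "\<And>j \<xi>. fourier (H j) \<xi> = \<i> * of_real (\<xi> $ j / sqrt (1 + (norm \<xi>)\<^sup>2)) * fourier f \<xi>"
    by metis
  have "fourier_multiplier (\<lambda>\<xi>. \<i> * complex_of_real (\<xi> $ j / norm \<xi>)) g (H j)" for j
    unfolding fourier_multiplier_def
  proof (intro conjI g H)
    have "AE \<xi> in lborel. (\<xi> :: real ^ 'n) \<noteq> 0" by (rule AE_lborel_singleton)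
    with ae show "AE \<xi> in lborel. fourier (H j) \<xi> = \<i> * complex_of_real (\<xi> $ j / norm \<xi>) * fourier g \<xi>"
      by eventually_elim (simp add: H(3))
  qed
  with H(2) that show thesis by blast
qed

lemma U_half_in_hardy:
  fixes f :: "real ^ 'n \<Rightarrow> complex"
  assumes f: "f \<in> local_hardy_h1" and U: "U_half f g"
  shows "g \<in> hardy_H1"
proof -
  from f obtain l a where d: "atomic_decomposition f l a" by (auto simp: local_hardy_h1_def)
  obtain H where "\<And>j. fourier_multiplier (\<lambda>\<xi>. \<i> * complex_of_real (\<xi> $ j / norm \<xi>)) g (H j)"
    by (rule U_half_gradient[OF U d]) blast
  then have "riesz_gradient g (\<lambda>x. \<chi> j. H j x)" by (simp add: riesz_gradient_def)
  then show ?thesis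
    using U by (auto simp: hardy_H1_def U_half_def fourier_multiplier_def)
qed

lemma norm_vec_le_sum:
  fixes z :: "complex ^ 'n"
  shows "norm z \<le> (\<Sum>j\<in>UNIV. norm (z $ j))"
  unfolding norm_vec_def by (rule L2_set_le_sum) simp

lemma H1_norm_le:
  fixes f :: "real ^ 'n \<Rightarrow> complex"
  assumes f: "f \<in> local_hardy_h1" and U: "U_half f g"
  shows "H1_norm g \<le> (2 + CARD('n) * (7 * gauss_const TYPE('n) + sqrt (2 ^ CARD('n)))) * h1_norm f"
proof -
  define C where "C = 7 * gauss_const TYPE('n) + sqrt (2 ^ CARD('n))"
  have C0: "0 \<le> C" using gauss_const_ge(3)[where 'n = 'n] by (simp add: C_def)
  define C' where "C' = 2 + CARD('n) * C"
  have C': "0 < C'" using C0 by (simp add: C'_def add_pos_nonneg)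
  from U have fi: "integrable lborel f" and g: "integrable lborel g"
    by (auto simp: U_half_def fourier_multiplier_def)
  define G where "G = (SOME G. riesz_gradient g G)"
  have "\<exists>G. riesz_gradient g G" using U_half_in_hardy[OF f U] by (simp add: hardy_H1_def)
  then have G: "riesz_gradient g G" unfolding G_def by (rule someI_ex)
  have le: "H1_norm g \<le> C' * (\<Sum>k. norm (l k))" if d: "atomic_decomposition f l a" for l a
  proof -
    let ?S = "\<Sum>k. norm (l k)"
    obtain g' where g': "U_half f g'" "norm1 g' \<le> 2 * norm1 f"
      by (rule U_half_exists[OF fi])
    have g'i: "integrable lborel g'" using g'(1) by (auto simp: U_half_def fourier_multiplier_def)
    have "norm1 g = norm1 g'"
      using fourier_multiplier_unique[OF U[unfolded U_half_def] g'(1)[unfolded U_half_def]] g g'i by (intro integral_cong_AE) (auto elim: eventually_mono)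
    also have "\<dots> \<le> 2 * ?S" using g'(2) atomic_norm[OF fi d] by linarith
    finally have 1: "norm1 g \<le> 2 * ?S" .
    obtain H where H: "\<And>j. fourier_multiplier (\<lambda>\<xi>. \<i> * complex_of_real (\<xi> $ j / norm \<xi>)) g (H j)"
      "\<And>j. (LINT x|lborel. norm (H j x)) \<le> C * ?S"
      by (rule U_half_gradient[OF U d]) (use C_def in blast)
    have Gi: "integrable lborel (\<lambda>x. G x $ j)" for j
      using G by (auto simp: riesz_gradient_def fourier_multiplier_def)
    have Gj: "(LINT x|lborel. norm (G x $ j)) \<le> C * ?S" for j
    proof -
      have "AE x in lborel. G x $ j = H j x"
        using G H(1)[of j] by (intro fourier_multiplier_unique) (auto simp: riesz_gradient_def)
      then have "(LINT x|lborel. norm (G x $ j)) = norm1 (H j)"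
        using Gi[of j] H(1)[of j] by (intro integral_cong_AE) (auto simp: fourier_multiplier_def elim: eventually_mono)
      with H(2)[of j] show ?thesis by simp
    qed
    have "norm1 G \<le> (LINT x|lborel. (\<Sum>j\<in>UNIV. norm (G x $ j)))"
      by (rule integral_mono_AE') (use Gi in \<open>auto intro!: AE_I2 norm_vec_le_sum sum_nonneg\<close>)
    also have "\<dots> = (\<Sum>j\<in>UNIV. (LINT x|lborel. norm (G x $ j)))"
      using Gi by (intro Bochner_Integration.integral_sum) auto
    also have "\<dots> \<le> (\<Sum>j\<in>(UNIV :: 'n set). C * ?S)" by (rule sum_mono) (rule Gj)
    finally have "norm1 G \<le> CARD('n) * C * ?S" by simp
    with 1 show ?thesis
      unfolding H1_norm_def G_def[symmetric] C'_def by (simp add: distrib_right)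
  qed
  have "H1_norm g / C' \<le> h1_norm f"
    unfolding h1_norm_def
  proof (rule cInf_greatest)
    show "{\<Sum>j. norm (l j) | l a. atomic_decomposition f l a} \<noteq> {}"
      using f by (auto simp: local_hardy_h1_def)
  qed (use le C' in \<open>auto simp: divide_le_eq mult.commute\<close>)
  then show ?thesis
    using C' unfolding C'_def C_def by (simp add: divide_le_eq mult.commute)
qed

theorem proposition2p2:
  shows "(\<forall>f \<in> (local_hardy_h1 :: (real ^ 'n \<Rightarrow> complex) set). \<exists>g \<in> hardy_H1. U_half f g) \<and>
    (\<exists>C. \<forall>f \<in> (local_hardy_h1 :: (real ^ 'n \<Rightarrow> complex) set). \<forall>g.
       U_half f g \<longrightarrow> g \<in> hardy_H1 \<and> H1_norm g \<le> C * h1_norm f) \<and>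
    (\<forall>f1 \<in> (local_hardy_h1 :: (real ^ 'n \<Rightarrow> complex) set). \<forall>f2 \<in> local_hardy_h1. \<forall>g.
       U_half f1 g \<and> U_half f2 g \<longrightarrow> (AE x in lborel. f1 x = f2 x)) \<and>
    \<not> (\<forall>g \<in> (hardy_H1 :: (real ^ 'n \<Rightarrow> complex) set). \<exists>f \<in> local_hardy_h1. U_half f g) \<and>
    {g :: real ^ 'n \<Rightarrow> complex. \<exists>f \<in> local_hardy_h1. U_half f g} \<subset> hardy_H1"
proof (intro conjI)
  show "\<forall>f \<in> (local_hardy_h1 :: (real ^ 'n \<Rightarrow> complex) set). \<exists>g \<in> hardy_H1. U_half f g"
  proof
    fix f :: "real ^ 'n \<Rightarrow> complex" assume f: "f \<in> local_hardy_h1"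
    then have "integrable lborel f" by (simp add: local_hardy_h1_def)
    then obtain g where "U_half f g" by (rule U_half_exists)
    with U_half_in_hardy[OF f this] show "\<exists>g \<in> hardy_H1. U_half f g" by blast
  qed
  show "\<exists>C. \<forall>f \<in> (local_hardy_h1 :: (real ^ 'n \<Rightarrow> complex) set). \<forall>g.
       U_half f g \<longrightarrow> g \<in> hardy_H1 \<and> H1_norm g \<le> C * h1_norm f"
    using U_half_in_hardy H1_norm_le by blast
  show "\<forall>f1 \<in> (local_hardy_h1 :: (real ^ 'n \<Rightarrow> complex) set). \<forall>f2 \<in> local_hardy_h1. \<forall>g.
       U_half f1 g \<and> U_half f2 g \<longrightarrow> (AE x in lborel. f1 x = f2 x)"
    using U_half_inj by blast
  show "\<not> (\<forall>g \<in> (hardy_H1 :: (real ^ 'n \<Rightarrow> complex) set). \<exists>f \<in> local_hardy_h1. U_half f g)"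
    using dgauss_in_hardy no_preimage_dgauss by blast
  show "{g :: real ^ 'n \<Rightarrow> complex. \<exists>f \<in> local_hardy_h1. U_half f g} \<subset> hardy_H1"
    using U_half_in_hardy dgauss_in_hardy no_preimage_dgauss by blast
qed

end
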